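(* There exist a natural number $d\in\mathbb{N}$, a globally bounded and infinitely often differentiable function $\mu=(\mu_1,\ldots,\mu_d)\colon\mathbb{R}^d\to\mathbb{R}^d$, a symmetric nonnegative matrix $A=(A_{i,j})_{i,j\in\{1,\ldots,d\}}\in\mathbb{R}^{d\times d}$ and an infinitely often differentiable function $\varphi\colon\mathbb{R}^d\to\mathbb{R}$ with compact support such that there exists no globally bounded classical solution of the PDE $$\frac{\partial}{\partial t}u(t,x)=\sum_{i,j=1}^{d}A_{i,j}\cdot\frac{\partial^2}{\partial x_i\,\partial x_j}u(t,x)+\sum_{i=1}^{d}\mu_i(x)\cdot\frac{\partial}{\partial x_i}u(t,x),\qquad u(0,x)=\varphi(x),$$ for $(t,x)\in(0,\infty)\times\mathbb{R}^d$. In addition, there exists a unique globally bounded viscosity solution $u\colon[0,\infty)\times\mathbb{R}^d\to\mathbb{R}$ of this PDE (with this initial condition), and this function $u$ fails to be locally Hölder continuous.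
   Context: A globally bounded classical solution is a globally bounded continuous function $u\colon[0,\infty)\times\mathbb{R}^d\to\mathbb{R}$ with $u(0,\cdot)=\varphi$ whose restriction to $(0,\infty)\times\mathbb{R}^d$ is once continuously differentiable in $t$ and twice continuously differentiable in $x$ and satisfies the PDE pointwise there. A globally bounded viscosity solution $u\colon[0,\infty)\times\mathbb{R}^d\to\mathbb{R}$ is a globally bounded continuous function with $u(0,x)=\varphi(x)$ for all $x\in\mathbb{R}^d$ such that $u|_{(0,\infty)\times\mathbb{R}^d}$ is a viscosity solution of $\frac{\partial}{\partial t}u-\sum_{i,j}A_{i,j}\frac{\partial^2}{\partial x_i\partial x_j}u-\sum_i\mu_i\frac{\partial}{\partial x_i}u=0$ in the following sense. Viscosity solutions: for $n\in\mathbb{N}$ let $\mathbb{S}_n$ be the set of symmetric real $n\times n$ matrices, with $A\le B$ iff $\langle x,Ax\rangle\le\langle x,Bx\rangle$ for all $x\in\mathbb{R}^n$. Let $U\subset\mathbb{R}^n$ be open. A function $F\colon U\times\mathbb{R}\times\mathbb{R}^n\times\mathbb{S}_n\to\mathbb{R}$ is degenerate elliptic if $F(z,r,p,A)\le F(z,r,p,B)$ whenever $A\ge B$. For such $F$, a function $u\colon U\to\mathbb{R}$ is a viscosity subsolution of $F=0$ if $u$ is upper semicontinuous and $F(z,\phi(z),(\nabla\phi)(z),(\operatorname{Hess}\phi)(z))\le0$ for all $z\in U$ and all $\phi\in C^2(U,\mathbb{R})$ with $\phi\ge u$ and $\phi(z)=u(z)$; it is a viscosity supersolution of $F=0$ if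 $u$ is lower semicontinuous and $F(z,\phi(z),(\nabla\phi)(z),(\operatorname{Hess}\phi)(z))\ge0$ for all $z\in U$ and all $\phi\in C^2(U,\mathbb{R})$ with $\phi\le u$ and $\phi(z)=u(z)$; it is a viscosity solution if it is both. Here this is applied with $U=(0,\infty)\times\mathbb{R}^d\subset\mathbb{R}^{d+1}$ and $z=(t,x)$. A function is locally Hölder continuous if every point has a neighborhood on which it is Hölder continuous with some exponent in $(0,1]$. *)

theory Defs
  imports "HOL-Analysis.Analysis"
begin

text \<open>
  The dimension is existentially quantified in the theorem, so it cannot be a type.
  The space $R^n$ is the carrier of the library's \<^const>\<open>Euclidean_space\<close>: the functions
  \<^typ>\<open>nat \<Rightarrow> real\<close> that vanish at all indices \<open>i \<ge> n\<close>; coordinates are numbered from 0.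
  Its topology is the one induced by the type class topology (lemma below), so
  \<^const>\<open>continuous_on\<close>, \<^const>\<open>compact\<close> and \<^const>\<open>closure\<close> have their usual meaning.  The type
  class \<^emph>\<open>metric\<close> on \<^typ>\<open>nat \<Rightarrow> real\<close> is not the Euclidean one and is not used; Euclidean
  lengths are written with \<^const>\<open>L2_set\<close>.
\<close>

abbreviation Rn :: "nat \<Rightarrow> (nat \<Rightarrow> real) set" where
  "Rn n \<equiv> topspace (Euclidean_space n)"

lemma Euclidean_space_eq_top_of_set: "Euclidean_space n = top_of_set (Rn n)"
  by (simp add: Euclidean_space_def euclidean_product_topology)


subsection \<open>Differentiability\<close>

definition has_partial :: "nat \<Rightarrow> ((nat \<Rightarrow> real) \<Rightarrow> real) \<Rightarrow> (nat \<Rightarrow> real) \<Rightarrow> bool" where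
  "has_partial i f x \<longleftrightarrow> (\<lambda>s. f (x(i := s))) differentiable (at (x i))"

definition partial :: "nat \<Rightarrow> ((nat \<Rightarrow> real) \<Rightarrow> real) \<Rightarrow> (nat \<Rightarrow> real) \<Rightarrow> real" where
  "partial i f x = deriv (\<lambda>s. f (x(i := s))) (x i)"

text \<open>\<open>C_diff n U k f\<close>: \<open>f\<close> is of class $C^k$ on the open subset \<open>U\<close> of $R^n$, that is, all
  iterated partial derivatives up to order \<open>k\<close> exist and are continuous on \<open>U\<close>.\<close>

primrec C_diff :: "nat \<Rightarrow> (nat \<Rightarrow> real) set \<Rightarrow> nat \<Rightarrow> ((nat \<Rightarrow> real) \<Rightarrow> real) \<Rightarrow> bool" where
  "C_diff n U 0 f \<longleftrightarrow> continuous_on U f"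
| "C_diff n U (Suc k) f \<longleftrightarrow> continuous_on U f \<and>
     (\<forall>i<n. (\<forall>x\<in>U. has_partial i f x) \<and> C_diff n U k (partial i f))"

definition C_infinity :: "nat \<Rightarrow> ((nat \<Rightarrow> real) \<Rightarrow> real) \<Rightarrow> bool" where
  "C_infinity n f \<longleftrightarrow> (\<forall>k. C_diff n (Rn n) k f)"

definition gradient :: "nat \<Rightarrow> ((nat \<Rightarrow> real) \<Rightarrow> real) \<Rightarrow> (nat \<Rightarrow> real) \<Rightarrow> nat \<Rightarrow> real" where
  "gradient n f x = (\<lambda>i. if i < n then partial i f x else 0)"

definition Hess :: "nat \<Rightarrow> ((nat \<Rightarrow> real) \<Rightarrow> real) \<Rightarrow> (nat \<Rightarrow> real) \<Rightarrow> nat \<Rightarrow> nat \<Rightarrow> real" where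
  "Hess n f x = (\<lambda>i j. if i < n \<and> j < n then partial i (partial j f) x else 0)"


subsection \<open>Symmetric matrices\<close>

definition sym_mats :: "nat \<Rightarrow> (nat \<Rightarrow> nat \<Rightarrow> real) set" where
  "sym_mats n = {M. (\<forall>i j. M i j = M j i) \<and> (\<forall>i j. n \<le> i \<or> n \<le> j \<longrightarrow> M i j = 0)}"

definition mat_le :: "nat \<Rightarrow> (nat \<Rightarrow> nat \<Rightarrow> real) \<Rightarrow> (nat \<Rightarrow> nat \<Rightarrow> real) \<Rightarrow> bool" where
  "mat_le n M N \<longleftrightarrow>
     (\<forall>x\<in>Rn n. (\<Sum>i<n. x i * (\<Sum>j<n. M i j * x j)) \<le> (\<Sum>i<n. x i * (\<Sum>j<n. N i j * x j)))"


subsection \<open>Viscosity solutions\<close>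

type_synonym nonlinearity =
  "(nat \<Rightarrow> real) \<Rightarrow> real \<Rightarrow> (nat \<Rightarrow> real) \<Rightarrow> (nat \<Rightarrow> nat \<Rightarrow> real) \<Rightarrow> real"

definition degenerate_elliptic :: "nat \<Rightarrow> (nat \<Rightarrow> real) set \<Rightarrow> nonlinearity \<Rightarrow> bool" where
  "degenerate_elliptic n U F \<longleftrightarrow>
     (\<forall>z\<in>U. \<forall>r. \<forall>p\<in>Rn n. \<forall>M\<in>sym_mats n. \<forall>N\<in>sym_mats n.
        mat_le n N M \<longrightarrow> F z r p M \<le> F z r p N)"

definition usc_on :: "(nat \<Rightarrow> real) set \<Rightarrow> ((nat \<Rightarrow> real) \<Rightarrow> real) \<Rightarrow> bool" where
  "usc_on U u \<longleftrightarrow> (\<forall>c. openin (top_of_set U) {z \<in> U. u z < c})"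

definition lsc_on :: "(nat \<Rightarrow> real) set \<Rightarrow> ((nat \<Rightarrow> real) \<Rightarrow> real) \<Rightarrow> bool" where
  "lsc_on U u \<longleftrightarrow> (\<forall>c. openin (top_of_set U) {z \<in> U. c < u z})"

text \<open>Sub- and supersolutions are defined only for open \<open>U\<close> and degenerate elliptic \<open>F\<close>;
  these standing hypotheses are part of the predicates.\<close>

definition viscosity_subsolution ::
    "nat \<Rightarrow> (nat \<Rightarrow> real) set \<Rightarrow> nonlinearity \<Rightarrow> ((nat \<Rightarrow> real) \<Rightarrow> real) \<Rightarrow> bool" where
  "viscosity_subsolution n U F u \<longleftrightarrow>
     openin (Euclidean_space n) U \<and> degenerate_elliptic n U F \<and> usc_on U u \<and>
     (\<forall>z\<in>U. \<forall>\<phi>. C_diff n U 2 \<phi> \<and> (\<forall>y\<in>U. u y \<le> \<phi> y) \<and> \<phi> z = u z \<longrightarrow>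
        F z (\<phi> z) (gradient n \<phi> z) (Hess n \<phi> z) \<le> 0)"

definition viscosity_supersolution ::
    "nat \<Rightarrow> (nat \<Rightarrow> real) set \<Rightarrow> nonlinearity \<Rightarrow> ((nat \<Rightarrow> real) \<Rightarrow> real) \<Rightarrow> bool" where
  "viscosity_supersolution n U F u \<longleftrightarrow>
     openin (Euclidean_space n) U \<and> degenerate_elliptic n U F \<and> lsc_on U u \<and>
     (\<forall>z\<in>U. \<forall>\<phi>. C_diff n U 2 \<phi> \<and> (\<forall>y\<in>U. \<phi> y \<le> u y) \<and> \<phi> z = u z \<longrightarrow>
        F z (\<phi> z) (gradient n \<phi> z) (Hess n \<phi> z) \<ge> 0)"

definition viscosity_solution ::
    "nat \<Rightarrow> (nat \<Rightarrow> real) set \<Rightarrow> nonlinearity \<Rightarrow> ((nat \<Rightarrow> real) \<Rightarrow> real) \<Rightarrow> bool" where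
  "viscosity_solution n U F u \<longleftrightarrow> viscosity_subsolution n U F u \<and> viscosity_supersolution n U F u"


subsection \<open>The Kolmogorov equation\<close>

definition bounded_continuous_with_initial ::
    "nat \<Rightarrow> ((nat \<Rightarrow> real) \<Rightarrow> real) \<Rightarrow> (real \<times> (nat \<Rightarrow> real) \<Rightarrow> real) \<Rightarrow> bool" where
  "bounded_continuous_with_initial d \<phi> u \<longleftrightarrow>
     bounded (u ` ({0..} \<times> Rn d)) \<and> continuous_on ({0..} \<times> Rn d) u \<and>
     (\<forall>x\<in>Rn d. u (0, x) = \<phi> x)"

definition time_deriv :: "(real \<times> (nat \<Rightarrow> real) \<Rightarrow> real) \<Rightarrow> real \<times> (nat \<Rightarrow> real) \<Rightarrow> real" where
  "time_deriv u = (\<lambda>(t, x). deriv (\<lambda>s. u (s, x)) t)"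

definition space_partial ::
    "nat \<Rightarrow> (real \<times> (nat \<Rightarrow> real) \<Rightarrow> real) \<Rightarrow> real \<times> (nat \<Rightarrow> real) \<Rightarrow> real" where
  "space_partial i u = (\<lambda>(t, x). partial i (\<lambda>y. u (t, y)) x)"

text \<open>The class $C^{1,2}((0,\infty) \times R^d)$, with derivatives jointly continuous in \<open>(t, x)\<close>.\<close>

definition C_1_2 :: "nat \<Rightarrow> (real \<times> (nat \<Rightarrow> real) \<Rightarrow> real) \<Rightarrow> bool" where
  "C_1_2 d u \<longleftrightarrow>
     (\<forall>t>0. \<forall>x\<in>Rn d. (\<lambda>s. u (s, x)) differentiable (at t)) \<and>
     continuous_on ({0<..} \<times> Rn d) (time_deriv u) \<and>
     (\<forall>i<d. (\<forall>t>0. \<forall>x\<in>Rn d. has_partial i (\<lambda>y. u (t, y)) x) \<and>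
        continuous_on ({0<..} \<times> Rn d) (space_partial i u)) \<and>
     (\<forall>i<d. \<forall>j<d. (\<forall>t>0. \<forall>x\<in>Rn d. has_partial i (\<lambda>y. space_partial j u (t, y)) x) \<and>
        continuous_on ({0<..} \<times> Rn d) (space_partial i (space_partial j u)))"

definition bounded_classical_solution ::
    "nat \<Rightarrow> ((nat \<Rightarrow> real) \<Rightarrow> nat \<Rightarrow> real) \<Rightarrow> (nat \<Rightarrow> nat \<Rightarrow> real) \<Rightarrow> ((nat \<Rightarrow> real) \<Rightarrow> real) \<Rightarrow>
     (real \<times> (nat \<Rightarrow> real) \<Rightarrow> real) \<Rightarrow> bool" where
  "bounded_classical_solution d \<mu> A \<phi> u \<longleftrightarrow>
     bounded_continuous_with_initial d \<phi> u \<and> C_1_2 d u \<and>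
     (\<forall>t>0. \<forall>x\<in>Rn d.
        time_deriv u (t, x) =
          (\<Sum>i<d. \<Sum>j<d. A i j * space_partial i (space_partial j u) (t, x)) +
          (\<Sum>i<d. \<mu> x i * space_partial i u (t, x)))"

text \<open>A point \<open>z = (t, x)\<close> of $R^{d+1}$ has \<open>t = z 0\<close> and \<open>x = (\<lambda>i. z (Suc i))\<close>.\<close>

definition spacetime :: "nat \<Rightarrow> (nat \<Rightarrow> real) set" where
  "spacetime d = {z \<in> Rn (Suc d). 0 < z 0}"

definition kolmogorov_op ::
    "nat \<Rightarrow> ((nat \<Rightarrow> real) \<Rightarrow> nat \<Rightarrow> real) \<Rightarrow> (nat \<Rightarrow> nat \<Rightarrow> real) \<Rightarrow> nonlinearity" where
  "kolmogorov_op d \<mu> A z r p M =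
     p 0 - (\<Sum>i<d. \<Sum>j<d. A i j * M (Suc i) (Suc j))
         - (\<Sum>i<d. \<mu> (\<lambda>k. z (Suc k)) i * p (Suc i))"

definition bounded_viscosity_solution ::
    "nat \<Rightarrow> ((nat \<Rightarrow> real) \<Rightarrow> nat \<Rightarrow> real) \<Rightarrow> (nat \<Rightarrow> nat \<Rightarrow> real) \<Rightarrow> ((nat \<Rightarrow> real) \<Rightarrow> real) \<Rightarrow>
     (real \<times> (nat \<Rightarrow> real) \<Rightarrow> real) \<Rightarrow> bool" where
  "bounded_viscosity_solution d \<mu> A \<phi> u \<longleftrightarrow>
     bounded_continuous_with_initial d \<phi> u \<and>
     viscosity_solution (Suc d) (spacetime d) (kolmogorov_op d \<mu> A)
       (\<lambda>z. u (z 0, \<lambda>i. z (Suc i)))"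


subsection \<open>Local Hoelder continuity\<close>

definition euclid_dist :: "nat \<Rightarrow> real \<times> (nat \<Rightarrow> real) \<Rightarrow> real \<times> (nat \<Rightarrow> real) \<Rightarrow> real" where
  "euclid_dist d = (\<lambda>(t, x) (s, y). sqrt ((t - s)\<^sup>2 + (L2_set (\<lambda>i. x i - y i) {..<d})\<^sup>2))"

definition hoelder_on ::
    "nat \<Rightarrow> real \<Rightarrow> (real \<times> (nat \<Rightarrow> real)) set \<Rightarrow> (real \<times> (nat \<Rightarrow> real) \<Rightarrow> real) \<Rightarrow> bool" where
  "hoelder_on d \<alpha> S u \<longleftrightarrow>
     (\<exists>C. \<forall>p\<in>S. \<forall>q\<in>S. \<bar>u p - u q\<bar> \<le> C * euclid_dist d p q powr \<alpha>)"

definition locally_hoelder :: "nat \<Rightarrow> (real \<times> (nat \<Rightarrow> real) \<Rightarrow> real) \<Rightarrow> bool" where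
  "locally_hoelder d u \<longleftrightarrow>
     (\<forall>p \<in> {0..} \<times> Rn d. \<exists>V \<alpha>. openin (top_of_set ({0..} \<times> Rn d)) V \<and> p \<in> V \<and>
        0 < \<alpha> \<and> \<alpha> \<le> 1 \<and> hoelder_on d \<alpha> V u)"

end

theory Submission
  imports Defs "HOL-Probability.Probability" "HOL-Real_Asymp.Real_Asymp"
begin

text \<open>
  The equation is \<open>u\<^sub>t = u\<^sub>x\<^sub>x + b(x, y) u\<^sub>x\<close> in dimension 2, so that \<open>y\<close> is a mere parameter.
  The drift \<open>b(\<cdot>, y)\<close> vanishes for \<open>y \<le> 0\<close>; for \<open>y > 0\<close> it is a fixed profile, zero on the left
  half-line, translated by \<open>\<ell>(y) = ln (1 + (ln y)\<^sup>2)\<close>.  As \<open>\<ell>(y) \<rightarrow> \<infinity>\<close> for \<open>y \<rightarrow> 0\<close>, the drift is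
  locally zero near \<open>y = 0\<close>, hence smooth.  But heat started near the origin sees it: the chance of
  reaching \<open>x = \<ell>(y)\<close> by time 1 is about \<open>exp (- c \<ell>(y)\<^sup>2)\<close>, which is much larger than every
  positive power of \<open>y\<close>, so \<open>u(1, x, \<cdot>)\<close> is not Hoelder continuous at 0.

  Writing \<open>b = 2 h\<^sub>x / h\<close> with \<open>h\<close> convex in \<open>x\<close> and \<open>h \<ge> 1\<close>, the function \<open>v = u h\<close> solves
  \<open>v\<^sub>t = v\<^sub>x\<^sub>x - (h\<^sub>x\<^sub>x / h) v\<close> with a bounded nonnegative potential.  The Dyson series of
  \<open>exp (M t) v\<close> has nonnegative terms; it gives boundedness and smoothness of each slice, joint
  continuity in \<open>y\<close>, and, through its first-order term, the lower bound on \<open>u(1, x, 0) - u(1, x, y)\<close>.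

  A function whose slices solve the equation classically is a viscosity solution.  Conversely, a
  smooth slice plus \<open>(y - y\<^sub>0)\<^sup>2 / \<epsilon>\<close> and a small penalty at infinity is an admissible test function,
  so any bounded viscosity solution agrees with it.  A classical solution is a viscosity solution
  differentiable in \<open>y\<close>, and therefore cannot exist.
\<close>

section \<open>Gaussian averages\<close>

text \<open>Perturbing the heat flow by the drift term itself would put a space derivative, hence a
  singular kernel, into every term of the series, and the terms would have no sign. A potential is a
  bounded multiplier: each term is an iterated average of bounded functions, differentiating it in x
  only differentiates the data, and once the potential is nonnegative a single term bounds the whole
  difference from below. That term replaces the probability of reaching the drift, so no stochastic
  process is needed. The growth \<open>exp (M t)\<close> of the series is exactly what the change of
  unknown takes away again, which gives the global bound. Uniqueness cannot test a viscosity
  solution against the constructed one, since the latter is not differentiable in y. Freezing y = y0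
  is possible because the equation has no y-derivative. The price is the error
  \<open>(b y x - b y0 x) * u_x\<close>, which must be small where the test function touches, and
  this decides in which order the constants of \<open>comparison\<close> are chosen.\<close>

definition gauss :: "real measure" where
  "gauss = density lborel (\<lambda>z. ennreal (std_normal_density z))"

text \<open>The heat flow of \<open>u_t = u_xx\<close> at time t has scale
  \<open>c = sqrt (2 * t)\<close>. Keeping c as the variable avoids the singularity of the root at t
  = 0. As \<open>sqrt\<close> is total and continuous on the reals, negative times make sense too
  and continuity can be stated on \<open>UNIV\<close>.\<close>

definition gauss_avg :: "(real \<Rightarrow> real) \<Rightarrow> real \<Rightarrow> real \<Rightarrow> real" where
  "gauss_avg f c x = (\<integral>z. f (x + c * z) \<partial>gauss)"

lemma prob_space_gauss: "prob_space gauss"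
  unfolding gauss_def by (rule prob_space_normal_density) simp

interpretation gauss: prob_space gauss
  by (rule prob_space_gauss)

lemma sets_gauss [simp, measurable_cong]: "sets gauss = sets borel"
  by (simp add: gauss_def)

lemma space_gauss [simp]: "space gauss = UNIV"
  by (simp add: gauss_def)

lemma prob_gauss_UNIV [simp]: "gauss.prob UNIV = 1"
  using gauss.prob_space by simp

lemma integrable_gauss_bounded:
  fixes f :: "real \<Rightarrow> real"
  assumes "f \<in> borel_measurable borel" "\<And>z. \<bar>f z\<bar> \<le> B"
  shows "integrable gauss f"
  using assms by (intro gauss.integrable_const_bound[where B = B]) (auto simp: gauss_def)

lemma integrable_gauss_abs: "integrable gauss (\<lambda>z. \<bar>z\<bar>)"
proof -
  have "integrable lborel (\<lambda>z. std_normal_density z * \<bar>z\<bar> ^ 1)"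
    by (rule integrable_std_normal_moment_abs)
  then show ?thesis
    unfolding gauss_def by (subst integrable_density) auto
qed

lemma borel_measurable_affine:
  fixes f :: "real \<Rightarrow> real"
  assumes "continuous_on UNIV f"
  shows "(\<lambda>z. f (x + c * z)) \<in> borel_measurable borel"
  by (intro borel_measurable_continuous_onI continuous_on_compose2[OF assms] continuous_intros) auto

lemma integrable_gauss_avg:
  fixes f :: "real \<Rightarrow> real"
  assumes "continuous_on UNIV f" "\<And>x. \<bar>f x\<bar> \<le> B"
  shows "integrable gauss (\<lambda>z. f (x + c * z))"
  using assms borel_measurable_affine by (intro integrable_gauss_bounded[where B=B]) auto

lemma gauss_avg_abs_le:
  assumes "continuous_on UNIV f" "\<And>x. \<bar>f x\<bar> \<le> B"
  shows "\<bar>gauss_avg f c x\<bar> \<le> B"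
proof -
  have "\<bar>gauss_avg f c x\<bar> \<le> (\<integral>z. \<bar>f (x + c * z)\<bar> \<partial>gauss)"
    unfolding gauss_avg_def by (rule integral_abs_bound)
  also have "\<dots> \<le> (\<integral>z. B \<partial>gauss)"
    using assms integrable_gauss_avg[OF assms] by (intro integral_mono integrable_abs) auto
  finally show ?thesis by simp
qed

lemma gauss_avg_nonneg: "(\<And>x. 0 \<le> f x) \<Longrightarrow> 0 \<le> gauss_avg f c x"
  unfolding gauss_avg_def by (rule Bochner_Integration.integral_nonneg) auto

lemma gauss_avg_zero [simp]: "gauss_avg f 0 x = f x"
  by (simp add: gauss_avg_def)

lemma tendsto_gauss_integral:
  fixes s :: "nat \<Rightarrow> real \<Rightarrow> real"
  assumes "\<And>n. s n \<in> borel_measurable borel" "f \<in> borel_measurable borel"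
    and "integrable gauss w" and "\<And>z. (\<lambda>n. s n z) \<longlonglongrightarrow> f z" and "\<And>n z. \<bar>s n z\<bar> \<le> w z"
  shows "(\<lambda>n. \<integral>z. s n z \<partial>gauss) \<longlonglongrightarrow> (\<integral>z. f z \<partial>gauss)"
  using assms by (intro integral_dominated_convergence[where w=w]) (auto simp: measurable_cong_sets[OF sets_gauss refl])

text \<open>The bound may vary with p: along a convergent sequence the continuous
  \<open>\<beta>\<close> stays bounded, which supplies a constant majorant for dominated
  convergence.\<close>

lemma continuous_gauss_avg:
  fixes F :: "'a::metric_space \<Rightarrow> real \<Rightarrow> real"
  assumes F: "continuous_on UNIV (\<lambda>(p, x). F p x)"
    and \<beta>: "continuous_on UNIV \<beta>" "\<And>p x. \<bar>F p x\<bar> \<le> \<beta> p"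
  shows "continuous_on UNIV (\<lambda>(p, c, x). gauss_avg (F p) c x)"
  unfolding continuous_on_sequentially
proof (intro ballI allI impI, elim conjE)
  fix a :: "'a \<times> real \<times> real" and u :: "nat \<Rightarrow> 'a \<times> real \<times> real"
  assume u: "u \<longlonglongrightarrow> a"
  obtain p c x where a: "a = (p, c, x)" by (cases a)
  define P C X where "P n = fst (u n)" "C n = fst (snd (u n))" "X n = snd (snd (u n))" for n
  have u_eq: "u n = (P n, C n, X n)" for n by (simp add: P_C_X_def)
  have lims: "P \<longlonglongrightarrow> p" "C \<longlonglongrightarrow> c" "X \<longlonglongrightarrow> x"
    using tendsto_fst[OF u] tendsto_fst[OF tendsto_snd[OF u]] tendsto_snd[OF tendsto_snd[OF u]]
    by (simp_all add: P_C_X_def[abs_def] a)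
  have Fc: "continuous_on UNIV (F p)" for p
    using continuous_on_compose2[OF F continuous_on_Pair[OF continuous_on_const continuous_on_id]]
    by (simp add: subset_UNIV)
  have "(\<lambda>n. \<beta> (P n)) \<longlonglongrightarrow> \<beta> p"
    using \<beta>(1) lims(1) by (rule continuous_on_tendsto_compose) auto
  then have "Bseq (\<lambda>n. \<beta> (P n))"
    by (intro convergent_imp_Bseq convergentI)
  then obtain K where K: "\<And>n. \<bar>\<beta> (P n)\<bar> \<le> K"
    by (auto simp: Bseq_def)
  have "(\<lambda>n. \<integral>z. F (P n) (X n + C n * z) \<partial>gauss) \<longlonglongrightarrow> (\<integral>z. F p (x + c * z) \<partial>gauss)"
  proof (rule tendsto_gauss_integral[where w = "\<lambda>_. K"])
    show "(\<lambda>n. F (P n) (X n + C n * z)) \<longlonglongrightarrow> F p (x + c * z)" for z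
    proof -
      have "(\<lambda>n. (P n, X n + C n * z)) \<longlonglongrightarrow> (p, x + c * z)"
        by (intro tendsto_intros lims)
      from continuous_on_tendsto_compose[OF F this] show ?thesis by simp
    qed
    show "\<bar>F (P n) (X n + C n * z)\<bar> \<le> K" for n z
      using \<beta>(2)[of "P n" "X n + C n * z"] K[of n] by linarith
  qed (use Fc borel_measurable_affine in auto)
  then show "((\<lambda>(p, c, x). gauss_avg (F p) c x) \<circ> u) \<longlonglongrightarrow> (\<lambda>(p, c, x). gauss_avg (F p) c x) a"
    by (simp add: comp_def u_eq a gauss_avg_def)
qed

text \<open>Dominated convergence for difference quotients, with the majorant from the mean value
  inequality. W depends on z because differentiating in the scale brings out a factor z.\<close>

lemma has_derivative_gauss_integral:
  fixes g g' :: "real \<Rightarrow> real \<Rightarrow> real"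
  assumes der: "\<And>s z. (g z has_real_derivative g' z s) (at s)"
    and bd: "\<And>s z. \<bar>g' z s\<bar> \<le> W z" and W: "integrable gauss W"
    and int: "\<And>s. integrable gauss (\<lambda>z. g z s)"
    and meas: "\<And>s. (\<lambda>z. g' z s) \<in> borel_measurable borel"
  shows "((\<lambda>s. \<integral>z. g z s \<partial>gauss) has_real_derivative (\<integral>z. g' z s \<partial>gauss)) (at s)"
  unfolding DERIV_def tendsto_at_iff_sequentially
proof (intro allI impI)
  fix h :: "nat \<Rightarrow> real"
  assume h0: "\<forall>i. h i \<in> UNIV - {0}" and h: "h \<longlonglongrightarrow> 0"
  have "(\<lambda>n. \<integral>z. (g z (s + h n) - g z s) / h n \<partial>gauss) \<longlonglongrightarrow> (\<integral>z. g' z s \<partial>gauss)"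
  proof (rule tendsto_gauss_integral[where w = W])
    show "(\<lambda>z. (g z (s + h n) - g z s) / h n) \<in> borel_measurable borel" for n
      using int[THEN borel_measurable_integrable] by (auto simp: measurable_cong_sets[OF sets_gauss refl])
    show "(\<lambda>n. (g z (s + h n) - g z s) / h n) \<longlonglongrightarrow> g' z s" for z
      using der[of z s] h0 h unfolding DERIV_def tendsto_at_iff_sequentially
      by (auto simp: comp_def)
    show "\<bar>(g z (s + h n) - g z s) / h n\<bar> \<le> W z" for n z
    proof -
      have "norm (g z (s + h n) - g z s) \<le> W z * norm ((s + h n) - s)"
        by (rule field_differentiable_bound[where S = UNIV and f' = "\<lambda>s. g' z s"])
          (use der bd in auto)
      then show ?thesis using h0 by (simp add: field_simps abs_divide)
    qed
  qed (use meas W in auto)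
  moreover have "(\<integral>z. (g z (s + h n) - g z s) / h n \<partial>gauss)
      = ((\<integral>z. g z (s + h n) \<partial>gauss) - (\<integral>z. g z s \<partial>gauss)) / h n" for n
    using int by (simp add: Bochner_Integration.integral_diff)
  ultimately show "((\<lambda>h. ((\<integral>z. g z (s + h) \<partial>gauss) - (\<integral>z. g z s \<partial>gauss)) / h) \<circ> h)
      \<longlonglongrightarrow> (\<integral>z. g' z s \<partial>gauss)"
    by (simp only: comp_def)
qed

lemma DERIV_gauss_avg:
  assumes "\<And>x. (f has_real_derivative f' x) (at x)" "\<And>x. \<bar>f x\<bar> \<le> B"
    and "continuous_on UNIV f'" "\<And>x. \<bar>f' x\<bar> \<le> B'"
  shows "(gauss_avg f c has_real_derivative gauss_avg f' c x) (at x)"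
proof -
  have "continuous_on UNIV f"
    using assms(1) by (intro DERIV_continuous_on) (auto intro: has_field_derivative_at_within)
  moreover have "((\<lambda>x. f (x + c * z)) has_real_derivative f' (x + c * z)) (at x)" for x z
    by (rule DERIV_cong[OF DERIV_chain2[OF assms(1)]], (rule derivative_eq_intros refl | simp)+)
  ultimately show ?thesis
    unfolding gauss_avg_def
    by (intro has_derivative_gauss_integral[where W = "\<lambda>_. B'"] borel_measurable_affine)
      (use assms integrable_gauss_avg[of f B] in auto)
qed

text \<open>Stein's identity: the Gaussian density has derivative - z times itself, and the boundary
  terms vanish because f is bounded.\<close>

lemma gauss_integral_by_parts:
  assumes f: "\<And>x. (f has_real_derivative f' x) (at x)" "\<And>x. \<bar>f x\<bar> \<le> B"
    and f': "continuous_on UNIV f'" "\<And>x. \<bar>f' x\<bar> \<le> B'"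
  shows "(\<integral>z. z * f z \<partial>gauss) = (\<integral>z. f' z \<partial>gauss)"
proof -
  let ?\<gamma> = std_normal_density
  have B: "0 \<le> B" using f(2)[of 0] by linarith
  have fc: "continuous_on UNIV f"
    using f(1) by (intro DERIV_continuous_on) (auto intro: has_field_derivative_at_within)
  have fm: "f \<in> borel_measurable borel" "f' \<in> borel_measurable borel"
    using fc f' by (auto intro: borel_measurable_continuous_onI)
  have i1: "integrable lborel (\<lambda>z. ?\<gamma> z * f' z)"
    using integrable_gauss_bounded[OF fm(2) f'(2)] fm
    unfolding gauss_def by (subst (asm) integrable_density) auto
  have "integrable gauss (\<lambda>z. z * f z)"
  proof (rule Bochner_Integration.integrable_bound[where f = "\<lambda>z. B * \<bar>z\<bar>"])
    show "AE z in gauss. norm (z * f z) \<le> norm (B * \<bar>z\<bar>)"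
    proof (rule AE_I2)
      fix z
      have "\<bar>z\<bar> * \<bar>f z\<bar> \<le> \<bar>z\<bar> * B" by (rule mult_left_mono[OF f(2)]) simp
      then show "norm (z * f z) \<le> norm (B * \<bar>z\<bar>)" using B by (simp add: abs_mult mult.commute)
    qed
  qed (use integrable_gauss_abs fm in auto)
  then have i2: "integrable lborel (\<lambda>z. ?\<gamma> z * (z * f z))"
    using fm unfolding gauss_def by (subst (asm) integrable_density) auto
  have d\<gamma>: "(?\<gamma> has_real_derivative - (z * ?\<gamma> z)) (at z)" for z
    unfolding std_normal_density_def
    by (rule derivative_eq_intros refl | simp)+
  let ?F' = "\<lambda>z. ?\<gamma> z * f' z - ?\<gamma> z * (z * f z)"
  have \<gamma>c: "continuous_on UNIV ?\<gamma>"
    unfolding std_normal_density_def by (intro continuous_intros) auto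
  have lim: "((\<lambda>z. ?\<gamma> z * f z) \<longlongrightarrow> 0) at_top" "((\<lambda>z. ?\<gamma> z * f z) \<longlongrightarrow> 0) at_bot"
  proof -
    have *: "(?\<gamma> \<longlongrightarrow> 0) at_top" "(?\<gamma> \<longlongrightarrow> 0) at_bot"
      unfolding std_normal_density_def by real_asymp+
    have "((\<lambda>z. ?\<gamma> z * B) \<longlongrightarrow> 0) F \<Longrightarrow> ((\<lambda>z. ?\<gamma> z * f z) \<longlongrightarrow> 0) F" for F
    proof (rule Lim_null_comparison[where g = "\<lambda>z. ?\<gamma> z * B"])
      show "\<forall>\<^sub>F z in F. norm (?\<gamma> z * f z) \<le> ?\<gamma> z * B"
        using f(2) by (intro always_eventually) (auto simp: abs_mult intro!: mult_left_mono)
    qed auto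
    then show "((\<lambda>z. ?\<gamma> z * f z) \<longlongrightarrow> 0) at_top" "((\<lambda>z. ?\<gamma> z * f z) \<longlongrightarrow> 0) at_bot"
      using *[THEN tendsto_mult_left_zero] by auto
  qed
  have "(LBINT z=-\<infinity>..\<infinity>. ?F' z) = 0 - 0"
  proof (rule interval_integral_FTC_integrable[where F = "\<lambda>z. ?\<gamma> z * f z"])
    show "((\<lambda>z. ?\<gamma> z * f z) has_vector_derivative ?F' z) (at z)" for z
      unfolding has_real_derivative_iff_has_vector_derivative[symmetric]
      by (rule derivative_eq_intros d\<gamma> f refl | simp)+
    show "isCont ?F' z" for z
      by (rule continuous_on_interior[where S = UNIV])
        (auto intro!: continuous_intros \<gamma>c f' fc)
    show "set_integrable lborel (einterval (- \<infinity>) \<infinity>) ?F'"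
      using i1 i2 by (simp add: set_integrable_def einterval_def)
    show "(((\<lambda>z. ?\<gamma> z * f z) \<circ> real_of_ereal) \<longlongrightarrow> 0) (at_right (- \<infinity>))"
      using lim(2) by (simp add: ereal_tendsto_simps)
    show "(((\<lambda>z. ?\<gamma> z * f z) \<circ> real_of_ereal) \<longlongrightarrow> 0) (at_left \<infinity>)"
      using lim(1) by (simp add: ereal_tendsto_simps)
  qed simp
  then have "(\<integral>z. ?F' z \<partial>lborel) = 0"
    by (simp add: interval_lebesgue_integral_def set_lebesgue_integral_def einterval_def)
  then have "(\<integral>z. ?\<gamma> z * f' z \<partial>lborel) = (\<integral>z. ?\<gamma> z * (z * f z) \<partial>lborel)"
    using i1 i2 by simp
  then show ?thesis
    unfolding gauss_def using fm by (subst (1 2) integral_density) auto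
qed

text \<open>The chain rule produces the average of \<open>z * f' (x + c * z)\<close>, and Stein's
  identity trades z for another derivative. This is the heat equation in the variable c: with
  \<open>c = sqrt (2 * t)\<close> the factor c cancels against dc/dt = 1/c.\<close>

lemma DERIV_gauss_avg_scale:
  assumes f: "\<And>x. (f has_real_derivative f' x) (at x)" "\<And>x. \<bar>f x\<bar> \<le> B"
    and f': "\<And>x. (f' has_real_derivative f'' x) (at x)" "\<And>x. \<bar>f' x\<bar> \<le> B'"
    and f'': "continuous_on UNIV f''" "\<And>x. \<bar>f'' x\<bar> \<le> B''"
  shows "((\<lambda>c. gauss_avg f c x) has_real_derivative c * gauss_avg f'' c x) (at c)"
proof -
  have fc: "continuous_on UNIV f" "continuous_on UNIV f'"
    using f(1) f'(1) by (auto intro!: DERIV_continuous_on intro: has_field_derivative_at_within)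
  have 1: "((\<lambda>c. gauss_avg f c x) has_real_derivative (\<integral>z. z * f' (x + c * z) \<partial>gauss)) (at c)"
    unfolding gauss_avg_def
  proof (rule has_derivative_gauss_integral[where W = "\<lambda>z. B' * \<bar>z\<bar>"])
    show "((\<lambda>c. f (x + c * z)) has_real_derivative z * f' (x + c * z)) (at c)" for z c
      by (rule DERIV_cong[OF DERIV_chain2[OF f(1)]], (rule derivative_eq_intros refl | simp)+)
    show "\<bar>z * f' (x + c * z)\<bar> \<le> B' * \<bar>z\<bar>" for z c
      using mult_left_mono[OF f'(2), of "\<bar>z\<bar>" "x + c * z"] by (simp add: abs_mult mult.commute)
    show "(\<lambda>z. z * f' (x + c * z)) \<in> borel_measurable borel" for c
      using borel_measurable_affine[OF fc(2)] by simp
  qed (use integrable_gauss_abs integrable_gauss_avg[OF fc(1) f(2)] in auto)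
  have "(\<integral>z. z * f' (x + c * z) \<partial>gauss) = (\<integral>z. c * f'' (x + c * z) \<partial>gauss)"
  proof (rule gauss_integral_by_parts)
    show "((\<lambda>z. f' (x + c * z)) has_real_derivative c * f'' (x + c * z)) (at z)" for z
      by (rule DERIV_cong[OF DERIV_chain2[OF f'(1)]], (rule derivative_eq_intros refl | simp)+)
    show "\<bar>c * f'' (x + c * z)\<bar> \<le> \<bar>c\<bar> * B''" for z
      by (simp add: abs_mult f'' mult_left_mono)
    show "continuous_on UNIV (\<lambda>z. c * f'' (x + c * z))"
      by (intro continuous_intros continuous_on_compose2[OF f''(1)]) auto
  qed (use f' in auto)
  also have "\<dots> = c * gauss_avg f'' c x" by (simp add: gauss_avg_def)
  finally show ?thesis using 1 by simp
qed

section \<open>Duhamel's formula\<close>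

lemma antiderivative_exists:
  fixes n :: "real \<Rightarrow> real"
  assumes "continuous_on UNIV n"
  obtains A where "\<And>s. (A has_real_derivative n s) (at s)"
proof -
  have "isCont n s" for s using assms by (simp add: continuous_on_eq_continuous_at)
  then have "\<exists>A. \<forall>s::real. -\<infinity> < ereal s \<longrightarrow> ereal s < \<infinity> \<longrightarrow> (A has_vector_derivative n s) (at s)"
    by (intro einterval_antiderivative) auto
  then show ?thesis
    using that by (auto simp: has_real_derivative_iff_has_vector_derivative)
qed

lemma scaled_integral_eq:
  fixes n :: "real \<Rightarrow> real"
  assumes A: "\<And>s. (A has_real_derivative n s) (at s)"
  shows "a * integral {0..1} (\<lambda>r. n (a * r)) = A a - A 0"
proof -
  have "((\<lambda>r. a * n (a * r)) has_integral A (a * 1) - A (a * 0)) {0..1}"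
  proof (rule fundamental_theorem_of_calculus)
    fix r :: real
    have "((\<lambda>r. A (a * r)) has_real_derivative a * n (a * r)) (at r)"
      by (rule DERIV_cong[OF DERIV_chain2[OF A]], (rule derivative_eq_intros refl | simp)+)
    then show "((\<lambda>r. A (a * r)) has_vector_derivative a * n (a * r)) (at r within {0..1})"
      by (simp add: has_real_derivative_iff_has_vector_derivative has_vector_derivative_at_within)
  qed simp
  then show ?thesis by (simp add: integral_unique flip: integral_mult_right)
qed

lemma DERIV_scaled_integral:
  fixes n :: "real \<Rightarrow> real"
  assumes "continuous_on UNIV n"
  shows "((\<lambda>a. a * integral {0..1} (\<lambda>r. n (a * r))) has_real_derivative n a) (at a)"
proof -
  obtain A where A: "\<And>s. (A has_real_derivative n s) (at s)"
    using antiderivative_exists[OF assms] by blast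
  show ?thesis
    unfolding scaled_integral_eq[OF A] by (rule derivative_eq_intros A refl | simp)+
qed

text \<open>The factor \<open>a\<close> and the unit interval replace the integral from \<open>0\<close> to \<open>a\<close>, so that
  the derivatives exist for all real \<open>a\<close> and \<open>t\<close> and not only one-sidedly at the diagonal.\<close>

lemma DERIV_convolution:
  fixes G G' :: "real \<Rightarrow> real \<Rightarrow> real"
  assumes G: "continuous_on UNIV (\<lambda>(s, \<tau>). G s \<tau>)"
    and G': "continuous_on UNIV (\<lambda>(s, \<tau>). G' s \<tau>)"
    and der: "\<And>s \<tau>. (G s has_real_derivative G' s \<tau>) (at \<tau>)"
  shows "((\<lambda>t. t * integral {0..1} (\<lambda>r. G (t * r) (t - t * r))) has_real_derivative
      G t 0 + t * integral {0..1} (\<lambda>r. G' (t * r) (t - t * r))) (at t)"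
proof -
  \<comment> \<open>K separates the two roles of t, as upper limit a and as final time, so that the
    claim is the chain rule along the diagonal a = t. Joint differentiability there needs one
    partial derivative at the point and the other one nearby and continuous.\<close>
  define K where "K t a = a * integral {0..1} (\<lambda>r. G (a * r) (t - a * r))" for t a
  have Gc: "continuous_on S (\<lambda>x. G (f x) (g x))" if "continuous_on S f" "continuous_on S g"
    for S and f g :: "'b::topological_space \<Rightarrow> real"
    using continuous_on_compose2[OF G continuous_on_Pair[OF that]] by simp
  have G'c: "continuous_on S (\<lambda>x. G' (f x) (g x))" if "continuous_on S f" "continuous_on S g"
    for S and f g :: "'b::topological_space \<Rightarrow> real"
    using continuous_on_compose2[OF G' continuous_on_Pair[OF that]] by simp
  have Kt: "((\<lambda>t. K t a) has_real_derivative a * integral {0..1} (\<lambda>r. G' (a * r) (t - a * r))) (at t)" for a t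
  proof -
    have "((\<lambda>t. integral (cbox 0 1) (\<lambda>r. G (a * r) (t - a * r))) has_real_derivative
        integral (cbox 0 1) (\<lambda>r. G' (a * r) (t - a * r))) (at t within UNIV)"
    proof (rule leibniz_rule_field_derivative)
      show "((\<lambda>t. G (a * r) (t - a * r)) has_real_derivative G' (a * r) (t - a * r)) (at t)" for t r
        by (rule DERIV_cong[OF DERIV_chain2[OF der]], (rule derivative_eq_intros refl | simp)+)
      show "(\<lambda>r. G (a * r) (t - a * r)) integrable_on cbox 0 1" for t
        by (intro integrable_continuous Gc continuous_intros)
      show "continuous_on (UNIV \<times> cbox 0 1) (\<lambda>(t, r). G' (a * r) (t - a * r))"
        unfolding split_beta by (intro G'c continuous_intros)
    qed auto
    then show ?thesis unfolding K_def by (intro DERIV_cmult) simp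
  qed
  have Ka: "(K t has_real_derivative G a (t - a)) (at a)" for t a
    unfolding K_def by (rule DERIV_scaled_integral[where n = "\<lambda>s. G s (t - s)"]) (intro Gc continuous_intros)
  have "((\<lambda>(t, a). K t a) has_derivative
      (\<lambda>(dt, da). (t * integral {0..1} (\<lambda>r. G' (t * r) (t - t * r))) * dt
        + blinfun_apply (blinfun_mult_right (G t (t - t))) da)) (at (t, t) within UNIV \<times> UNIV)"
  proof (rule has_derivative_partialsI[where fy = "\<lambda>t a. blinfun_mult_right (G a (t - a))"])
    show "((\<lambda>x. K x t) has_derivative (*) (t * integral {0..1} (\<lambda>r. G' (t * r) (t - t * r)))) (at t)"
      using Kt[of t t] by (simp add: has_field_derivative_def)
    show "(K x has_derivative blinfun_apply (blinfun_mult_right (G y (x - y)))) (at y)" for x y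
      using Ka[of x y] by (simp add: has_field_derivative_def)
    have "continuous_on UNIV (\<lambda>(t, a). blinfun_mult_right (G a (t - a)))"
      unfolding split_beta
      by (intro bounded_linear.continuous_on[OF bounded_linear_blinfun_mult_right] Gc continuous_intros)
    then show "continuous (at (t, t) within UNIV \<times> UNIV) (\<lambda>(x, y). blinfun_mult_right (G y (x - y)))"
      by (simp add: continuous_on_eq_continuous_within)
  qed auto
  then have 1: "((\<lambda>(t, a). K t a) has_derivative
      (\<lambda>(dt, da). (t * integral {0..1} (\<lambda>r. G' (t * r) (t - t * r))) * dt + G t 0 * da)) (at (t, t))"
    by simp
  have 2: "((\<lambda>t. (t, t)) has_derivative (\<lambda>h. (h, h))) (at t)"
    by (intro derivative_intros)
  show ?thesis
    unfolding has_field_derivative_def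
    by (rule has_derivative_eq_rhs[OF has_derivative_compose[OF 2 1, unfolded split K_def]])
      (simp add: fun_eq_iff algebra_simps)
qed

text \<open>On the left the root hides the differentiability at \<tau> = 0. The right side is
  differentiable there and makes sense for negative \<tau> as well;
  \<open>DERIV_duhamel_time\<close> uses it as a replacement.\<close>

lemma gauss_avg_eq_integral:
  assumes f: "\<And>x. (f has_real_derivative f' x) (at x)" "\<And>x. \<bar>f x\<bar> \<le> B"
    and f': "\<And>x. (f' has_real_derivative f'' x) (at x)" "\<And>x. \<bar>f' x\<bar> \<le> B'"
    and f'': "continuous_on UNIV f''" "\<And>x. \<bar>f'' x\<bar> \<le> B''"
    and "0 \<le> \<tau>"
  shows "gauss_avg f (sqrt (2 * \<tau>)) x
    = f x + \<tau> * integral {0..1} (\<lambda>r. gauss_avg f'' (sqrt (2 * (\<tau> * r))) x)"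
proof -
  have "continuous_on UNIV (\<lambda>(p, c, x). gauss_avg ((\<lambda>_::real. f'') p) c x)"
    by (rule continuous_gauss_avg[where \<beta> = "\<lambda>_. B''"])
      (auto intro!: continuous_intros continuous_on_compose2[OF f''(1)] f'' simp: split_beta)
  from continuous_on_compose2[OF this, of UNIV "\<lambda>c. (0::real, c, x)"]
  have cont: "continuous_on UNIV (\<lambda>c. gauss_avg f'' c x)"
    by (simp add: continuous_on_Pair)
  then have cont': "continuous_on UNIV (\<lambda>s. gauss_avg f'' (sqrt (2 * s)) x)"
    by (rule continuous_on_compose2) (auto intro!: continuous_intros)
  obtain A where A: "\<And>s. (A has_real_derivative gauss_avg f'' (sqrt (2 * s)) x) (at s)"
    using antiderivative_exists[OF cont'] by blast
  \<comment> \<open>\<open>sqrt (2 * (c\<^sup>2 / 2))\<close> is the absolute value of c, so the two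
    terms are visibly equal only for nonnegative c. Hence constancy is claimed between 0 and a
    nonnegative c.\<close>
  have D: "((\<lambda>c. gauss_avg f c x - A (c\<^sup>2 / 2)) has_real_derivative
      c * gauss_avg f'' c x - gauss_avg f'' (sqrt (2 * (c\<^sup>2 / 2))) x * c) (at c)" for c
    by (rule DERIV_diff DERIV_gauss_avg_scale[OF f f' f''] DERIV_chain2[OF A])+
      (rule derivative_eq_intros refl | simp)+
  define c where "c = sqrt (2 * \<tau>)"
  have c: "0 \<le> c" "c\<^sup>2 / 2 = \<tau>" using \<open>0 \<le> \<tau>\<close> by (auto simp: c_def)
  have "gauss_avg f c x - A (c\<^sup>2 / 2) = gauss_avg f 0 x - A (0\<^sup>2 / 2)"
  proof (cases "c = 0")
    case False
    then have "0 < c" using c by simp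
    then show ?thesis
    proof (rule DERIV_isconst_end)
      show "continuous_on {0..c} (\<lambda>c. gauss_avg f c x - A (c\<^sup>2 / 2))"
        by (rule DERIV_continuous_on, rule has_field_derivative_at_within, rule D)
      show "((\<lambda>c. gauss_avg f c x - A (c\<^sup>2 / 2)) has_real_derivative 0) (at c')" if "0 < c'" "c' < c" for c'
        using D[of c'] that by simp
    qed
  qed simp
  then show ?thesis
    using scaled_integral_eq[OF A, of \<tau>] c by (simp add: c_def)
qed

text \<open>For t > 0 the solution of \<open>U_t = U_xx + F\<close> with initial value 0: the source
  at time s = t r is carried by the heat flow over the remaining time t - s.\<close>

definition duhamel :: "(real \<Rightarrow> real \<Rightarrow> real) \<Rightarrow> real \<Rightarrow> real \<Rightarrow> real" where
  "duhamel F t x = t * integral {0..1} (\<lambda>r. gauss_avg (F (t * r)) (sqrt (2 * (t - t * r))) x)"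

lemma continuous_duhamel_integrand:
  fixes F :: "'p::metric_space \<Rightarrow> real \<Rightarrow> real \<Rightarrow> real"
  assumes F: "continuous_on UNIV (\<lambda>(p, t, x). F p t x)"
    and \<beta>: "continuous_on UNIV \<beta>" "\<And>p t x. \<bar>F p t x\<bar> \<le> \<beta> t"
    and "continuous_on S q" "continuous_on S t" "continuous_on S c" "continuous_on S x"
  shows "continuous_on S (\<lambda>z. gauss_avg (F (q z) (t z)) (c z) (x z))"
proof -
  have "continuous_on UNIV (\<lambda>(pt, x). (\<lambda>(p, t, x). F p t x) (fst pt, snd pt, x))"
    unfolding split_beta by (rule continuous_on_compose2[OF F[unfolded split_beta]]) (intro continuous_intros, auto)
  then have "continuous_on UNIV (\<lambda>(pt, c, x). gauss_avg (F (fst pt) (snd pt)) c x)"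
    by (intro continuous_gauss_avg[where \<beta> = "\<lambda>pt. \<beta> (snd pt)"])
      (auto intro!: continuous_on_compose2[OF \<beta>(1)] continuous_intros \<beta>(2))
  from continuous_on_compose2[OF this, of S "\<lambda>z. ((q z, t z), c z, x z)"] show ?thesis
    using assms(4-) by (simp add: continuous_on_Pair)
qed

lemma continuous_duhamel:
  fixes F :: "'p::metric_space \<Rightarrow> real \<Rightarrow> real \<Rightarrow> real"
  assumes F: "continuous_on UNIV (\<lambda>(p, t, x). F p t x)"
    and \<beta>: "continuous_on UNIV \<beta>" "\<And>p t x. \<bar>F p t x\<bar> \<le> \<beta> t"
  shows "continuous_on UNIV (\<lambda>(p, t, x). duhamel (F p) t x)"
proof -
  have "continuous_on UNIV (\<lambda>z. integral (cbox 0 1) (\<lambda>r. gauss_avg (F (fst z) (fst (snd z) * r))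
      (sqrt (2 * (fst (snd z) - fst (snd z) * r))) (snd (snd z))))"
    by (rule integral_continuous_on_param) (unfold split_beta,
      intro continuous_duhamel_integrand[OF F \<beta>] continuous_intros)
  then show ?thesis
    unfolding duhamel_def split_beta by (intro continuous_intros) simp_all
qed

context
  fixes F :: "real \<Rightarrow> real \<Rightarrow> real" and \<beta> :: "real \<Rightarrow> real"
  assumes F: "continuous_on UNIV (\<lambda>(t, x). F t x)"
    and \<beta>: "continuous_on UNIV \<beta>" "\<And>t x. \<bar>F t x\<bar> \<le> \<beta> t"
begin

lemma continuous_duhamel_integrand':
  assumes "continuous_on S t" "continuous_on S c" "continuous_on S x"
  shows "continuous_on S (\<lambda>z. gauss_avg (F (t z)) (c z) (x z))"
proof (rule continuous_duhamel_integrand[where F = "\<lambda>_::real. F" and q = "\<lambda>_. 0", OF _ \<beta>])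
  show "continuous_on UNIV (\<lambda>(p::real, t, x). F t x)"
    unfolding split_beta by (rule continuous_on_compose2[OF F[unfolded split_beta]]) (intro continuous_intros, auto)
qed (use assms in auto)

lemma duhamel_integrable:
  "(\<lambda>r. gauss_avg (F (t * r)) (sqrt (2 * (t - t * r))) x) integrable_on {0..1}"
  by (intro integrable_continuous_interval continuous_duhamel_integrand' continuous_intros)

lemma DERIV_duhamel_space:
  assumes F': "continuous_on UNIV (\<lambda>(t, x). F' t x)" "continuous_on UNIV \<beta>'" "\<And>t x. \<bar>F' t x\<bar> \<le> \<beta>' t"
    and der: "\<And>t x. (F t has_real_derivative F' t x) (at x)"
  shows "(duhamel F t has_real_derivative duhamel F' t x) (at x)"
proof -
  have F'c: "continuous_on UNIV (F' t)" for t
    using continuous_on_compose2[OF F'(1) continuous_on_Pair[OF continuous_on_const continuous_on_id]]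
    by (simp add: subset_UNIV)
  have 1: "continuous_on UNIV (\<lambda>(p::real, t, x). F' t x)"
    unfolding split_beta by (rule continuous_on_compose2[OF F'(1)[unfolded split_beta]]) (intro continuous_intros, auto)
  have "((\<lambda>x. integral (cbox 0 1) (\<lambda>r. gauss_avg (F (t * r)) (sqrt (2 * (t - t * r))) x)) has_real_derivative
      integral (cbox 0 1) (\<lambda>r. gauss_avg (F' (t * r)) (sqrt (2 * (t - t * r))) x)) (at x within UNIV)"
  proof (rule leibniz_rule_field_derivative)
    show "(gauss_avg (F (t * r)) (sqrt (2 * (t - t * r))) has_real_derivative
        gauss_avg (F' (t * r)) (sqrt (2 * (t - t * r))) x) (at x)" for x r
      by (rule DERIV_gauss_avg[OF der \<beta>(2) F'c F'(3)])
    show "continuous_on (UNIV \<times> cbox 0 1) (\<lambda>(x, r). gauss_avg (F' (t * r)) (sqrt (2 * (t - t * r))) x)"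
      unfolding split_beta
      by (rule continuous_duhamel_integrand[where F = "\<lambda>_::real. F'" and q = "\<lambda>_. 0", OF 1 F'(2,3)])
        (auto intro!: continuous_intros)
  qed (use duhamel_integrable in auto)
  then show ?thesis unfolding duhamel_def[abs_def] by (intro DERIV_cmult) simp
qed

text \<open>The factor t and the integral of \<open>r ^ n\<close> raise the power and the factorial
  by one each; iterated, this builds the exponential series.\<close>

lemma abs_duhamel_le:
  assumes "\<And>t x. \<bar>F t x\<bar> \<le> C * (A * \<bar>t\<bar>) ^ n / fact n"
  shows "\<bar>duhamel F t x\<bar> \<le> C * A ^ n * \<bar>t\<bar> ^ Suc n / fact (Suc n)"
proof -
  have Fc: "continuous_on UNIV (F t)" for t
    using continuous_on_compose2[OF F continuous_on_Pair[OF continuous_on_const continuous_on_id]]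
    by (simp add: subset_UNIV)
  have i: "((\<lambda>r. C * (A * \<bar>t\<bar>) ^ n / fact n * r ^ n) has_integral C * (A * \<bar>t\<bar>) ^ n / fact n * (1 / real (Suc n))) {0..1}"
  proof (rule has_integral_mult_right)
    have "((\<lambda>r. r ^ n) has_integral 1 ^ Suc n / real (Suc n) - 0 ^ Suc n / real (Suc n)) {0..1}"
    proof (rule fundamental_theorem_of_calculus)
      fix r :: real
      have "((\<lambda>r. r ^ Suc n / real (Suc n)) has_real_derivative r ^ n) (at r within {0..1})"
        by (intro derivative_eq_intros) (auto simp del: of_nat_Suc)
      then show "((\<lambda>r. r ^ Suc n / real (Suc n)) has_vector_derivative r ^ n) (at r within {0..1})"
        by (simp add: has_real_derivative_iff_has_vector_derivative)
    qed simp
    then show "((\<lambda>r. r ^ n) has_integral 1 / real (Suc n)) {0..1}" by simp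
  qed
  have "norm (integral {0..1} (\<lambda>r. gauss_avg (F (t * r)) (sqrt (2 * (t - t * r))) x))
      \<le> integral {0..1} (\<lambda>r. C * (A * \<bar>t\<bar>) ^ n / fact n * r ^ n)"
  proof (rule integral_norm_bound_integral)
    show "norm (gauss_avg (F (t * r)) (sqrt (2 * (t - t * r))) x) \<le> C * (A * \<bar>t\<bar>) ^ n / fact n * r ^ n"
      if "r \<in> {0..1}" for r
      unfolding real_norm_def
    proof (rule gauss_avg_abs_le[OF Fc])
      show "\<bar>F (t * r) x\<bar> \<le> C * (A * \<bar>t\<bar>) ^ n / fact n * r ^ n" for x
        using assms[of "t * r" x] that by (simp add: abs_mult power_mult_distrib mult_ac)
    qed
  qed (use i duhamel_integrable in auto)
  then have "\<bar>duhamel F t x\<bar> \<le> \<bar>t\<bar> * (C * (A * \<bar>t\<bar>) ^ n / fact n * (1 / real (Suc n)))"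
    unfolding duhamel_def abs_mult integral_unique[OF i] real_norm_def by (rule mult_left_mono) simp
  also have "\<dots> = C * A ^ n * \<bar>t\<bar> ^ Suc n / fact (Suc n)"
    by (simp add: power_mult_distrib field_simps del: of_nat_Suc)
  finally show ?thesis .
qed

lemma duhamel_nonneg: "0 \<le> t \<Longrightarrow> (\<And>s x. 0 \<le> s \<Longrightarrow> 0 \<le> F s x) \<Longrightarrow> 0 \<le> duhamel F t x"
  unfolding duhamel_def
  by (intro mult_nonneg_nonneg Henstock_Kurzweil_Integration.integral_nonneg duhamel_integrable gauss_avg_nonneg) auto

text \<open>Duhamel's principle. The heat flow commutes with differentiation in x, so both
  derivatives fall on F and none on the kernel, which is singular at elapsed time 0.\<close>

lemma DERIV_duhamel_time:
  assumes F': "\<And>t x. (F t has_real_derivative F' t x) (at x)" "\<And>t x. \<bar>F' t x\<bar> \<le> \<beta>' t"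
    and F'': "\<And>t x. (F' t has_real_derivative F'' t x) (at x)" "\<And>t x. \<bar>F'' t x\<bar> \<le> \<beta>'' t"
      "continuous_on UNIV (\<lambda>(t, x). F'' t x)" "continuous_on UNIV \<beta>''"
    and t: "0 < t"
  shows "((\<lambda>t. duhamel F t x) has_real_derivative F t x + duhamel F'' t x) (at t)"
proof -
  define G' where "G' s \<tau> = gauss_avg (F'' s) (sqrt (2 * \<tau>)) x" for s \<tau>
  \<comment> \<open>By \<open>gauss_avg_eq_integral\<close> this is the heat flow for \<tau> \<ge>
    0; being differentiable at every real \<tau>, it meets the hypothesis of
    \<open>DERIV_convolution\<close>.\<close>
  define G where "G s \<tau> = F s x + \<tau> * integral {0..1} (\<lambda>r. G' s (\<tau> * r))" for s \<tau>
  have F''c: "continuous_on UNIV (F'' t)" for t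
    using continuous_on_compose2[OF F''(3) continuous_on_Pair[OF continuous_on_const continuous_on_id]]
    by (simp add: subset_UNIV)
  have 1: "continuous_on UNIV (\<lambda>(p::real, t, x). F'' t x)"
    unfolding split_beta by (rule continuous_on_compose2[OF F''(3)[unfolded split_beta]]) (intro continuous_intros, auto)
  have G'c: "continuous_on S (\<lambda>z. G' (f z) (g z))" if "continuous_on S f" "continuous_on S g"
    for S and f g :: "'b::topological_space \<Rightarrow> real"
    unfolding G'_def
    by (rule continuous_duhamel_integrand[where F = "\<lambda>_::real. F''" and q = "\<lambda>_. 0", OF 1 F''(4,2)])
      (auto intro!: continuous_intros that)
  have G_eq: "G s \<tau> = gauss_avg (F s) (sqrt (2 * \<tau>)) x" if "0 \<le> \<tau>" for s \<tau>
    unfolding G_def G'_def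
    by (rule gauss_avg_eq_integral[OF F'(1) \<beta>(2) F''(1) F'(2) F''c F''(2) that, symmetric])
  have "((\<lambda>t. t * integral {0..1} (\<lambda>r. G (t * r) (t - t * r))) has_real_derivative
      G t 0 + t * integral {0..1} (\<lambda>r. G' (t * r) (t - t * r))) (at t)"
  proof (rule DERIV_convolution)
    show "continuous_on UNIV (\<lambda>(s, \<tau>). G' s \<tau>)"
      unfolding split_beta by (intro G'c continuous_intros)
    show "(G s has_real_derivative G' s \<tau>) (at \<tau>)" for s \<tau>
      unfolding G_def[abs_def]
      by (rule DERIV_cong[OF DERIV_add[OF DERIV_const DERIV_scaled_integral]])
        (auto intro!: G'c continuous_intros)
    have "continuous_on UNIV (\<lambda>z. integral (cbox 0 1) (\<lambda>r. G' (fst z) (snd z * r)))"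
      by (rule integral_continuous_on_param) (unfold split_beta, intro G'c continuous_intros)
    then show "continuous_on UNIV (\<lambda>(s, \<tau>). G s \<tau>)"
      unfolding G_def split_beta
      by (auto intro!: continuous_intros
          continuous_on_compose2[OF F, where f = "\<lambda>z. (fst z, x)", simplified])
  qed
  moreover have "G t 0 = F t x" by (simp add: G_def)
  moreover have "t * integral {0..1} (\<lambda>r. G (t * r) (t - t * r)) = duhamel F t x" if "0 < t" for t
    unfolding duhamel_def using that
    by (intro arg_cong2[where f="(*)"] refl Henstock_Kurzweil_Integration.integral_cong G_eq) (simp add: mult_left_le)
  ultimately have "((\<lambda>t. t * integral {0..1} (\<lambda>r. G (t * r) (t - t * r))) has_real_derivative
      F t x + duhamel F'' t x) (at t)"
    by (simp add: duhamel_def G'_def)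
  then show ?thesis
    by (rule has_field_derivative_transform_within_open[of _ _ _ "{0<..}"])
      (use t \<open>\<And>t. 0 < t \<Longrightarrow> t * integral {0..1} (\<lambda>r. G (t * r) (t - t * r)) = duhamel F t x\<close> in auto)
qed

end

section \<open>Smooth functions of one variable\<close>

text \<open>The flag lets one calculus serve both the data of the Dyson series, whose derivatives
  must all be bounded, and functions such as \<open>ln\<close> that are merely smooth.\<close>

primrec k_diff :: "bool \<Rightarrow> real set \<Rightarrow> nat \<Rightarrow> (real \<Rightarrow> real) \<Rightarrow> bool" where
  "k_diff bd T 0 f \<longleftrightarrow> continuous_on T f \<and> (bd \<longrightarrow> bounded (f ` T))"
| "k_diff bd T (Suc k) f \<longleftrightarrow> continuous_on T f \<and> (bd \<longrightarrow> bounded (f ` T)) \<and>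
     (\<exists>f'. (\<forall>x\<in>T. (f has_real_derivative f' x) (at x)) \<and> k_diff bd T k f')"

lemma k_diff_cont: "k_diff bd T k f \<Longrightarrow> continuous_on T f"
  and k_diff_bounded: "k_diff True T k f \<Longrightarrow> bounded (f ` T)"
  by (cases k; simp)+

lemma k_diff_SucD: "k_diff bd T (Suc k) f \<Longrightarrow> k_diff bd T k f"
  by (induction k arbitrary: f) (simp, metis k_diff.simps(2))

lemma k_diff_SucI:
  assumes "\<And>x. x \<in> T \<Longrightarrow> (f has_real_derivative f' x) (at x)" "k_diff bd T k f'"
    and "bd \<Longrightarrow> bounded (f ` T)"
  shows "k_diff bd T (Suc k) f"
  using assms by (auto intro!: DERIV_continuous_on intro: has_field_derivative_at_within)

lemma k_diff_cong:
  assumes "open T" "\<And>x. x \<in> T \<Longrightarrow> f x = g x"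
  shows "k_diff bd T k f \<longleftrightarrow> k_diff bd T k g"
proof -
  have *: "(f has_real_derivative D) (at x) \<longleftrightarrow> (g has_real_derivative D) (at x)" if "x \<in> T" for x D
    using assms that by (intro DERIV_cong_ev) (auto simp: eventually_nhds)
  have "continuous_on T f \<longleftrightarrow> continuous_on T g" "f ` T = g ` T"
    using assms by (auto intro!: continuous_on_cong image_cong)
  then show ?thesis using * by (cases k) auto
qed

lemma bounded_image_add: "bounded (f ` T) \<Longrightarrow> bounded (g ` T) \<Longrightarrow> bounded ((\<lambda>x. f x + g x) ` T)"
  for f g :: "'a \<Rightarrow> real"
  by (rule bounded_plus_comp)

lemma bounded_image_mult:
  fixes f g :: "'a \<Rightarrow> real"
  assumes "bounded (f ` T)" "bounded (g ` T)"
  shows "bounded ((\<lambda>x. f x * g x) ` T)"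
proof -
  obtain a b where "\<forall>x\<in>T. \<bar>f x\<bar> \<le> a" "\<forall>x\<in>T. \<bar>g x\<bar> \<le> b"
    using assms by (auto simp: bounded_iff)
  then have "\<forall>x\<in>T. \<bar>f x * g x\<bar> \<le> a * b"
    by (auto simp: abs_mult intro!: mult_mono order_trans[OF abs_ge_zero])
  then show ?thesis by (auto simp: bounded_iff)
qed

lemma k_diff_const: "k_diff bd T k (\<lambda>_. c)"
proof (induction k arbitrary: c)
  case 0
  show ?case by (auto simp: bounded_iff)
next
  case (Suc k)
  show ?case by (rule k_diff_SucI[OF _ Suc[of 0]]) (auto simp: bounded_iff)
qed

lemma k_diff_ident: "k_diff False T k (\<lambda>x. x)"
  by (cases k) (auto intro!: exI[of _ "\<lambda>_. 1"] k_diff_const continuous_intros derivative_eq_intros)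

lemma k_diff_add: "k_diff bd T k f \<Longrightarrow> k_diff bd T k g \<Longrightarrow> k_diff bd T k (\<lambda>x. f x + g x)"
proof (induction k arbitrary: f g)
  case 0
  then show ?case by (auto intro!: continuous_intros bounded_image_add)
next
  case (Suc k)
  then obtain f' g' where "\<forall>x\<in>T. (f has_real_derivative f' x) (at x)" "k_diff bd T k f'"
      "\<forall>x\<in>T. (g has_real_derivative g' x) (at x)" "k_diff bd T k g'"
    by auto
  then show ?case
    using Suc by (intro k_diff_SucI[where f' = "\<lambda>x. f' x + g' x"]) (auto intro!: derivative_intros bounded_image_add)
qed

lemma k_diff_mult: "k_diff bd T k f \<Longrightarrow> k_diff bd T k g \<Longrightarrow> k_diff bd T k (\<lambda>x. f x * g x)"
proof (induction k arbitrary: f g)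
  case 0
  then show ?case by (auto intro!: continuous_intros bounded_image_mult)
next
  case (Suc k)
  then obtain f' g' where fg: "\<forall>x\<in>T. (f has_real_derivative f' x) (at x)" "k_diff bd T k f'"
      "\<forall>x\<in>T. (g has_real_derivative g' x) (at x)" "k_diff bd T k g'"
    by auto
  show ?case
  proof (rule k_diff_SucI[where f' = "\<lambda>x. f' x * g x + f x * g' x"])
    show "k_diff bd T k (\<lambda>x. f' x * g x + f x * g' x)"
      by (intro k_diff_add Suc.IH fg Suc.prems[THEN k_diff_SucD])
    show "((\<lambda>x. f x * g x) has_real_derivative f' x * g x + f x * g' x) (at x)" if "x \<in> T" for x
      using fg that by (auto intro!: derivative_eq_intros)
  qed (use Suc.prems in \<open>auto intro!: bounded_image_mult\<close>)
qed

lemma k_diff_cmult: "k_diff bd T k f \<Longrightarrow> k_diff bd T k (\<lambda>x. c * f x)"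
  by (intro k_diff_mult k_diff_const)

lemma k_diff_uminus: "k_diff bd T k f \<Longrightarrow> k_diff bd T k (\<lambda>x. - f x)"
  using k_diff_cmult[of bd T k f "-1"] by simp

lemma k_diff_affine: "k_diff bd UNIV k f \<Longrightarrow> k_diff bd UNIV k (\<lambda>x. f (a * x + b))"
proof (induction k arbitrary: f)
  case 0
  then show ?case by (auto intro!: continuous_intros continuous_on_compose2[of UNIV f] simp: bounded_iff)
next
  case (Suc k)
  then obtain f' where f: "\<And>x. (f has_real_derivative f' x) (at x)" "k_diff bd UNIV k f'" by auto
  show ?case
  proof (rule k_diff_SucI[where f' = "\<lambda>x. a * f' (a * x + b)"])
    show "((\<lambda>x. f (a * x + b)) has_real_derivative a * f' (a * x + b)) (at x)" for x
      by (rule DERIV_cong[OF DERIV_chain2[OF f(1)]], (rule derivative_eq_intros refl | simp)+)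
  qed (use Suc f in \<open>auto intro!: k_diff_cmult simp: bounded_iff\<close>)
qed

lemma k_diff_compose:
  "k_diff False T' k g \<Longrightarrow> k_diff False T k f \<Longrightarrow> f ` T \<subseteq> T' \<Longrightarrow> k_diff False T k (\<lambda>x. g (f x))"
proof (induction k arbitrary: g)
  case 0
  then show ?case by (auto intro!: continuous_on_compose2[of T' g])
next
  case (Suc k)
  then obtain f' g' where fg: "\<forall>x\<in>T. (f has_real_derivative f' x) (at x)" "k_diff False T k f'"
      "\<forall>x\<in>T'. (g has_real_derivative g' x) (at x)" "k_diff False T' k g'"
    by auto
  show ?case
  proof (rule k_diff_SucI[where f' = "\<lambda>x. g' (f x) * f' x"])
    show "((\<lambda>x. g (f x)) has_real_derivative g' (f x) * f' x) (at x)" if "x \<in> T" for x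
      by (rule DERIV_chain2) (use fg that Suc.prems(3) in auto)
    show "k_diff False T k (\<lambda>x. g' (f x) * f' x)"
      by (rule k_diff_mult[OF Suc.IH[OF fg(4) k_diff_SucD[OF Suc.prems(2)] Suc.prems(3)] fg(2)])
  qed simp
qed

lemma k_diff_inverse_comp:
  assumes "\<And>x. x \<in> T \<Longrightarrow> f x \<noteq> 0" "bd \<Longrightarrow> bounded ((\<lambda>x. inverse (f x)) ` T)"
  shows "k_diff bd T k f \<Longrightarrow> k_diff bd T k (\<lambda>x. inverse (f x))"
proof (induction k)
  case 0
  then show ?case using assms by (auto intro!: continuous_intros)
next
  case (Suc k)
  then obtain f' where f: "\<forall>x\<in>T. (f has_real_derivative f' x) (at x)" "k_diff bd T k f'"
    by auto
  show ?case
  proof (rule k_diff_SucI[where f' = "\<lambda>x. - (f' x * (inverse (f x) * inverse (f x)))"])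
    show "k_diff bd T k (\<lambda>x. - (f' x * (inverse (f x) * inverse (f x))))"
      by (intro k_diff_uminus k_diff_mult f Suc.IH Suc.prems[THEN k_diff_SucD])
    show "((\<lambda>x. inverse (f x)) has_real_derivative - (f' x * (inverse (f x) * inverse (f x)))) (at x)"
      if "x \<in> T" for x
      using assms(1) f(1) that by (auto intro!: derivative_eq_intros)
  qed (use assms in auto)
qed

lemma k_diff_ln: "k_diff False {0<..} k ln"
proof (cases k)
  case (Suc l)
  show ?thesis unfolding Suc
    by (rule k_diff_SucI[where f' = inverse])
      (auto intro!: k_diff_inverse_comp k_diff_ident derivative_eq_intros simp: divide_inverse)
qed (auto intro!: continuous_intros)

lemma k_diff_deriv:
  assumes "open T" "k_diff bd T (Suc k) f"
  shows "k_diff bd T k (deriv f)" "x \<in> T \<Longrightarrow> (f has_real_derivative deriv f x) (at x)"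
proof -
  obtain f' where f: "\<forall>x\<in>T. (f has_real_derivative f' x) (at x)" "k_diff bd T k f'"
    using assms by auto
  then have "\<And>x. x \<in> T \<Longrightarrow> deriv f x = f' x" by (auto intro: DERIV_imp_deriv)
  then show "k_diff bd T k (deriv f)" "x \<in> T \<Longrightarrow> (f has_real_derivative deriv f x) (at x)"
    using f k_diff_cong[OF assms(1), of "deriv f" f'] by auto
qed

lemma k_diff_deriv_iter:
  assumes "\<And>k. k_diff bd T k f" "open T"
  shows "k_diff bd T k ((deriv ^^ j) f)"
  by (induction j arbitrary: k) (use assms k_diff_deriv(1) in \<open>auto simp del: k_diff.simps\<close>)

lemma DERIV_deriv_iter:
  assumes "\<And>k. k_diff bd T k f" "open T" "x \<in> T"
  shows "((deriv ^^ j) f has_real_derivative (deriv ^^ Suc j) f x) (at x)"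
  using k_diff_deriv(2)[OF assms(2) k_diff_deriv_iter[OF assms(1,2)] assms(3)] by simp

section \<open>Flat functions built from exp (-1/x)\<close>

definition flat_exp :: "nat \<Rightarrow> real \<Rightarrow> real" where
  "flat_exp k x = (if 0 < x then exp (- inverse x) * inverse x ^ k else 0)"

lemma flat_nonneg: "0 \<le> flat_exp k x"
  by (simp add: flat_exp_def)

lemma flat_nonpos [simp]: "x \<le> 0 \<Longrightarrow> flat_exp k x = 0"
  by (simp add: flat_exp_def)

lemma flat_le: "flat_exp k x \<le> fact k"
proof (cases "0 < x")
  case True
  define y where "y = inverse x"
  have y: "0 < y" using True by (simp add: y_def)
  have "y ^ k /\<^sub>R fact k \<le> exp y"
    unfolding exp_def using y sum_le_suminf[OF summable_exp_generic[of y], of "{k}"] by auto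
  then have "y ^ k * exp (- y) \<le> fact k"
    by (simp add: exp_minus divide_simps mult.commute)
  then show ?thesis using True by (simp add: flat_exp_def y_def mult.commute)
qed simp

lemma flat_tendsto_0: "(flat_exp k \<longlongrightarrow> 0) (at 0)"
proof -
  have "((\<lambda>y::real. y ^ k / exp y) \<longlongrightarrow> 0) at_top" by (rule tendsto_power_div_exp_0)
  from filterlim_compose[OF this filterlim_inverse_at_top_right]
  have "((\<lambda>x::real. (inverse x) ^ k / exp (inverse x)) \<longlongrightarrow> 0) (at_right 0)" .
  then have "(flat_exp k \<longlongrightarrow> 0) (at_right 0)"
    by (rule Lim_transform_eventually)
      (auto simp: eventually_at_right_field flat_exp_def exp_minus divide_inverse mult.commute intro!: exI[of _ 1])
  moreover have "(flat_exp k \<longlongrightarrow> 0) (at_left 0)"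
    by (rule Lim_transform_eventually[OF tendsto_const])
      (auto simp: eventually_at_left_field intro!: exI[of _ "-1"])
  ultimately show ?thesis by (simp add: filterlim_at_split)
qed

text \<open>The factor \<open>inverse x ^ k\<close> makes the linear span of the family closed under
  differentiation, so one induction for all k at once yields smoothness.\<close>

lemma flat_DERIV: "(flat_exp k has_real_derivative flat_exp (k + 2) x - real k * flat_exp (k + 1) x) (at x)"
proof -
  consider "0 < x" | "x < 0" | "x = 0" by linarith
  then show ?thesis
  proof cases
    case 1
    have "((\<lambda>x. exp (- inverse x) * inverse x ^ k) has_real_derivative
        flat_exp (k + 2) x - real k * flat_exp (k + 1) x) (at x)"
    proof -
      have "((\<lambda>x. exp (- inverse x)) has_real_derivative exp (- inverse x) * (inverse x * inverse x)) (at x)"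
        using 1 by (auto intro!: derivative_eq_intros)
      moreover have "((\<lambda>x. inverse x ^ k) has_real_derivative real k * inverse x ^ (k - 1) * - (inverse x * inverse x)) (at x)"
        using 1 by (auto intro!: derivative_eq_intros)
      ultimately show ?thesis
        by (rule DERIV_cong[OF DERIV_mult]) (use 1 in \<open>cases k; simp add: flat_exp_def algebra_simps\<close>)
    qed
    then show ?thesis
      by (rule has_field_derivative_transform_within_open[of _ _ _ "{0<..}"]) (use 1 in \<open>auto simp: flat_exp_def\<close>)
  next
    case 2
    have "((\<lambda>x. 0) has_real_derivative flat_exp (k + 2) x - real k * flat_exp (k + 1) x) (at x)"
      using 2 by simp
    then show ?thesis
      by (rule has_field_derivative_transform_within_open[of _ _ _ "{..<0}"]) (use 2 in auto)
  next
    case 3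
    \<comment> \<open>At the origin the difference quotient of one member is the next member, which
      tends to 0.\<close>
    have "flat_exp k h / h = flat_exp (Suc k) h" for h by (simp add: flat_exp_def divide_inverse)
    then have "(\<lambda>h. (flat_exp k (0 + h) - flat_exp k 0) / h) = flat_exp (Suc k)" by (auto simp: fun_eq_iff)
    then show ?thesis
      using flat_tendsto_0[of "Suc k"] 3 by (simp add: DERIV_def)
  qed
qed

lemma k_diff_flat: "k_diff True UNIV n (flat_exp k)"
proof (induction n arbitrary: k)
  case 0
  have "continuous_on UNIV (flat_exp k)"
    by (rule DERIV_continuous_on, rule has_field_derivative_at_within, rule flat_DERIV)
  then show ?case using flat_nonneg flat_le by (auto simp: bounded_iff intro!: exI[of _ "fact k"])
next
  case (Suc n)
  show ?case
  proof (rule k_diff_SucI)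
    show "k_diff True UNIV n (\<lambda>x. flat_exp (k + 2) x + - (real k * flat_exp (k + 1) x))"
      by (intro k_diff_add k_diff_uminus k_diff_cmult Suc)
    show "(flat_exp k has_real_derivative flat_exp (k + 2) x + - (real k * flat_exp (k + 1) x)) (at x)" for x
      using flat_DERIV by simp
    show "bounded (range (flat_exp k))"
      using flat_nonneg flat_le by (auto simp: bounded_iff intro!: exI[of _ "fact k"])
  qed
qed


section \<open>The convex profile with its potential and drift\<close>

definition profile :: "real \<Rightarrow> real" where
  "profile x = 1 + x * flat_exp 0 x"

lemma profile_ge_1: "1 \<le> profile x"
  using flat_nonneg[of 0 x] by (cases "0 \<le> x") (auto simp: profile_def)

lemma profile_neg [simp]: "x \<le> 0 \<Longrightarrow> profile x = 1"
  by (simp add: profile_def)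

lemma DERIV_profile: "(profile has_real_derivative flat_exp 0 x + flat_exp 1 x) (at x)"
proof -
  have "x * flat_exp 2 x = flat_exp 1 x" by (cases "0 < x") (auto simp: flat_exp_def power2_eq_square)
  then show ?thesis
    unfolding profile_def[abs_def] by (auto intro!: derivative_eq_intros flat_DERIV simp: numeral_2_eq_2 mult.commute)
qed

text \<open>The factor x in \<open>profile\<close> makes the terms with \<open>flat_exp 2\<close>
  cancel, so the second derivative is nonnegative and the profile convex. The second derivative of
  \<open>flat_exp 0\<close> alone, \<open>flat_exp 4 - 2 * flat_exp 3\<close>, is negative for x >
  1/2.\<close>

lemma DERIV_profile': "((\<lambda>x. flat_exp 0 x + flat_exp 1 x) has_real_derivative flat_exp 3 x) (at x)"
  by (rule DERIV_cong[OF DERIV_add[OF flat_DERIV flat_DERIV]]) (simp add: numeral_2_eq_2 numeral_3_eq_3)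

lemma bounded_inverse_profile: "bounded (range (\<lambda>x. inverse (profile x)))"
  using profile_ge_1
  by (auto simp: bounded_iff intro!: exI[of _ 1] inverse_le_1_iff[THEN iffD2] order_trans[OF _ abs_ge_self])

text \<open>The profile h is unbounded, so \<open>k_diff_inverse_comp\<close> does not give bounds.
  But h' is bounded, and the derivative of 1/h is - h' times the square of 1/h, which closes an
  induction on 1/h itself.\<close>

lemma k_diff_inverse_profile: "k_diff True UNIV k (\<lambda>x. inverse (profile x))"
proof (induction k)
  case 0
  have "continuous_on UNIV profile"
    by (rule DERIV_continuous_on, rule has_field_derivative_at_within, rule DERIV_profile)
  moreover have "profile x \<noteq> 0" for x using profile_ge_1[of x] by linarith
  ultimately show ?case
    using bounded_inverse_profile by (auto intro!: continuous_intros)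
next
  case (Suc k)
  show ?case
  proof (rule k_diff_SucI[where f' = "\<lambda>x. - ((flat_exp 0 x + flat_exp 1 x) * (inverse (profile x) * inverse (profile x)))"])
    show "((\<lambda>x. inverse (profile x)) has_real_derivative
        - ((flat_exp 0 x + flat_exp 1 x) * (inverse (profile x) * inverse (profile x)))) (at x)" for x
      using profile_ge_1[of x] by (auto intro!: derivative_eq_intros DERIV_profile)
    show "k_diff True UNIV k (\<lambda>x. - ((flat_exp 0 x + flat_exp 1 x) * (inverse (profile x) * inverse (profile x))))"
      by (rule k_diff_uminus k_diff_mult k_diff_add k_diff_flat Suc)+
  qed (rule bounded_inverse_profile)
qed

definition potential :: "real \<Rightarrow> real" where
  "potential x = flat_exp 3 x * inverse (profile x)"

definition drift :: "real \<Rightarrow> real" where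
  "drift x = 2 * ((flat_exp 0 x + flat_exp 1 x) * inverse (profile x))"

lemma k_diff_potential: "k_diff True UNIV k potential"
  unfolding potential_def[abs_def] by (intro k_diff_mult k_diff_flat k_diff_inverse_profile)

lemma k_diff_drift: "k_diff True UNIV k drift"
  unfolding drift_def[abs_def] by (intro k_diff_cmult k_diff_mult k_diff_add k_diff_flat k_diff_inverse_profile)

lemma potential_nonneg: "0 \<le> potential x"
  using profile_ge_1[of x] flat_nonneg by (auto simp: potential_def)

lemma k_diff_weaken: "k_diff True T k f \<Longrightarrow> k_diff False T k f"
  by (induction k arbitrary: f) auto

text \<open>Two demands meet here: the shift must tend to infinity as y tends to 0, and its square
  must be small against - ln y. An iterated logarithm does both. The square and the 1 keep it smooth
  and nonnegative for all y > 0, also at y = 1.\<close>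

definition log_shift :: "real \<Rightarrow> real" where
  "log_shift y = ln (1 + (ln y)\<^sup>2)"

lemma shift_nonneg: "0 \<le> log_shift y"
  by (simp add: log_shift_def)

lemma shift_at_top: "filterlim log_shift at_top (at_right 0)"
  unfolding log_shift_def[abs_def] by real_asymp

definition log_shift' :: "real \<Rightarrow> real" where
  "log_shift' y = 2 * (ln y * (inverse y * inverse (1 + ln y * ln y)))"

lemma DERIV_shift: "0 < y \<Longrightarrow> (log_shift has_real_derivative log_shift' y) (at y)"
proof -
  have "1 + (ln y)\<^sup>2 > 0" by (simp add: add_pos_nonneg)
  then show "0 < y \<Longrightarrow> (log_shift has_real_derivative log_shift' y) (at y)"
    unfolding log_shift_def[abs_def]
    by (auto intro!: derivative_eq_intros simp: log_shift'_def divide_inverse power2_eq_square)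
qed

lemma k_diff_shift': "k_diff False {0<..} k log_shift'"
  unfolding log_shift'_def[abs_def]
proof (intro k_diff_cmult k_diff_mult k_diff_ln)
  show "k_diff False {0<..} k inverse"
    by (rule k_diff_inverse_comp[OF _ _ k_diff_ident]) auto
  have "1 + ln y * ln y \<noteq> 0" for y :: real
    using add_pos_nonneg[of 1 "ln y * ln y"] by simp
  then show "k_diff False {0<..} k (\<lambda>y. inverse (1 + ln y * ln y))"
    by (intro k_diff_inverse_comp k_diff_add k_diff_mult k_diff_ln k_diff_const) auto
qed

text \<open>On every bounded set of \<open>x\<close> the function vanishes for small \<open>y\<close>, which makes it smooth
  across \<open>y = 0\<close> whatever the derivatives of \<open>log_shift\<close> do there.\<close>

definition shifted :: "(real \<Rightarrow> real) \<Rightarrow> real \<Rightarrow> real \<Rightarrow> real" where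
  "shifted G y x = (if 0 < y then G (x - log_shift y) else 0)"

lemma shift_eventually_ge: "\<exists>e>0. \<forall>y. 0 < y \<and> y < e \<longrightarrow> r < log_shift y"
  using shift_at_top unfolding filterlim_at_top_dense eventually_at_right_field by blast

text \<open>The factor c stands for the coefficients that differentiation in y produces and may blow
  up at 0. If y0 \<le> 0, the shift exceeds x0 + 1 for all small y > 0, so G is evaluated where it
  vanishes and the function is 0 near the point.\<close>

lemma isCont_shifted:
  fixes c G :: "real \<Rightarrow> real"
  assumes c: "continuous_on {0<..} c" and G: "continuous_on UNIV G" "\<And>x. x < 0 \<Longrightarrow> G x = 0"
  shows "isCont (\<lambda>(y, x). if 0 < y then c y * G (x - log_shift y) else 0) (y0, x0)"
proof (cases "0 < y0")
  case True
  have sc: "continuous_on {0<..} log_shift"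
    by (rule DERIV_continuous_on, rule has_field_derivative_at_within, rule DERIV_shift) simp
  have "continuous_on ({0<..} \<times> UNIV) (\<lambda>z. c (fst z) * G (snd z - log_shift (fst z)))"
  proof (rule continuous_on_mult)
    show "continuous_on ({0<..} \<times> UNIV) (\<lambda>z. c (fst z))"
      by (rule continuous_on_compose2[OF c]) (auto intro: continuous_intros)
    have "continuous_on ({0<..} \<times> UNIV) (\<lambda>z. log_shift (fst z))"
      by (rule continuous_on_compose2[OF sc]) (auto intro: continuous_intros)
    then have "continuous_on ({0<..} \<times> UNIV) (\<lambda>z. snd z - log_shift (fst z))"
      by (intro continuous_intros)
    then show "continuous_on ({0<..} \<times> UNIV) (\<lambda>z. G (snd z - log_shift (fst z)))"
      by (rule continuous_on_compose2[OF G(1)]) auto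
  qed
  then have "continuous_on ({0<..} \<times> UNIV) (\<lambda>(y, x). if 0 < y then c y * G (x - log_shift y) else 0)"
    by (rule continuous_on_cong[THEN iffD1, rotated -1]) (auto simp: split_beta)
  moreover have "open ({0<..} \<times> UNIV :: (real \<times> real) set)" by (intro open_Times) auto
  ultimately show ?thesis using True by (auto simp: continuous_on_eq_continuous_at)
next
  case False
  obtain e where e: "e > 0" "\<And>y. 0 < y \<Longrightarrow> y < e \<Longrightarrow> x0 + 1 < log_shift y"
    using shift_eventually_ge[of "x0 + 1"] by blast
  have "open ({..<e} \<times> {..<x0 + 1})" by (intro open_Times) auto
  moreover have "(y0, x0) \<in> {..<e} \<times> {..<x0 + 1}" using False e(1) by auto
  ultimately have ev: "\<forall>\<^sub>F z in nhds (y0, x0). (\<lambda>(y, x). if 0 < y then c y * G (x - log_shift y) else 0) z = 0"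
    using e(2) G(2) by (fastforce simp: eventually_nhds intro!: exI[of _ "{..<e} \<times> {..<x0 + 1}"])
  show ?thesis
    using isCont_cong[OF ev] by simp
qed

section \<open>The heat equation with a bounded potential\<close>

text \<open>The k-th derivative of a product whose factors have the derivatives \<open>a i\<close>
  and \<open>b j\<close>. Being linear in b, the formula passes through the summation of the Dyson
  series in \<open>w_time\<close>.\<close>

definition leibniz :: "nat \<Rightarrow> (nat \<Rightarrow> real) \<Rightarrow> (nat \<Rightarrow> real) \<Rightarrow> real" where
  "leibniz k a b = (\<Sum>j\<le>k. real (k choose j) * (a (k - j) * b j))"

lemma leibniz_0 [simp]: "leibniz 0 a b = a 0 * b 0"
  by (simp add: leibniz_def)

lemma leibniz_Suc:
  "leibniz k (\<lambda>i. a (Suc i)) b + leibniz k a (\<lambda>j. b (Suc j)) = leibniz (Suc k) a b"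
proof -
  let ?c = "\<lambda>j. real (k choose Suc j) * (a (k - j) * b (Suc j))"
  have "leibniz k (\<lambda>i. a (Suc i)) b = a (Suc k) * b 0 + (\<Sum>j<k. ?c j)"
  proof (cases k)
    case (Suc l)
    have "(\<Sum>j\<le>l. real (k choose Suc j) * (a (Suc (k - Suc j)) * b (Suc j))) = (\<Sum>j<k. ?c j)"
      using Suc by (intro sum.cong) (auto simp: Suc_diff_le)
    then show ?thesis
      unfolding leibniz_def Suc by (subst sum.atMost_Suc_shift) simp
  qed (simp add: leibniz_def)
  also have "(\<Sum>j<k. ?c j) = (\<Sum>j\<le>k. ?c j)"
    by (simp flip: lessThan_Suc_atMost)
  finally have "leibniz k (\<lambda>i. a (Suc i)) b + leibniz k a (\<lambda>j. b (Suc j))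
      = a (Suc k) * b 0 + (\<Sum>j\<le>k. ?c j + real (k choose j) * (a (k - j) * b (Suc j)))"
    by (simp add: leibniz_def sum.distrib)
  also have "\<dots> = leibniz (Suc k) a b"
    unfolding leibniz_def by (subst sum.atMost_Suc_shift) (simp add: algebra_simps)
  finally show ?thesis .
qed

lemma DERIV_leibniz:
  assumes "\<And>i. ((\<lambda>x. a i x) has_real_derivative a (Suc i) x) (at x)"
    and "\<And>i. ((\<lambda>x. b i x) has_real_derivative b (Suc i) x) (at x)"
  shows "((\<lambda>x. leibniz k (\<lambda>i. a i x) (\<lambda>j. b j x)) has_real_derivative
      leibniz (Suc k) (\<lambda>i. a i x) (\<lambda>j. b j x)) (at x)"
  unfolding leibniz_Suc[symmetric]
  by (auto simp: leibniz_def sum.distrib[symmetric] algebra_simps intro!: derivative_eq_intros assms sum.cong)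

lemma abs_leibniz_le:
  assumes "\<And>i. i \<le> k \<Longrightarrow> \<bar>a i\<bar> \<le> A" "\<And>i. i \<le> k \<Longrightarrow> \<bar>b i\<bar> \<le> B"
  shows "\<bar>leibniz k a b\<bar> \<le> 2 ^ k * (A * B)"
proof -
  have "0 \<le> A" "0 \<le> B" using assms(1)[of 0] assms(2)[of 0] by auto
  have "\<bar>leibniz k a b\<bar> \<le> (\<Sum>j\<le>k. real (k choose j) * (A * B))"
    unfolding leibniz_def
    by (rule order_trans[OF sum_abs], rule sum_mono)
      (use assms \<open>0 \<le> A\<close> in \<open>auto simp: abs_mult intro!: mult_left_mono mult_mono\<close>)
  also have "\<dots> = 2 ^ k * (A * B)"
    by (simp flip: sum_distrib_right of_nat_sum add: choose_row_sum)
  finally show ?thesis .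
qed

lemma continuous_leibniz:
  assumes "\<And>i. continuous_on S (\<lambda>z. a i z)" "\<And>i. continuous_on S (\<lambda>z. b i z)"
  shows "continuous_on S (\<lambda>z. leibniz k (\<lambda>i. a i z) (\<lambda>j. b j z))"
  unfolding leibniz_def by (intro continuous_intros assms)

lemma duhamel_diff:
  assumes F: "continuous_on UNIV (\<lambda>(t, x). F t x)" "continuous_on UNIV \<beta>" "\<And>t x. \<bar>F t x\<bar> \<le> \<beta> t"
    and G: "continuous_on UNIV (\<lambda>(t, x). G t x)" "continuous_on UNIV \<beta>'" "\<And>t x. \<bar>G t x\<bar> \<le> \<beta>' t"
  shows "duhamel (\<lambda>t x. F t x - G t x) t x = duhamel F t x - duhamel G t x"
proof -
  have "continuous_on UNIV (F t)" "continuous_on UNIV (G t)" for t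
    using continuous_on_compose2[OF F(1) continuous_on_Pair[OF continuous_on_const continuous_on_id]]
      continuous_on_compose2[OF G(1) continuous_on_Pair[OF continuous_on_const continuous_on_id]]
    by (simp_all add: subset_UNIV)
  then have "gauss_avg (\<lambda>x. F t x - G t x) c x = gauss_avg (F t) c x - gauss_avg (G t) c x" for t c x
    unfolding gauss_avg_def
    by (intro Bochner_Integration.integral_diff integrable_gauss_avg[of "F t" "\<beta> t"]
        integrable_gauss_avg[of "G t" "\<beta>' t"]) (use F(3) G(3) in auto)
  then show ?thesis
    unfolding duhamel_def right_diff_distrib[symmetric]
    by (simp only: Henstock_Kurzweil_Integration.integral_diff[OF duhamel_integrable[OF F] duhamel_integrable[OF G]])
qed

text \<open>\<open>m k p\<close> and \<open>f k\<close> are the \<open>k\<close>-th derivatives of the potential \<open>m 0 p\<close> with parameter \<open>p\<close>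
  and of the initial value \<open>f 0\<close>.  The series \<open>w k p\<close> is the \<open>k\<close>-th space derivative of the
  solution of \<open>w\<^sub>t = w\<^sub>x\<^sub>x + m 0 p w\<close>; its \<open>n\<close>-th term is homogeneous of degree \<open>n\<close> in the potential.\<close>

locale heat_potential =
  fixes m :: "nat \<Rightarrow> real \<Rightarrow> real \<Rightarrow> real" and f :: "nat \<Rightarrow> real \<Rightarrow> real"
    and Km Kf :: "nat \<Rightarrow> real"
  assumes m_cont: "continuous_on UNIV (\<lambda>(p, x). m k p x)"
    and m_der: "(m k p has_real_derivative m (Suc k) p x) (at x)"
    and m_bd: "\<bar>m k p x\<bar> \<le> Km k"
    and f_der: "(f k has_real_derivative f (Suc k) x) (at x)"
    and f_bd: "\<bar>f k x\<bar> \<le> Kf k"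
begin

text \<open>The recursion prescribes all space derivatives at once, so that it can be stated before
  any differentiability is known; that index \<open>Suc k\<close> really is the derivative of index
  k is then the induction \<open>V_der\<close>.\<close>

primrec V :: "nat \<Rightarrow> nat \<Rightarrow> real \<Rightarrow> real \<Rightarrow> real \<Rightarrow> real" where
  "V 0 k p = (\<lambda>t x. gauss_avg (f k) (sqrt (2 * t)) x)"
| "V (Suc n) k p = duhamel (\<lambda>t x. leibniz k (\<lambda>i. m i p x) (\<lambda>j. V n j p t x))"

abbreviation "S n k p t x \<equiv> leibniz k (\<lambda>i. m i p x) (\<lambda>j. V n j p t x)"

definition "w k p t x = (\<Sum>n. V n k p t x)"

definition "K k = (\<Sum>j\<le>k. Km j + Kf j)"

lemma Km_nonneg: "0 \<le> Km k" and Kf_nonneg: "0 \<le> Kf k"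
  using m_bd[of k 0 0] f_bd[of k 0] by linarith+

lemma K_ge: "i \<le> k \<Longrightarrow> Km i \<le> K k" "i \<le> k \<Longrightarrow> Kf i \<le> K k"
proof -
  assume "i \<le> k"
  then have "Km i + Kf i \<le> K k"
    unfolding K_def by (intro member_le_sum[where f = "\<lambda>j. Km j + Kf j"]) (use Km_nonneg Kf_nonneg in auto)
  then show "Km i \<le> K k" "Kf i \<le> K k" using Km_nonneg[of i] Kf_nonneg[of i] by linarith+
qed

lemma K_nonneg: "0 \<le> K k"
  using K_ge(1)[of k k] Km_nonneg[of k] by linarith

lemma f_cont: "continuous_on UNIV (f k)"
  using f_der by (intro DERIV_continuous_on) (auto intro: has_field_derivative_at_within)

lemma continuous_V0: "continuous_on UNIV (\<lambda>(p, t, x). V 0 k p t x)"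
proof -
  have "continuous_on UNIV (\<lambda>(p, c, x). gauss_avg ((\<lambda>_::real. f k) p) c x)"
    by (rule continuous_gauss_avg[where \<beta> = "\<lambda>_. Kf k"])
      (auto intro!: continuous_intros continuous_on_compose2[OF f_cont] f_bd simp: split_beta)
  from continuous_on_compose2[OF this, of UNIV "\<lambda>z. (0, sqrt (2 * fst (snd z)), snd (snd z))"]
  show ?thesis by (simp add: split_beta continuous_intros)
qed

lemma continuous_S_if:
  assumes "\<And>k. continuous_on UNIV (\<lambda>(p, t, x). V n k p t x)"
  shows "continuous_on UNIV (\<lambda>(p, t, x). S n k p t x)"
  using assms continuous_on_compose2[OF m_cont, of UNIV "\<lambda>z. (fst z, snd (snd z))"]
  unfolding split_beta by (intro continuous_leibniz) (simp_all add: continuous_intros)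

lemma S_bd_if:
  assumes "k \<le> N" "\<And>i. i \<le> N \<Longrightarrow> \<bar>V n i p t x\<bar> \<le> B * (2 ^ N * A * \<bar>t\<bar>) ^ n / fact n"
    and A: "\<And>i. i \<le> N \<Longrightarrow> Km i \<le> A"
  shows "\<bar>S n k p t x\<bar> \<le> (2 ^ N * A * B) * (2 ^ N * A * \<bar>t\<bar>) ^ n / fact n"
proof -
  let ?b = "B * (2 ^ N * A * \<bar>t\<bar>) ^ n / fact n"
  have "0 \<le> A" using A[of 0] Km_nonneg[of 0] by auto
  have "0 \<le> ?b" using assms(2)[of 0] by linarith
  have "\<bar>S n k p t x\<bar> \<le> 2 ^ k * (A * ?b)"
  proof (rule abs_leibniz_le)
    show "\<bar>m i p x\<bar> \<le> A" if "i \<le> k" for i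
      using m_bd[of i p x] A[of i] that assms(1) by linarith
    show "\<bar>V n i p t x\<bar> \<le> ?b" if "i \<le> k" for i using that assms(1,2) by auto
  qed
  also have "\<dots> \<le> 2 ^ N * (A * ?b)"
    using assms(1) \<open>0 \<le> A\<close> \<open>0 \<le> ?b\<close> by (intro mult_right_mono power_increasing mult_nonneg_nonneg) auto
  finally show ?thesis by (simp add: mult_ac)
qed

text \<open>Continuity and bound need each other: \<open>duhamel\<close> is estimated for continuous
  sources and is continuous for bounded ones. N stays fixed because the Leibniz sum of order k
  involves all lower orders. A and B are free for two uses: \<open>K N\<close> gives summable
  majorants for all derivatives, while N = 0 with the sharp constants gives the exact growth rate in
  \<open>w_0_le_exp\<close>.\<close>

lemma V_cont_bd:
  "(\<forall>k. continuous_on UNIV (\<lambda>(p, t, x). V n k p t x)) \<and>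
    (\<forall>N A B k p t x. (\<forall>i\<le>N. Km i \<le> A) \<longrightarrow> (\<forall>i\<le>N. Kf i \<le> B) \<longrightarrow> k \<le> N \<longrightarrow>
      \<bar>V n k p t x\<bar> \<le> B * (2 ^ N * A * \<bar>t\<bar>) ^ n / fact n)"
proof (induction n)
  case 0
  have "\<bar>gauss_avg (f k) c x\<bar> \<le> B" if "\<forall>i\<le>N. Kf i \<le> B" "k \<le> N" for N B k c x
    using gauss_avg_abs_le[OF f_cont f_bd, of k c x] that by force
  then show ?case using continuous_V0 by auto
next
  case (Suc n)
  have Sb: "\<bar>S n k p t x\<bar> \<le> (2 ^ N * A * B) * (2 ^ N * A * \<bar>t\<bar>) ^ n / fact n"
    if "\<forall>i\<le>N. Km i \<le> A" "\<forall>i\<le>N. Kf i \<le> B" "k \<le> N" for N A B k p t x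
    by (rule S_bd_if) (use that Suc in auto)
  have Sc: "continuous_on UNIV (\<lambda>(p, t, x). S n k p t x)" for k
    by (rule continuous_S_if) (use Suc in auto)
  show ?case
  proof (intro conjI allI impI)
    fix N k p t x A B assume k: "\<forall>i\<le>N. Km i \<le> A" "\<forall>i\<le>N. Kf i \<le> B" "k \<le> N"
    have 1: "continuous_on UNIV (\<lambda>(t, x). S n k p t x)"
      using continuous_on_compose2[OF Sc, of UNIV "\<lambda>z. (p, fst z, snd z)"]
      by (simp add: split_beta continuous_intros)
    have "\<bar>V (Suc n) k p t x\<bar> \<le> 2 ^ N * A * B * (2 ^ N * A) ^ n * \<bar>t\<bar> ^ Suc n / fact (Suc n)"
      unfolding V.simps
      by (rule abs_duhamel_le[OF 1, where \<beta> = "\<lambda>t. (2 ^ N * A * B) * (2 ^ N * A * \<bar>t\<bar>) ^ n / fact n"])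
        (auto intro!: continuous_intros Sb k)
    then show "\<bar>V (Suc n) k p t x\<bar> \<le> B * (2 ^ N * A * \<bar>t\<bar>) ^ Suc n / fact (Suc n)"
      by (simp add: power_mult_distrib mult_ac)
  next
    fix k
    show "continuous_on UNIV (\<lambda>(p, t, x). V (Suc n) k p t x)"
      unfolding V.simps
      by (rule continuous_duhamel[OF Sc, where \<beta> = "\<lambda>t. (2 ^ k * K k * K k) * (2 ^ k * K k * \<bar>t\<bar>) ^ n / fact n"])
        (auto intro!: continuous_intros Sb K_ge)
  qed
qed

lemma continuous_V3: "continuous_on UNIV (\<lambda>(p, t, x). V n k p t x)"
  using V_cont_bd by blast

lemma continuous_S3: "continuous_on UNIV (\<lambda>(p, t, x). S n k p t x)"
  by (rule continuous_S_if[OF continuous_V3])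

lemma V_bd_0: "\<bar>V n 0 p t x\<bar> \<le> Kf 0 * (Km 0 * \<bar>t\<bar>) ^ n / fact n"
  using V_cont_bd[of n, THEN conjunct2, rule_format, of 0 "Km 0" "Kf 0" 0 p t x] by simp

definition "bd N n t = K N * (2 ^ N * K N * \<bar>t\<bar>) ^ n / fact n"

lemma V_bd: "\<bar>V n k p t x\<bar> \<le> bd k n t"
  unfolding bd_def
  by (rule V_cont_bd[THEN conjunct2, rule_format]) (use K_ge in auto)

lemma S_bd: "\<bar>S n k p t x\<bar> \<le> 2 ^ k * K k * bd k n t"
proof -
  have "\<bar>S n k p t x\<bar> \<le> (2 ^ k * K k * K k) * (2 ^ k * K k * \<bar>t\<bar>) ^ n / fact n"
    by (rule S_bd_if) (use K_ge in \<open>auto intro!: V_cont_bd[THEN conjunct2, rule_format]\<close>)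
  then show ?thesis by (simp add: bd_def)
qed

lemma bd_cont: "continuous_on UNIV (bd k n)"
  unfolding bd_def by (intro continuous_intros) auto

lemma bd_mono: "\<bar>t\<bar> \<le> T \<Longrightarrow> bd k n t \<le> bd k n T"
  unfolding bd_def using K_nonneg[of k]
  by (intro divide_right_mono mult_left_mono power_mono) auto

lemma bd_summable: "summable (\<lambda>n. bd k n t)"
proof -
  have "summable (\<lambda>n. K k * (inverse (fact n) * (2 ^ k * K k * \<bar>t\<bar>) ^ n))"
    by (intro summable_mult summable_exp)
  then show ?thesis by (simp add: bd_def divide_inverse mult_ac)
qed

lemma continuous_S: "continuous_on UNIV (\<lambda>(t, x). S n k p t x)"
  using continuous_on_compose2[OF continuous_S3, of UNIV "\<lambda>z. (p, fst z, snd z)"]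
  by (simp add: split_beta continuous_intros)

lemma S_bd_cont: "continuous_on UNIV (\<lambda>t. 2 ^ k * K k * bd k n t)"
  by (intro continuous_intros bd_cont)

lemma V_der: "(V n k p t has_real_derivative V n (Suc k) p t x) (at x)"
proof (induction n arbitrary: k t x)
  case 0
  show ?case using DERIV_gauss_avg[OF f_der f_bd f_cont f_bd] by simp
next
  case (Suc n)
  have "((\<lambda>x. S n k p t x) has_real_derivative S n (Suc k) p t x) (at x)" for k t x
    by (intro DERIV_leibniz m_der Suc)
  then show ?case
    unfolding V.simps
    by (intro DERIV_duhamel_space[OF continuous_S S_bd_cont S_bd continuous_S S_bd_cont S_bd])
qed

lemma S_der: "(S n k p t has_real_derivative S n (Suc k) p t x) (at x)"
  by (intro DERIV_leibniz m_der V_der)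

lemma V_time:
  assumes "0 < t"
  shows "((\<lambda>t. V n k p t x) has_real_derivative
    V n (k + 2) p t x + (case n of 0 \<Rightarrow> 0 | Suc n \<Rightarrow> S n k p t x)) (at t)"
proof (cases n)
  case 0
  have "((\<lambda>c. gauss_avg (f k) c x) has_real_derivative sqrt (2 * t) * gauss_avg (f (Suc (Suc k))) (sqrt (2 * t)) x)
    (at (sqrt (2 * t)))"
    by (rule DERIV_gauss_avg_scale[OF f_der f_bd f_der f_bd f_cont f_bd])
  moreover have "((\<lambda>t. sqrt (2 * t)) has_real_derivative 1 / sqrt (2 * t)) (at t)"
    using assms by (auto intro!: derivative_eq_intros simp: field_simps)
  ultimately have "((\<lambda>t. gauss_avg (f k) (sqrt (2 * t)) x) has_real_derivative
      sqrt (2 * t) * gauss_avg (f (Suc (Suc k))) (sqrt (2 * t)) x * (1 / sqrt (2 * t))) (at t)"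
    by (rule DERIV_chain2[where g = "\<lambda>t. sqrt (2 * t)"])
  then show ?thesis using assms 0 by simp
next
  case (Suc n')
  show ?thesis
    using DERIV_duhamel_time[OF continuous_S S_bd_cont S_bd S_der S_bd S_der S_bd continuous_S S_bd_cont assms]
    by (simp add: Suc add.commute)
qed

lemma V_summable: "summable (\<lambda>n. V n k p t x)"
  by (rule summable_comparison_test'[OF bd_summable[of k t]]) (simp add: V_bd)

lemma S_summable: "summable (\<lambda>n. S n k p t x)"
  by (rule summable_comparison_test'[OF summable_mult[OF bd_summable[of k t], of "2 ^ k * K k"]]) (simp add: S_bd)

text \<open>The majorants are uniform in p and x but grow with t, so the Weierstrass test is applied
  on strips of bounded t.\<close>

lemma w_cont: "continuous_on UNIV (\<lambda>(p, t, x). w k p t x)"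
proof -
  have *: "continuous_on (UNIV \<times> {-T<..<T} \<times> UNIV) (\<lambda>(p, t, x). w k p t x)" for T
  proof -
    have "uniform_limit (UNIV \<times> {-T<..<T} \<times> UNIV) (\<lambda>N (p, t, x). \<Sum>n<N. V n k p t x)
        (\<lambda>(p, t, x). \<Sum>n. V n k p t x) sequentially"
      unfolding split_beta
      by (rule Weierstrass_m_test[OF _ bd_summable[of k T]])
        (auto intro!: order_trans[OF V_bd bd_mono])
    then show ?thesis
      unfolding w_def
    proof (rule uniform_limit_theorem[rotated])
      show "\<forall>\<^sub>F N in sequentially. continuous_on (UNIV \<times> {-T<..<T} \<times> UNIV) (\<lambda>(p, t, x). \<Sum>n<N. V n k p t x)"
        unfolding split_beta
        by (intro always_eventually allI continuous_intros continuous_on_subset[OF continuous_V3[unfolded split_beta]]) auto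
    qed simp
  qed
  have "isCont (\<lambda>(p, t, x). w k p t x) z" for z :: "real \<times> real \<times> real"
  proof -
    obtain p t x where z: "z = (p, t, x)" by (cases z)
    have "open (UNIV \<times> {-(\<bar>t\<bar> + 1)<..<\<bar>t\<bar> + 1} \<times> UNIV :: (real \<times> real \<times> real) set)"
      by (intro open_Times) auto
    moreover have "z \<in> UNIV \<times> {-(\<bar>t\<bar> + 1)<..<\<bar>t\<bar> + 1} \<times> UNIV" by (auto simp: z)
    ultimately show ?thesis
      using *[of "\<bar>t\<bar> + 1"] by (simp only: continuous_on_eq_continuous_at)
  qed
  then show ?thesis by (simp add: continuous_on_eq_continuous_at)
qed

lemma w_der: "(w k p t has_real_derivative w (Suc k) p t x) (at x)"
  unfolding w_def[abs_def]
proof (rule has_field_derivative_series'(2)[where S = UNIV and ?x0.0 = x])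
  show "uniformly_convergent_on UNIV (\<lambda>N x. \<Sum>n<N. V n (Suc k) p t x)"
    by (rule Weierstrass_m_test'[OF _ bd_summable[of "Suc k" t]]) (simp add: V_bd)
qed (auto intro: V_summable V_der)

lemma w_time:
  assumes "0 < t"
  shows "((\<lambda>t. w k p t x) has_real_derivative
    w (k + 2) p t x + leibniz k (\<lambda>i. m i p x) (\<lambda>j. w j p t x)) (at t)"
proof -
  let ?s = "\<lambda>n t. case n of 0 \<Rightarrow> 0 | Suc n \<Rightarrow> S n k p t x"
  \<comment> \<open>The time derivative of term n contains the source made from term n - 1, so the
    second majorant is shifted by one index.\<close>
  let ?b = "\<lambda>n. bd (k + 2) n (t + 1) + (case n of 0 \<Rightarrow> 0 | Suc n \<Rightarrow> 2 ^ k * K k * bd k n (t + 1))"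
  have b: "summable ?b"
    by (intro summable_add bd_summable, subst summable_Suc_iff[symmetric]) (simp add: summable_mult bd_summable)
  have "((\<lambda>t. w k p t x) has_real_derivative (\<Sum>n. V n (k + 2) p t x + ?s n t)) (at t)"
    unfolding w_def[abs_def]
  proof (rule has_field_derivative_series'(2)[where S = "{0<..<t + 1}" and ?x0.0 = t])
    show "uniformly_convergent_on {0<..<t + 1} (\<lambda>N t. \<Sum>n<N. V n (k + 2) p t x + ?s n t)"
    proof (rule Weierstrass_m_test'[OF _ b])
      fix n s assume s: "s \<in> {0<..<t + 1}"
      have "\<bar>V n (k + 2) p s x\<bar> \<le> bd (k + 2) n (t + 1)"
        using s by (intro order_trans[OF V_bd bd_mono]) auto
      moreover have "\<bar>?s n s\<bar> \<le> (case n of 0 \<Rightarrow> 0 | Suc n \<Rightarrow> 2 ^ k * K k * bd k n (t + 1))"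
        using s K_nonneg[of k] by (auto split: nat.split intro!: order_trans[OF S_bd] mult_left_mono bd_mono)
      ultimately show "norm (V n (k + 2) p s x + ?s n s) \<le> ?b n"
        unfolding real_norm_def by (rule order_trans[OF abs_triangle_ineq add_mono])
    qed
    show "((\<lambda>t. V n k p t x) has_real_derivative V n (k + 2) p s x + ?s n s) (at s within {0<..<t + 1})"
      if "s \<in> {0<..<t + 1}" for n s
      by (rule has_field_derivative_at_within[OF V_time]) (use that in simp)
    show "t \<in> interior {0<..<t + 1}" using assms by simp
    show "t \<in> {0<..<t + 1}" using assms by simp
  qed (simp_all only: V_summable convex_real_interval)
  also have "(\<Sum>n. V n (k + 2) p t x + ?s n t) = w (k + 2) p t x + (\<Sum>n. S n k p t x)"
  proof -
    have s: "summable (\<lambda>n. ?s n t)"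
      by (subst summable_Suc_iff[symmetric]) (simp add: S_summable)
    have "(\<Sum>n. V n (k + 2) p t x + ?s n t) = (\<Sum>n. V n (k + 2) p t x) + (\<Sum>n. ?s n t)"
      by (rule suminf_add[OF V_summable s, symmetric])
    moreover have "(\<Sum>n. S n k p t x) = (\<Sum>n. ?s n t)"
      using suminf_split_head[OF s] by (simp only: nat.case diff_zero)
    ultimately show ?thesis unfolding w_def by (simp only:)
  qed
  also have "(\<Sum>n. S n k p t x) = leibniz k (\<lambda>i. m i p x) (\<lambda>j. w j p t x)"
    unfolding leibniz_def w_def
    by (simp only: suminf_mult[OF summable_mult[OF V_summable]] suminf_mult[OF V_summable]
        suminf_sum[OF summable_mult[OF summable_mult[OF V_summable]]])
  finally show ?thesis .
qed

lemma w_bd: "\<bar>t\<bar> \<le> T \<Longrightarrow> \<bar>w k p t x\<bar> \<le> (\<Sum>n. bd k n T)"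
proof -
  assume "\<bar>t\<bar> \<le> T"
  then have *: "\<bar>V n k p t x\<bar> \<le> bd k n T" for n
    by (rule order_trans[OF V_bd bd_mono])
  have "norm (\<Sum>n. V n k p t x) \<le> (\<Sum>n. bd k n T)"
    by (rule norm_suminf_le[OF _ bd_summable]) (simp add: *)
  then show ?thesis by (simp add: w_def)
qed

lemma w_0_le_exp:
  assumes "0 \<le> t"
  shows "\<bar>w 0 p t x\<bar> \<le> Kf 0 * exp (Km 0 * t)"
proof -
  have s: "(\<lambda>n. Kf 0 * ((Km 0 * t) ^ n /\<^sub>R fact n)) sums (Kf 0 * exp (Km 0 * t))"
    by (intro sums_mult exp_converges)
  have "norm (\<Sum>n. V n 0 p t x) \<le> (\<Sum>n. Kf 0 * ((Km 0 * t) ^ n /\<^sub>R fact n))"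
    by (rule norm_suminf_le[OF _ sums_summable[OF s]])
      (use V_bd_0[of _ p t x] assms in \<open>simp add: divide_inverse mult_ac\<close>)
  then show ?thesis unfolding w_def real_norm_def sums_unique[OF s, symmetric] .
qed

lemma w_initial: "w k p 0 x = f k x"
proof -
  have "V n k p 0 x = (if n = 0 then f k x else 0)" for n
    by (cases n) (auto simp: duhamel_def)
  then have "(\<lambda>n. V n k p 0 x) = (\<lambda>n. if n = 0 then f k x else 0)" by (rule ext)
  then show ?thesis unfolding w_def using sums_unique[OF sums_single[of 0 "\<lambda>_. f k x"]] by simp
qed

lemma V_nonneg:
  assumes "\<And>x. 0 \<le> f 0 x" "\<And>x. 0 \<le> m 0 p x" "0 \<le> t"
  shows "0 \<le> V n 0 p t x"
  using assms(3)
proof (induction n arbitrary: t x)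
  case (Suc n)
  then show ?case
    using assms(2) unfolding V.simps
    by (intro duhamel_nonneg[OF continuous_S S_bd_cont S_bd]) auto
qed (simp add: gauss_avg_nonneg assms)

lemma w_nonneg:
  assumes "\<And>x. 0 \<le> f 0 x" "\<And>x. 0 \<le> m 0 p x" "0 \<le> t"
  shows "0 \<le> w 0 p t x"
  unfolding w_def by (intro suminf_nonneg V_summable V_nonneg assms)

text \<open>Every Dyson term is monotone in a nonnegative potential when f is nonnegative. So all
  differences of terms are nonnegative, and the one for n = 1, in which only the free heat flow of f
  occurs, may be kept alone.\<close>

lemma w_diff_ge:
  assumes f: "\<And>x. 0 \<le> f 0 x" and m: "\<And>x. 0 \<le> m 0 p' x" "\<And>x. m 0 p' x \<le> m 0 p x" and t: "0 \<le> t"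
  shows "duhamel (\<lambda>t x. (m 0 p x - m 0 p' x) * gauss_avg (f 0) (sqrt (2 * t)) x) t x
    \<le> w 0 p t x - w 0 p' t x"
proof -
  have S_diff: "V (Suc n) 0 p t x - V (Suc n) 0 p' t x
      = duhamel (\<lambda>t x. S n 0 p t x - S n 0 p' t x) t x" for n t x
    unfolding V.simps
    by (rule duhamel_diff[OF continuous_S S_bd_cont S_bd continuous_S S_bd_cont S_bd, symmetric])
  have *: "0 \<le> V n 0 p t x - V n 0 p' t x" if "0 \<le> t" for n t x
    using that
  proof (induction n arbitrary: t x)
    case (Suc n)
    show ?case
      unfolding S_diff
    proof (rule duhamel_nonneg[where \<beta> = "\<lambda>t. 2 ^ 0 * K 0 * bd 0 n t + 2 ^ 0 * K 0 * bd 0 n t", OF _ _ _ Suc(2)])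
      show "continuous_on UNIV (\<lambda>(t, x). S n 0 p t x - S n 0 p' t x)"
        using continuous_on_diff[OF continuous_S continuous_S] unfolding split_beta .
      show "\<bar>S n 0 p t x - S n 0 p' t x\<bar> \<le> 2 ^ 0 * K 0 * bd 0 n t + 2 ^ 0 * K 0 * bd 0 n t" for t x
        using S_bd[where n=n and k=0 and p=p and t=t and x=x] S_bd[where n=n and k=0 and p=p' and t=t and x=x] by linarith
      show "0 \<le> S n 0 p s x - S n 0 p' s x" if "0 \<le> s" for s x
      proof -
        have "m 0 p' x * V n 0 p' s x \<le> m 0 p x * V n 0 p s x"
          using m Suc(1)[OF that, of x] V_nonneg[OF f m(1) that, where n=n and x=x]
            order_trans[OF m] by (intro mult_mono) auto
        then show ?thesis by simp
      qed
    qed (intro continuous_intros bd_cont)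
  qed simp
  have "(\<Sum>n\<in>{1}. V n 0 p t x - V n 0 p' t x) \<le> (\<Sum>n. V n 0 p t x - V n 0 p' t x)"
    by (rule sum_le_suminf[OF summable_diff[OF V_summable V_summable]]) (use * t in auto)
  also have "\<dots> = w 0 p t x - w 0 p' t x"
    unfolding w_def by (rule suminf_diff[OF V_summable V_summable, symmetric])
  finally have "V (Suc 0) 0 p t x - V (Suc 0) 0 p' t x \<le> w 0 p t x - w 0 p' t x" by simp
  then show ?thesis unfolding S_diff by (simp add: left_diff_distrib)
qed

end

section \<open>Functions of class $C^k$ in several variables\<close>

lemma Rn_iff: "x \<in> Rn n \<longleftrightarrow> (\<forall>i\<ge>n. x i = 0)"
  by (simp add: topspace_Euclidean_space)

lemma continuous_on_coord [continuous_intros]: "continuous_on S (\<lambda>z. z i)"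
  for S :: "(nat \<Rightarrow> real) set"
  by (rule continuous_on_product_then_coordinatewise) (rule continuous_on_id)

lemma continuous_on_fun_upd: "continuous_on S (\<lambda>s. x(i := s))" for x :: "nat \<Rightarrow> real"
proof (rule continuous_on_coordinatewise_then_product)
  show "continuous_on S (\<lambda>s. (x(i := s)) j)" for j by (cases "j = i") auto
qed

lemma eventually_fun_upd:
  assumes "openin (Euclidean_space n) U" "x \<in> U" "i < n"
  shows "\<forall>\<^sub>F s in nhds (x i). x(i := s) \<in> U"
proof -
  have "openin (top_of_set (Rn n)) U"
    using assms(1) by (subst Euclidean_space_eq_top_of_set[symmetric])
  then obtain T where T: "open T" "U = Rn n \<inter> T"
    by (auto simp: openin_open)
  have "open ((\<lambda>s. x(i := s)) -` T)"
    using continuous_on_fun_upd T(1) by (rule open_vimage[rotated])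
  moreover have "x i \<in> (\<lambda>s. x(i := s)) -` T" using assms T by auto
  ultimately have "\<forall>\<^sub>F s in nhds (x i). s \<in> (\<lambda>s. x(i := s)) -` T"
    by (rule eventually_nhds_in_open)
  then show ?thesis
    by (rule eventually_mono) (use assms T in \<open>auto simp: Rn_iff\<close>)
qed

lemma C_diff_cont: "C_diff n U k f \<Longrightarrow> continuous_on U f"
  by (cases k) auto

lemma C_diff_SucD: "C_diff n U (Suc k) f \<Longrightarrow> C_diff n U k f"
  by (induction k arbitrary: f) (simp, metis C_diff.simps(2))

lemma C_diff_partial:
  assumes "C_diff n U (Suc k) f" "i < n"
  shows "C_diff n U k (partial i f)"
    "x \<in> U \<Longrightarrow> ((\<lambda>s. f (x(i := s))) has_real_derivative partial i f x) (at (x i))"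
  using assms by (auto simp: has_partial_def partial_def real_differentiable_def dest: DERIV_imp_deriv)

lemma eventually_eq_fun_upd:
  assumes "openin (Euclidean_space n) U" "x \<in> U" "i < n" "\<And>x. x \<in> U \<Longrightarrow> f x = g x"
  shows "\<forall>\<^sub>F s in nhds (x i). f (x(i := s)) = g (x(i := s))"
  using eventually_fun_upd[OF assms(1-3)] by (rule eventually_mono) (rule assms(4))

lemma C_diff_cong:
  assumes "openin (Euclidean_space n) U"
  shows "(\<And>x. x \<in> U \<Longrightarrow> f x = g x) \<Longrightarrow> C_diff n U k f \<Longrightarrow> C_diff n U k g"
proof (induction k arbitrary: f g)
  case 0
  then show ?case by (simp cong: continuous_on_cong)
next
  case (Suc k)
  have D: "((\<lambda>s. g (x(i := s))) has_real_derivative partial i f x) (at (x i))"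
    if "i < n" "x \<in> U" for i x
    by (rule DERIV_cong_ev[OF refl eventually_eq_fun_upd[OF assms that(2,1) Suc.prems(1)] refl, THEN iffD1,
          OF _ C_diff_partial(2)[OF Suc.prems(2) that]])
  have "C_diff n U k (partial i g)" if "i < n" for i
    by (rule Suc.IH[OF _ C_diff_partial(1)[OF Suc.prems(2) that]])
      (simp add: partial_def[of _ g] DERIV_imp_deriv[OF D[OF that]])
  moreover have "continuous_on U g"
    using C_diff_cont[OF Suc.prems(2)] Suc.prems(1) by (simp cong: continuous_on_cong)
  moreover have "has_partial i g x" if "i < n" "x \<in> U" for i x
    using D[OF that] by (auto simp: has_partial_def real_differentiable_def)
  ultimately show ?case by simp
qed

lemma C_diff_SucI:
  assumes "openin (Euclidean_space n) U" "continuous_on U f"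
    and "\<And>i x. i < n \<Longrightarrow> x \<in> U \<Longrightarrow> ((\<lambda>s. f (x(i := s))) has_real_derivative g i x) (at (x i))"
    and "\<And>i. i < n \<Longrightarrow> C_diff n U k (g i)"
  shows "C_diff n U (Suc k) f"
proof -
  have "C_diff n U k (partial i f)" if "i < n" for i
    by (rule C_diff_cong[OF assms(1) _ assms(4)[OF that]])
      (simp add: partial_def DERIV_imp_deriv[OF assms(3)[OF that]])
  then show ?thesis
    using assms(2,3) by (auto simp: has_partial_def real_differentiable_def)
qed

context
  fixes n :: nat and U :: "(nat \<Rightarrow> real) set"
  assumes U: "openin (Euclidean_space n) U"
begin

lemma C_diff_const: "C_diff n U k (\<lambda>_. c)"
proof (induction k arbitrary: c)
  case (Suc k)
  show ?case by (rule C_diff_SucI[OF U, where g = "\<lambda>i x. 0"]) (auto intro: Suc)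
qed simp

lemma C_diff_add: "C_diff n U k f \<Longrightarrow> C_diff n U k g \<Longrightarrow> C_diff n U k (\<lambda>x. f x + g x)"
proof (induction k arbitrary: f g)
  case (Suc k)
  show ?case
  proof (rule C_diff_SucI[OF U, where g = "\<lambda>i x. partial i f x + partial i g x"])
    show "((\<lambda>s. f (x(i := s)) + g (x(i := s))) has_real_derivative partial i f x + partial i g x) (at (x i))"
      if "i < n" "x \<in> U" for i x
      by (intro DERIV_add Suc.prems[THEN C_diff_partial(2), OF that])
    show "C_diff n U k (\<lambda>x. partial i f x + partial i g x)" if "i < n" for i
      by (intro Suc.IH Suc.prems[THEN C_diff_partial(1), OF that])
  qed (intro continuous_intros Suc.prems[THEN C_diff_cont])
qed (auto intro: continuous_intros)

lemma C_diff_mult: "C_diff n U k f \<Longrightarrow> C_diff n U k g \<Longrightarrow> C_diff n U k (\<lambda>x. f x * g x)"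
proof (induction k arbitrary: f g)
  case (Suc k)
  show ?case
  proof (rule C_diff_SucI[OF U, where g = "\<lambda>i x. partial i f x * g x + partial i g x * f x"])
    show "((\<lambda>s. f (x(i := s)) * g (x(i := s))) has_real_derivative partial i f x * g x + partial i g x * f x) (at (x i))"
      if "i < n" "x \<in> U" for i x
      using DERIV_mult[OF Suc.prems[THEN C_diff_partial(2), OF that]] by (simp del: fun_upd_apply)
    show "C_diff n U k (\<lambda>x. partial i f x * g x + partial i g x * f x)" if "i < n" for i
      by (intro C_diff_add Suc.IH Suc.prems[THEN C_diff_SucD] Suc.prems[THEN C_diff_partial(1), OF that])
  qed (intro continuous_intros Suc.prems[THEN C_diff_cont])
qed (auto intro: continuous_intros)

lemma C_diff_sum: "(\<And>i. i \<in> I \<Longrightarrow> C_diff n U k (f i)) \<Longrightarrow> C_diff n U k (\<lambda>x. \<Sum>i\<in>I. f i x)"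
  by (induction I rule: infinite_finite_induct) (auto intro!: C_diff_const C_diff_add)

lemma C_diff_coord:
  assumes "i < n" "\<And>x. x \<in> U \<Longrightarrow> x i \<in> T"
  shows "k_diff False T k g \<Longrightarrow> C_diff n U k (\<lambda>x. g (x i))"
proof (induction k arbitrary: g)
  case 0
  then show ?case
    using assms(2) by (auto intro!: continuous_on_compose2[of T g] continuous_intros)
next
  case (Suc k)
  then obtain g' where g: "\<forall>x\<in>T. (g has_real_derivative g' x) (at x)" "k_diff False T k g'" by auto
  show ?case
  proof (rule C_diff_SucI[OF U, where g = "\<lambda>j x. if j = i then g' (x i) else 0"])
    show "continuous_on U (\<lambda>x. g (x i))"
      using k_diff_cont[OF Suc.prems] assms(2) by (auto intro!: continuous_on_compose2[of T g] continuous_intros)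
    show "((\<lambda>s. g ((x(j := s)) i)) has_real_derivative (if j = i then g' (x i) else 0)) (at (x j))"
      if "x \<in> U" for j x
      using g(1) assms(2)[OF that] by auto
    show "C_diff n U k (\<lambda>x. if j = i then g' (x i) else 0)" for j
      by (cases "j = i") (simp_all add: Suc.IH[OF g(2)] C_diff_const)
  qed
qed

end

text \<open>The prefactor c makes the class closed under both derivatives: in x, G becomes G'; in y,
  there arise c' G and - c \<ell>' G', where \<ell> is \<open>log_shift\<close>. Only continuity at
  y \<le> 0 is delicate, and \<open>isCont_shifted\<close> handles it for every c.\<close>

lemma C_diff_shifted:
  assumes "\<And>j. k_diff False {0<..} j c" "\<And>j. k_diff False UNIV j G" "\<And>x. x < 0 \<Longrightarrow> G x = 0"
  shows "C_diff 2 (Rn 2) k (\<lambda>z. if 0 < z 1 then c (z 1) * G (z 0 - log_shift (z 1)) else 0)"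
  using assms
proof (induction k arbitrary: c G)
  case (0 c G)
  have "continuous_on UNIV (\<lambda>(y, x). if 0 < y then c y * G (x - log_shift y) else 0)"
    using isCont_shifted[OF k_diff_cont[OF 0(1)] k_diff_cont[OF 0(2)] 0(3)]
    by (auto simp: continuous_on_eq_continuous_at)
  then have "continuous_on (Rn 2) (\<lambda>z. (\<lambda>(y, x). if 0 < y then c y * G (x - log_shift y) else 0) (z 1, z 0))"
    by (rule continuous_on_compose2) (auto intro!: continuous_intros)
  then show ?case by (simp only: C_diff.simps split_conv)
next
  case (Suc k c G)
  let ?f = "\<lambda>c G z. if 0 < z 1 then c (z 1) * G (z 0 - log_shift (z 1)) else (0::real)"
  have U: "openin (Euclidean_space 2) (Rn 2)" by simp
  have c: "k_diff False {0<..} j (deriv c)" for j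
    using k_diff_deriv_iter[OF Suc.prems(1), of j 1] by simp
  have cd: "(c has_real_derivative deriv c y) (at y)" if "0 < y" for y
    using DERIV_deriv_iter[OF Suc.prems(1), of y 0] that by simp
  have G: "k_diff False UNIV j (deriv G)" for j
    using k_diff_deriv_iter[OF Suc.prems(2), of j 1] by simp
  have Gd: "(G has_real_derivative deriv G x) (at x)" for x
    using DERIV_deriv_iter[OF Suc.prems(2), of x 0] by simp
  have G0: "deriv G x = 0" if "x < 0" for x
  proof (rule DERIV_imp_deriv)
    show "(G has_real_derivative 0) (at x)"
      by (rule has_field_derivative_transform_within_open[of "\<lambda>_. 0" _ _ "{..<0}"])
        (use that Suc.prems(3) in auto)
  qed
  define g where "g i z = (if i = (0::nat) then ?f c (deriv G) z
      else ?f (deriv c) G z + ?f (\<lambda>y. - (c y * log_shift' y)) (deriv G) z)" for i :: nat and z :: "nat \<Rightarrow> real"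
  show ?case
  proof (rule C_diff_SucI[OF U, where g = g])
    show "continuous_on (Rn 2) (?f c G)"
    proof -
      have "continuous_on UNIV (\<lambda>(y, x). if 0 < y then c y * G (x - log_shift y) else 0)"
        using isCont_shifted[OF k_diff_cont[OF Suc.prems(1)] k_diff_cont[OF Suc.prems(2)] Suc.prems(3)]
        by (auto simp: continuous_on_eq_continuous_at)
      then have "continuous_on (Rn 2) (\<lambda>z. (\<lambda>(y, x). if 0 < y then c y * G (x - log_shift y) else 0) (z 1, z 0))"
        by (rule continuous_on_compose2) (auto intro!: continuous_intros)
      then show ?thesis by (simp only: split_conv)
    qed
    show "C_diff 2 (Rn 2) k (g i)" if "i < 2" for i
    proof (cases "i = 0")
      case True
      then show ?thesis
        unfolding g_def using Suc.IH[OF Suc.prems(1) G G0] by simp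
    next
      case False
      have "k_diff False {0<..} j (\<lambda>y. - (c y * log_shift' y))" for j
        by (intro k_diff_uminus k_diff_mult Suc.prems k_diff_shift')
      then have "C_diff 2 (Rn 2) k (\<lambda>z. ?f (deriv c) G z + ?f (\<lambda>y. - (c y * log_shift' y)) (deriv G) z)"
        by (intro C_diff_add[OF U] Suc.IH c Suc.prems(2,3) G G0)
      then show ?thesis
        unfolding g_def[abs_def] if_not_P[OF False] .
    qed
    fix i :: nat and z assume i: "i < 2" and "z \<in> Rn 2"
    consider "i = 0" | "i = 1" "0 < z 1" | "i = 1" "z 1 \<le> 0" using i by linarith
    then show "((\<lambda>s. ?f c G (z(i := s))) has_real_derivative g i z) (at (z i))"
    proof cases
      case 1
      have "((\<lambda>s. c (z 1) * G (s - log_shift (z 1))) has_real_derivative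
          c (z 1) * deriv G (z 0 - log_shift (z 1))) (at (z 0))"
        by (rule DERIV_cong[OF DERIV_cmult[OF DERIV_chain2[OF Gd]]], (rule derivative_eq_intros refl | simp)+)
      then show ?thesis using 1 by (simp add: g_def)
    next
      case 2
      have "((\<lambda>s. G (z 0 - log_shift s)) has_real_derivative
          deriv G (z 0 - log_shift (z 1)) * - log_shift' (z 1)) (at (z 1))"
        by (rule DERIV_chain2[OF Gd], rule DERIV_cong[OF DERIV_diff[OF DERIV_const DERIV_shift]]) (use 2 in auto)
      from DERIV_mult[OF cd[OF 2(2)] this]
      have "((\<lambda>s. c s * G (z 0 - log_shift s)) has_real_derivative g i z) (at (z 1))"
        using 2 by (simp add: g_def algebra_simps)
      then show ?thesis
        unfolding 2(1)
        by (rule has_field_derivative_transform_within_open[of _ _ _ "{0<..}"]) (use 2 in auto)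
    next
      case 3
      \<comment> \<open>On the line through z in direction y the function is 0 for all s < e: for s
        \<le> 0 by definition, for 0 < s because \<open>z 0 - log_shift s\<close> is
        negative.\<close>
      obtain e where e: "e > 0" "\<And>y. 0 < y \<Longrightarrow> y < e \<Longrightarrow> z 0 < log_shift y"
        using shift_eventually_ge[of "z 0"] by blast
      have "g 1 z = 0" using 3 by (simp add: g_def)
      moreover have "((\<lambda>s. ?f c G (z(1 := s))) has_real_derivative 0) (at (z 1))"
        by (rule has_field_derivative_transform_within_open[of "\<lambda>_. 0" _ _ "{..<e}"])
          (use 3 e Suc.prems(3) in auto)
      ultimately show ?thesis unfolding 3(1) by (simp only:)
    qed
  qed
qed

lemma second_derivative_nonneg_at_min:
  fixes g :: "real \<Rightarrow> real"
  assumes g: "\<forall>\<^sub>F s in nhds x. (g has_real_derivative g' s) (at s)" "(g' has_real_derivative D) (at x)"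
    and min: "\<forall>\<^sub>F s in nhds x. g x \<le> g s"
  shows "g' x = 0" "0 \<le> D"
proof -
  have "\<forall>\<^sub>F s in nhds x. (g has_real_derivative g' s) (at s) \<and> g x \<le> g s"
    using g(1) min by (rule eventually_conj)
  then obtain d where d: "0 < d" "\<And>s. \<bar>s - x\<bar> < d \<Longrightarrow> (g has_real_derivative g' s) (at s)"
      "\<And>s. \<bar>s - x\<bar> < d \<Longrightarrow> g x \<le> g s"
    by (auto simp: eventually_nhds_metric dist_real_def)
  show 0: "g' x = 0"
    by (rule DERIV_local_min[OF d(2)[of x] d(1)]) (use d in \<open>auto simp: abs_minus_commute\<close>)
  show "0 \<le> D"
  proof (rule ccontr)
    assume "\<not> 0 \<le> D"
    then obtain e where e: "0 < e" "\<And>h. 0 < h \<Longrightarrow> h < e \<Longrightarrow> g' (x + h) < 0"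
      using DERIV_neg_dec_right[OF g(2)] 0 by force
    define h where "h = min d e / 2"
    have h: "0 < h" "h < d" "h < e" using d(1) e(1) by (auto simp: h_def)
    obtain s where s: "x < s" "s < x + h" "g (x + h) - g x = (x + h - x) * g' s"
      using MVT2[of x "x + h" g g'] d(2) h by force
    have "g' s < 0" using e(2)[of "s - x"] s h by simp
    then have "g (x + h) - g x < 0" using s(3) h by (simp add: mult_pos_neg)
    then show False using d(3)[of "x + h"] h by simp
  qed
qed

section \<open>Viscosity solutions\<close>

text \<open>The equation lives in dimension 2: coordinate 0 diffuses and coordinate 1 is a parameter.\<close>

definition diffusion :: "nat \<Rightarrow> nat \<Rightarrow> real" where
  "diffusion i j = (if i = 0 \<and> j = 0 then 1 else 0)"

definition drift_field :: "(real \<Rightarrow> real \<Rightarrow> real) \<Rightarrow> (nat \<Rightarrow> real) \<Rightarrow> nat \<Rightarrow> real" where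
  "drift_field b x i = (if i = 0 then b (x 1) (x 0) else 0)"

abbreviation param_op :: "(real \<Rightarrow> real \<Rightarrow> real) \<Rightarrow> nonlinearity" where
  "param_op b \<equiv> kolmogorov_op 2 (drift_field b) diffusion"

text \<open>Space-time shifts the indices by one: \<open>z 0\<close> is the time, \<open>z 1\<close>
  the diffusing variable and \<open>z 2\<close> the parameter.\<close>

lemma param_op_eq: "param_op b z r p M = p 0 - M 1 1 - b (z 2) (z 1) * p 1"
  by (simp add: kolmogorov_op_def drift_field_def diffusion_def numeral_2_eq_2)

lemma diffusion_sym: "diffusion \<in> sym_mats 2"
  by (auto simp: sym_mats_def diffusion_def)

lemma diffusion_nonneg: "mat_le 2 (\<lambda>i j. 0) diffusion"
  by (simp add: mat_le_def diffusion_def numeral_2_eq_2)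

lemma degenerate_elliptic_param_op: "degenerate_elliptic 3 U (param_op b)"
  unfolding degenerate_elliptic_def
proof (intro ballI allI impI)
  fix z r p M N assume "mat_le 3 N M"
  moreover have "(\<lambda>i. if i = 1 then 1 else 0) \<in> Rn 3" by (auto simp: Rn_iff)
  ultimately have "N 1 1 \<le> M 1 1"
    unfolding mat_le_def by (fastforce simp: eval_nat_numeral)
  then show "param_op b z r p M \<le> param_op b z r p N" by (simp add: param_op_eq)
qed

abbreviation space_part :: "(nat \<Rightarrow> real) \<Rightarrow> nat \<Rightarrow> real" where
  "space_part z \<equiv> \<lambda>i. z (Suc i)"

lemma space_part_Rn: "z \<in> Rn 3 \<Longrightarrow> space_part z \<in> Rn 2"
  by (auto simp: Rn_iff)

lemma continuous_space_part: "continuous_on S space_part"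
  by (rule continuous_on_coordinatewise_then_product) (intro continuous_intros)

lemma spacetime_iff: "z \<in> spacetime 2 \<longleftrightarrow> z \<in> Rn 3 \<and> 0 < z 0"
  by (simp add: spacetime_def numeral_3_eq_3)

lemma open_spacetime: "openin (Euclidean_space 3) (spacetime 2)"
proof -
  have "openin (top_of_set (Rn 3)) (Rn 3 \<inter> (\<lambda>z. z 0) -` {0<..})"
    by (intro continuous_openin_preimage_gen continuous_intros open_greaterThan)
  also have "Rn 3 \<inter> (\<lambda>z. z 0) -` {0<..} = spacetime 2"
    by (auto simp: spacetime_iff)
  finally show ?thesis by (subst Euclidean_space_eq_top_of_set)
qed

lemma partial_test:
  assumes "C_diff 3 U 2 \<psi>" "openin (Euclidean_space 3) U" "z \<in> U" "i < 3"
  shows "((\<lambda>s. \<psi> (z(i := s))) has_real_derivative gradient 3 \<psi> z i) (at (z i))"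
    and "\<forall>\<^sub>F s in nhds (z i). ((\<lambda>s. \<psi> (z(i := s))) has_real_derivative partial i \<psi> (z(i := s))) (at s)"
    and "((\<lambda>s. partial i \<psi> (z(i := s))) has_real_derivative Hess 3 \<psi> z i i) (at (z i))"
proof -
  have C: "C_diff 3 U (Suc 1) \<psi>" "C_diff 3 U (Suc 0) (partial i \<psi>)"
    using assms C_diff_partial(1)[of 3 U 1 \<psi> i] by (simp_all add: numeral_2_eq_2 del: C_diff.simps)
  show "((\<lambda>s. \<psi> (z(i := s))) has_real_derivative gradient 3 \<psi> z i) (at (z i))"
    using C_diff_partial(2)[OF C(1) assms(4,3)] assms(4) by (simp add: gradient_def)
  show "((\<lambda>s. partial i \<psi> (z(i := s))) has_real_derivative Hess 3 \<psi> z i i) (at (z i))"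
    using C_diff_partial(2)[OF C(2) assms(4,3)] assms(4) by (simp add: Hess_def)
  show "\<forall>\<^sub>F s in nhds (z i). ((\<lambda>s. \<psi> (z(i := s))) has_real_derivative partial i \<psi> (z(i := s))) (at s)"
    using eventually_fun_upd[OF assms(2-4)]
    by (rule eventually_mono) (use C_diff_partial(2)[OF C(1) assms(4)] in fastforce)
qed

lemma gradient_Hess_eq:
  assumes U: "openin (Euclidean_space 3) U" "z \<in> U" and i: "i < 3"
    and \<psi>: "\<And>y. y \<in> U \<Longrightarrow> ((\<lambda>s. \<psi> (y(i := s))) has_real_derivative \<psi>' y) (at (y i))"
  shows "gradient 3 \<psi> z i = \<psi>' z"
    and "((\<lambda>s. \<psi>' (z(i := s))) has_real_derivative D) (at (z i)) \<Longrightarrow> Hess 3 \<psi> z i i = D"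
proof -
  have p: "partial i \<psi> y = \<psi>' y" if "y \<in> U" for y
    unfolding partial_def by (rule DERIV_imp_deriv[OF \<psi>[OF that]])
  show "gradient 3 \<psi> z i = \<psi>' z" using p[OF U(2)] i by (simp add: gradient_def)
  assume "((\<lambda>s. \<psi>' (z(i := s))) has_real_derivative D) (at (z i))"
  then have "((\<lambda>s. partial i \<psi> (z(i := s))) has_real_derivative D) (at (z i))"
    by (rule DERIV_cong_ev[OF refl eventually_eq_fun_upd[OF U i p] refl, THEN iffD2, rotated])
  then show "Hess 3 \<psi> z i i = D"
    using i by (simp add: Hess_def partial_def[of i "partial i \<psi>"] DERIV_imp_deriv)
qed

lemma param_op_uminus:
  assumes \<psi>: "C_diff 3 (spacetime 2) 2 \<psi>" and z: "z \<in> spacetime 2"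
  shows "C_diff 3 (spacetime 2) 2 (\<lambda>z. - \<psi> z)"
    and "param_op b z (- \<psi> z) (gradient 3 (\<lambda>z. - \<psi> z) z) (Hess 3 (\<lambda>z. - \<psi> z) z)
      = - param_op b z (\<psi> z) (gradient 3 \<psi> z) (Hess 3 \<psi> z)"
proof -
  show "C_diff 3 (spacetime 2) 2 (\<lambda>z. - \<psi> z)"
    using C_diff_mult[OF open_spacetime C_diff_const[OF open_spacetime], of 2 \<psi> "-1"] \<psi> by simp
  note U = open_spacetime z
  have "gradient 3 (\<lambda>z. - \<psi> z) z i = - gradient 3 \<psi> z i" if "i < 3" for i
    by (rule gradient_Hess_eq(1)[OF U that, where \<psi>' = "\<lambda>z. - gradient 3 \<psi> z i"])
      (use partial_test(1)[OF _ open_spacetime _ that] \<psi> in \<open>auto intro!: DERIV_minus\<close>)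
  moreover have "Hess 3 (\<lambda>z. - \<psi> z) z 1 1 = - Hess 3 \<psi> z 1 1"
  proof (rule gradient_Hess_eq(2)[OF U, where \<psi>' = "\<lambda>z. - partial 1 \<psi> z"])
    show "((\<lambda>s. - \<psi> (y(1 := s))) has_real_derivative - partial 1 \<psi> y) (at (y 1))" if "y \<in> spacetime 2" for y
      using partial_test(1)[OF _ open_spacetime that, of \<psi> 1] \<psi>
      by (auto intro!: DERIV_minus simp: gradient_def simp del: fun_upd_apply)
    show "((\<lambda>s. - partial 1 \<psi> (z(1 := s))) has_real_derivative - Hess 3 \<psi> z 1 1) (at (z 1))"
      using partial_test(3)[OF _ U, of \<psi> 1] \<psi> by (auto intro!: DERIV_minus)
  qed simp
  ultimately show "param_op b z (- \<psi> z) (gradient 3 (\<lambda>z. - \<psi> z) z) (Hess 3 (\<lambda>z. - \<psi> z) z)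
      = - param_op b z (\<psi> z) (gradient 3 \<psi> z) (Hess 3 \<psi> z)"
    by (simp add: param_op_eq)
qed

text \<open>The operator is linear in the test function, so a change of sign swaps the two notions;
  existence and uniqueness then need a direct argument for subsolutions only.\<close>

lemma viscosity_supersolution_uminus:
  assumes sub: "viscosity_subsolution 3 (spacetime 2) (param_op b) u"
  shows "viscosity_supersolution 3 (spacetime 2) (param_op b) (\<lambda>z. - u z)"
  unfolding viscosity_supersolution_def
proof (intro conjI ballI allI impI, goal_cases)
  case 3
  have "{z \<in> spacetime 2. c < - u z} = {z \<in> spacetime 2. u z < - c}" for c by auto
  then show ?case using sub by (auto simp: viscosity_subsolution_def usc_on_def lsc_on_def)
next
  case (4 z \<psi>)
  then have "\<forall>y\<in>spacetime 2. u y \<le> - \<psi> y" "- \<psi> z = u z" by force+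
  then have "param_op b z (- \<psi> z) (gradient 3 (\<lambda>z. - \<psi> z) z) (Hess 3 (\<lambda>z. - \<psi> z) z) \<le> 0"
    using sub param_op_uminus(1)[of \<psi> z] 4 unfolding viscosity_subsolution_def by blast
  then show ?case using param_op_uminus(2)[of \<psi> z b] 4 by simp
qed (use open_spacetime degenerate_elliptic_param_op in auto)

lemma viscosity_subsolution_uminus:
  assumes sup: "viscosity_supersolution 3 (spacetime 2) (param_op b) u"
  shows "viscosity_subsolution 3 (spacetime 2) (param_op b) (\<lambda>z. - u z)"
  unfolding viscosity_subsolution_def
proof (intro conjI ballI allI impI, goal_cases)
  case 3
  have "{z \<in> spacetime 2. - u z < c} = {z \<in> spacetime 2. - c < u z}" for c by auto
  then show ?case using sup by (auto simp: viscosity_supersolution_def usc_on_def lsc_on_def)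
next
  case (4 z \<psi>)
  then have "\<forall>y\<in>spacetime 2. - \<psi> y \<le> u y" "- \<psi> z = u z" by force+
  then have "0 \<le> param_op b z (- \<psi> z) (gradient 3 (\<lambda>z. - \<psi> z) z) (Hess 3 (\<lambda>z. - \<psi> z) z)"
    using sup param_op_uminus(1)[of \<psi> z] 4 unfolding viscosity_supersolution_def by blast
  then show ?case using param_op_uminus(2)[of \<psi> z b] 4 by simp
qed (use open_spacetime degenerate_elliptic_param_op in auto)

text \<open>A classical solution in t and x with no regularity in y. The x-derivative has to be one
  function, since it is differentiated again along a line, whereas \<open>D\<close> and
  \<open>D2\<close> are numbers at one point.\<close>

definition slice_solution :: "(real \<Rightarrow> real \<Rightarrow> real) \<Rightarrow> (real \<times> (nat \<Rightarrow> real) \<Rightarrow> real) \<Rightarrow> bool" where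
  "slice_solution b u \<longleftrightarrow> (\<exists>u\<^sub>x. \<forall>t>0. \<forall>x\<in>Rn 2. \<exists>D D2.
     ((\<lambda>s. u (s, x)) has_real_derivative D) (at t) \<and>
     ((\<lambda>s. u (t, x(0 := s))) has_real_derivative u\<^sub>x t x) (at (x 0)) \<and>
     ((\<lambda>s. u\<^sub>x t (x(0 := s))) has_real_derivative D2) (at (x 0)) \<and>
     D = D2 + b (x 1) (x 0) * u\<^sub>x t x)"

lemma slice_solution_uminus: "slice_solution b u \<Longrightarrow> slice_solution b (\<lambda>z. - u z)"
  unfolding slice_solution_def
proof (elim exE)
  fix u\<^sub>x assume *: "\<forall>t>0. \<forall>x\<in>Rn 2. \<exists>D D2.
     ((\<lambda>s. u (s, x)) has_real_derivative D) (at t) \<and>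
     ((\<lambda>s. u (t, x(0 := s))) has_real_derivative u\<^sub>x t x) (at (x 0)) \<and>
     ((\<lambda>s. u\<^sub>x t (x(0 := s))) has_real_derivative D2) (at (x 0)) \<and>
     D = D2 + b (x 1) (x 0) * u\<^sub>x t x"
  show "\<exists>u\<^sub>x. \<forall>t>0. \<forall>x\<in>Rn 2. \<exists>D D2.
     ((\<lambda>s. - u (s, x)) has_real_derivative D) (at t) \<and>
     ((\<lambda>s. - u (t, x(0 := s))) has_real_derivative u\<^sub>x t x) (at (x 0)) \<and>
     ((\<lambda>s. u\<^sub>x t (x(0 := s))) has_real_derivative D2) (at (x 0)) \<and>
     D = D2 + b (x 1) (x 0) * u\<^sub>x t x"
  proof (intro exI[of _ "\<lambda>t x. - u\<^sub>x t x"] allI impI ballI)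
    fix t :: real and x assume "0 < t" "x \<in> Rn 2"
    with * obtain D D2 where "((\<lambda>s. u (s, x)) has_real_derivative D) (at t)"
     "((\<lambda>s. u (t, x(0 := s))) has_real_derivative u\<^sub>x t x) (at (x 0))"
     "((\<lambda>s. u\<^sub>x t (x(0 := s))) has_real_derivative D2) (at (x 0))"
     "D = D2 + b (x 1) (x 0) * u\<^sub>x t x" by blast
    then show "\<exists>D D2. ((\<lambda>s. - u (s, x)) has_real_derivative D) (at t) \<and>
       ((\<lambda>s. - u (t, x(0 := s))) has_real_derivative - u\<^sub>x t x) (at (x 0)) \<and>
       ((\<lambda>s. - u\<^sub>x t (x(0 := s))) has_real_derivative D2) (at (x 0)) \<and>
       D = D2 + b (x 1) (x 0) * - u\<^sub>x t x"
      by (intro exI[of _ "- D"] exI[of _ "- D2"] conjI DERIV_minus) auto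
  qed
qed

text \<open>The operator sees no y-derivative, so a test function touching from above is compared
  with u only along the t-line and the x-line through the point. There the difference has a minimum:
  its first derivatives vanish and its second x-derivative is nonnegative.\<close>

lemma slice_solution_viscosity_sub:
  assumes cont: "continuous_on ({0..} \<times> Rn 2) u" and sol: "slice_solution b u"
  shows "viscosity_subsolution 3 (spacetime 2) (param_op b) (\<lambda>z. u (z 0, space_part z))"
  unfolding viscosity_subsolution_def
proof (intro conjI ballI allI impI, goal_cases)
  case 3
  have "continuous_on (spacetime 2) (\<lambda>z. u (z 0, space_part z))"
    by (rule continuous_on_compose2[OF cont])
      (auto intro!: continuous_intros continuous_space_part space_part_Rn simp: spacetime_iff)
  then have "openin (top_of_set (spacetime 2)) (spacetime 2 \<inter> (\<lambda>z. u (z 0, space_part z)) -` {..<c})" for c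
    by (rule continuous_openin_preimage_gen) auto
  moreover have "spacetime 2 \<inter> (\<lambda>z. u (z 0, space_part z)) -` {..<c} = {z \<in> spacetime 2. u (z 0, space_part z) < c}" for c
    by auto
  ultimately show ?case by (simp add: usc_on_def)
next
  case (4 z \<psi>)
  then have C: "C_diff 3 (spacetime 2) 2 \<psi>" and le: "\<And>y. y \<in> spacetime 2 \<Longrightarrow> u (y 0, space_part y) \<le> \<psi> y"
    and eq: "\<psi> z = u (z 0, space_part z)" and z: "z \<in> spacetime 2" by auto
  obtain u\<^sub>x where u: "\<And>t x. 0 < t \<Longrightarrow> x \<in> Rn 2 \<Longrightarrow> \<exists>D D2.
     ((\<lambda>s. u (s, x)) has_real_derivative D) (at t) \<and>
     ((\<lambda>s. u (t, x(0 := s))) has_real_derivative u\<^sub>x t x) (at (x 0)) \<and>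
     ((\<lambda>s. u\<^sub>x t (x(0 := s))) has_real_derivative D2) (at (x 0)) \<and>
     D = D2 + b (x 1) (x 0) * u\<^sub>x t x"
    using sol unfolding slice_solution_def by blast
  define x where "x = space_part z"
  have x: "x \<in> Rn 2" "0 < z 0" using z space_part_Rn by (auto simp: x_def spacetime_iff)
  obtain D D2 where D: "((\<lambda>s. u (s, x)) has_real_derivative D) (at (z 0))"
     "((\<lambda>s. u\<^sub>x (z 0) (x(0 := s))) has_real_derivative D2) (at (x 0))"
     "D = D2 + b (x 1) (x 0) * u\<^sub>x (z 0) x"
    using u[OF x(2,1)] by blast
  have ux: "((\<lambda>s. u (z 0, x(0 := s))) has_real_derivative u\<^sub>x (z 0) (x(0 := s))) (at s)" for s
  proof -
    have "x(0 := s) \<in> Rn 2" using x by (auto simp: Rn_iff)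
    from u[OF x(2) this] show ?thesis by auto
  qed
  have tl: "space_part (z(0 := s)) = x" "space_part (z(1 := s)) = x(0 := s)" for s
    by (auto simp: x_def fun_eq_iff)
  have x0: "x(0 := z 1) = x" by (auto simp: x_def)
  have 0: "gradient 3 \<psi> z 0 - D = 0"
  proof (rule DERIV_local_min)
    show "((\<lambda>s. \<psi> (z(0 := s)) - u (s, x)) has_real_derivative gradient 3 \<psi> z 0 - D) (at (z 0))"
      by (intro DERIV_diff D partial_test(1)[OF C open_spacetime z]) simp
    show "0 < z 0" by (rule x)
    show "\<forall>s. \<bar>z 0 - s\<bar> < z 0 \<longrightarrow> \<psi> (z(0 := z 0)) - u (z 0, x) \<le> \<psi> (z(0 := s)) - u (s, x)"
    proof (intro allI impI)
      fix s assume "\<bar>z 0 - s\<bar> < z 0"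
      then have "z(0 := s) \<in> spacetime 2" using z by (auto simp: spacetime_iff Rn_iff)
      from le[OF this] show "\<psi> (z(0 := z 0)) - u (z 0, x) \<le> \<psi> (z(0 := s)) - u (s, x)"
        using eq unfolding tl by (simp add: x_def)
    qed
  qed
  have ev: "\<forall>\<^sub>F s in nhds (z 1). ((\<lambda>s. \<psi> (z(1 := s)) - u (z 0, x(0 := s))) has_real_derivative
      partial 1 \<psi> (z(1 := s)) - u\<^sub>x (z 0) (x(0 := s))) (at s)"
    by (rule eventually_mono[OF partial_test(2)[OF C open_spacetime z]])
      (auto intro!: DERIV_diff ux simp del: fun_upd_apply)
  have D2: "((\<lambda>s. partial 1 \<psi> (z(1 := s)) - u\<^sub>x (z 0) (x(0 := s))) has_real_derivative
      Hess 3 \<psi> z 1 1 - D2) (at (z 1))"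
    using partial_test(3)[OF C open_spacetime z, of 1] D(2) by (intro DERIV_diff) (auto simp: x_def)
  have min: "\<forall>\<^sub>F s in nhds (z 1). \<psi> (z(1 := z 1)) - u (z 0, x(0 := z 1)) \<le> \<psi> (z(1 := s)) - u (z 0, x(0 := s))"
  proof -
    have "\<forall>\<^sub>F s in nhds (z 1). z(1 := s) \<in> spacetime 2"
      by (rule eventually_fun_upd[OF open_spacetime z]) simp
    then show ?thesis
    proof (rule eventually_mono)
      fix s assume "z(1 := s) \<in> spacetime 2"
      from le[OF this] show "\<psi> (z(1 := z 1)) - u (z 0, x(0 := z 1)) \<le> \<psi> (z(1 := s)) - u (z 0, x(0 := s))"
        unfolding tl x0 by (simp add: eq[folded x_def])
    qed
  qed
  from second_derivative_nonneg_at_min[OF ev D2 min, unfolded fun_upd_triv x0] D(3) 0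
  have "gradient 3 \<psi> z 0 - Hess 3 \<psi> z 1 1 - b (z 2) (z 1) * gradient 3 \<psi> z 1 \<le> 0"
    by (simp add: x_def gradient_def numeral_2_eq_2)
  then show ?case by (simp add: param_op_eq)
qed (use open_spacetime degenerate_elliptic_param_op in auto)

lemma slice_solution_viscosity:
  assumes u: "bounded_continuous_with_initial 2 \<phi> u" and sol: "slice_solution b u"
  shows "bounded_viscosity_solution 2 (drift_field b) diffusion \<phi> u"
proof -
  have c: "continuous_on ({0..} \<times> Rn 2) u" "continuous_on ({0..} \<times> Rn 2) (\<lambda>z. - u z)"
    using u by (auto simp: bounded_continuous_with_initial_def intro: continuous_intros)
  have 3: "Suc 2 = 3" by simp
  show ?thesis
    using u slice_solution_viscosity_sub[OF c(1) sol]
      viscosity_supersolution_uminus[OF slice_solution_viscosity_sub[OF c(2) slice_solution_uminus[OF sol]]]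
    unfolding bounded_viscosity_solution_def viscosity_solution_def 3 by simp
qed

section \<open>Comparison with a smooth solution on a slice\<close>

definition pt :: "real \<Rightarrow> real \<Rightarrow> nat \<Rightarrow> real" where
  "pt x y i = (if i = 0 then x else if i = 1 then y else 0)"

definition pt3 :: "real \<Rightarrow> real \<Rightarrow> real \<Rightarrow> nat \<Rightarrow> real" where
  "pt3 t x y i = (if i = 0 then t else pt x y (i - 1))"

lemma pt_simps [simp]: "pt x y 0 = x" "pt x y 1 = y" "pt x y (Suc 0) = y" "pt x y \<in> Rn 2"
  by (auto simp: pt_def Rn_iff)

lemma pt3_simps [simp]: "pt3 t x y 0 = t" "space_part (pt3 t x y) = pt x y"
    "pt3 t x y 1 = x" "pt3 t x y (Suc 0) = x" "pt3 t x y 2 = y" "pt3 t x y \<in> Rn 3"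
  by (auto simp: pt3_def Rn_iff pt_def fun_eq_iff)

lemma Rn2_eq: "x \<in> Rn 2 \<Longrightarrow> x = pt (x 0) (x 1)"
proof
  fix i assume "x \<in> Rn 2"
  then show "x i = pt (x 0) (x 1) i"
    by (cases "i < 2") (auto simp: Rn_iff pt_def less_2_cases_iff)
qed

lemma continuous_on_pt:
  assumes "continuous_on S f" "continuous_on S g"
  shows "continuous_on S (\<lambda>z. pt (f z) (g z))"
proof (rule continuous_on_coordinatewise_then_product)
  show "continuous_on S (\<lambda>z. pt (f z) (g z) i)" for i
    using assms by (cases "i = 0"; cases "i = 1") (simp_all add: pt_def)
qed

text \<open>It tends to infinity, yet its first derivative is bounded by 1 and its second is at most
  2. So with a bounded drift the operator changes it by a bounded amount; for a quadratic penalty,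
  drift times gradient would be unbounded.\<close>

definition penalty :: "real \<Rightarrow> real" where "penalty x = ln (1 + x * x)"
definition penalty' :: "real \<Rightarrow> real" where "penalty' x = 2 * (x * inverse (1 + x * x))"
definition penalty'' :: "real \<Rightarrow> real" where
  "penalty'' x = 2 * (inverse (1 + x * x) - 2 * (x * x) * (inverse (1 + x * x) * inverse (1 + x * x)))"

lemma penalty_pos: "0 < 1 + x * x" for x :: real
  by (simp add: add_pos_nonneg)

lemma DERIV_penalty: "(penalty has_real_derivative penalty' x) (at x)"
  unfolding penalty_def[abs_def] penalty'_def using penalty_pos[of x]
  by (auto intro!: derivative_eq_intros simp: divide_inverse)

lemma DERIV_penalty': "(penalty' has_real_derivative penalty'' x) (at x)"
  unfolding penalty'_def[abs_def] penalty''_def using penalty_pos[of x]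
  by (auto intro!: derivative_eq_intros simp: algebra_simps)

lemma penalty_nonneg: "0 \<le> penalty x"
  by (simp add: penalty_def)

lemma abs_penalty'_le: "\<bar>penalty' x\<bar> \<le> 1"
proof -
  have "2 * \<bar>x\<bar> \<le> 1 + x * x"
    using sum_squares_bound[of "\<bar>x\<bar>" 1] by (simp add: power2_eq_square)
  then show ?thesis
    using penalty_pos[of x] by (simp add: penalty'_def abs_mult divide_simps flip: divide_inverse)
qed

lemma penalty''_le: "penalty'' x \<le> 2"
proof -
  have "inverse (1 + x * x) \<le> 1" using penalty_pos[of x] by (simp add: inverse_le_1_iff)
  moreover have "0 \<le> 2 * (x * x) * (inverse (1 + x * x) * inverse (1 + x * x))"
    by simp
  ultimately show ?thesis unfolding penalty''_def by argo
qed

lemma k_diff_penalty: "k_diff False UNIV k penalty"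
  unfolding penalty_def[abs_def]
  by (rule k_diff_compose[OF k_diff_ln])
    (auto intro!: k_diff_add k_diff_mult k_diff_const k_diff_ident penalty_pos)

lemma abs_le_of_penalty_le: "penalty x \<le> c \<Longrightarrow> \<bar>x\<bar> \<le> exp c"
proof -
  assume "penalty x \<le> c"
  then have "1 + x * x \<le> exp c"
    using penalty_pos[of x] by (metis exp_le_cancel_iff exp_ln penalty_def)
  moreover have "\<bar>x\<bar> \<le> 1 + x * x"
    using sum_squares_bound[of "\<bar>x\<bar>" 1] by (simp add: power2_eq_square)
  ultimately show ?thesis by linarith
qed

lemma comparison:
  fixes v :: "real \<times> (nat \<Rightarrow> real) \<Rightarrow> real" and u u\<^sub>t u\<^sub>x u\<^sub>x\<^sub>x :: "real \<Rightarrow> real \<Rightarrow> real"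
  assumes sub: "viscosity_subsolution 3 (spacetime 2) (param_op b) (\<lambda>z. v (z 0, space_part z))"
    and v_cont: "continuous_on ({0..} \<times> Rn 2) v"
    and v_bd: "\<And>t x. 0 \<le> t \<Longrightarrow> x \<in> Rn 2 \<Longrightarrow> \<bar>v (t, x)\<bar> \<le> Bv"
    and u_C2: "C_diff 3 (spacetime 2) 2 (\<lambda>z. u (z 0) (z 1))"
    and u_cont: "continuous_on ({0..} \<times> UNIV) (\<lambda>(t, x). u t x)"
    and u_bd: "\<And>t x. 0 \<le> t \<Longrightarrow> \<bar>u t x\<bar> \<le> Bu"
    and u_t: "\<And>t x. 0 < t \<Longrightarrow> ((\<lambda>t. u t x) has_real_derivative u\<^sub>t t x) (at t)"
    and u_x: "\<And>t x. 0 < t \<Longrightarrow> (u t has_real_derivative u\<^sub>x t x) (at x)"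
    and u_xx: "\<And>t x. 0 < t \<Longrightarrow> (u\<^sub>x t has_real_derivative u\<^sub>x\<^sub>x t x) (at x)"
    and pde: "\<And>t x. 0 < t \<Longrightarrow> u\<^sub>t t x = u\<^sub>x\<^sub>x t x + b y0 x * u\<^sub>x t x"
    and u_x_bd: "\<And>T. \<exists>C. \<forall>t x. 0 < t \<longrightarrow> t \<le> T \<longrightarrow> \<bar>u\<^sub>x t x\<bar> \<le> C"
    and b_bd: "\<And>y x. \<bar>b y x\<bar> \<le> Kb"
    and b_cont: "\<And>R \<epsilon>. 0 < \<epsilon> \<Longrightarrow> \<exists>\<rho>>0. \<forall>x y. \<bar>x\<bar> \<le> R \<longrightarrow> \<bar>y - y0\<bar> \<le> \<rho> \<longrightarrow> \<bar>b y x - b y0 x\<bar> < \<epsilon>"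
    and init: "\<And>\<epsilon>. 0 < \<epsilon> \<Longrightarrow> \<exists>\<rho>>0. \<forall>x y. \<bar>y - y0\<bar> \<le> \<rho> \<longrightarrow> v (0, pt x y) \<le> u 0 x + \<epsilon>"
    and t1: "0 \<le> t1"
  shows "v (t1, pt x1 y0) \<le> u t1 x1"
proof (rule ccontr)
  assume neg: "\<not> ?thesis"
  define \<eta> where "\<eta> = (v (t1, pt x1 y0) - u t1 x1) / 2"
  have \<eta>: "0 < \<eta>" using neg by (simp add: \<eta>_def)
  have Kb: "0 \<le> Kb" using b_bd[of 0 0] by linarith
  \<comment> \<open>2 absorbs \<open>penalty''\<close>, Kb absorbs the drift times
    \<open>penalty'\<close>, and the remaining 1 yields the strict gain \<delta>.\<close>
  define K where "K = 3 + Kb"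
  \<comment> \<open>Chosen so that the penalties at (t1, x1, y0) cost at most half of the gap 2
    \<eta>, which leaves \<Psi> \<ge> \<eta> there.\<close>
  define \<delta> where "\<delta> = \<eta> / (K * t1 + penalty x1 + 1)"
  have den: "0 < K * t1 + penalty x1 + 1"
    using t1 Kb penalty_nonneg[of x1] by (simp add: K_def add_nonneg_pos)
  have \<delta>: "0 < \<delta>" using \<eta> den by (simp add: \<delta>_def)
  have \<delta>1: "\<delta> * (K * t1 + penalty x1) \<le> \<eta>"
  proof -
    have "\<delta> * (K * t1 + penalty x1) \<le> \<delta> * (K * t1 + penalty x1 + 1)" using \<delta> by simp
    also have "\<dots> = \<eta>" using den by (simp add: \<delta>_def)
    finally show ?thesis .
  qed
  define B where "B = Bv + Bu + 1"
  have B: "v (t, pt x y) - u t x \<le> B" "0 < B" if "0 \<le> t" for t x y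
    using v_bd[OF that, of "pt x y"] u_bd[OF that, of x] by (auto simp: B_def abs_le_iff)
  have B0: "0 < B" using B(2)[of 0] by simp
  \<comment> \<open>T, R and later L are such that outside \<open>box\<close> one penalty term alone
    exceeds B, which makes \<Psi> negative. T and R do not depend on \<rho>, so \<rho> can be taken
    from the bound C up to time T and the continuity of b on [-R, R], and L after it.\<close>
  define T where "T = B / (\<delta> * K)"
  define R where "R = exp (B / \<delta>)"
  obtain C where C: "\<And>t x. 0 < t \<Longrightarrow> t \<le> T \<Longrightarrow> \<bar>u\<^sub>x t x\<bar> \<le> C" using u_x_bd[of T] by blast
  obtain \<rho>1 where \<rho>1: "0 < \<rho>1" "\<And>x y. \<bar>x\<bar> \<le> R \<Longrightarrow> \<bar>y - y0\<bar> \<le> \<rho>1 \<Longrightarrow> \<bar>b y x - b y0 x\<bar> < \<delta> / (\<bar>C\<bar> + 1)"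
    using b_cont[of "\<delta> / (\<bar>C\<bar> + 1)" R] \<delta> by (auto simp: add_nonneg_pos)
  obtain \<rho>2 where \<rho>2: "0 < \<rho>2" "\<And>x y. \<bar>y - y0\<bar> \<le> \<rho>2 \<Longrightarrow> v (0, pt x y) \<le> u 0 x + \<eta> / 2"
    using init[of "\<eta> / 2"] \<eta> by auto
  define \<rho> where "\<rho> = min \<rho>1 \<rho>2"
  have \<rho>: "0 < \<rho>" using \<rho>1 \<rho>2 by (simp add: \<rho>_def)
  define L where "L = B / \<rho>\<^sup>2"
  have L: "0 < L" using B0 \<rho> by (simp add: L_def)
  define W where "W t x y = u t x + (\<delta> * (K * t + penalty x) + L * (y - y0)\<^sup>2)" for t x y
  define \<Psi> where "\<Psi> = (\<lambda>(t, x, y). v (t, pt x y) - W t x y)"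
  define box where "box = {0..T} \<times> {-R..R} \<times> {y0 - \<rho>..y0 + \<rho>}"
  have in_box: "(t, x, y) \<in> box" if "0 \<le> t" "0 \<le> \<Psi> (t, x, y)" for t x y
  proof -
    have le: "\<delta> * (K * t) + \<delta> * penalty x + L * (y - y0)\<^sup>2 \<le> B"
      using that B(1)[OF that(1), of x y] by (simp add: \<Psi>_def W_def algebra_simps)
    have nn: "0 \<le> \<delta> * (K * t)" "0 \<le> \<delta> * penalty x" "0 \<le> L * (y - y0)\<^sup>2"
      using \<delta> Kb that L penalty_nonneg by (auto simp: K_def)
    have "\<delta> * (K * t) \<le> B" "\<delta> * penalty x \<le> B" "L * (y - y0)\<^sup>2 \<le> B" using le nn by linarith+
    then have "t \<le> T" "penalty x \<le> B / \<delta>" "(y - y0)\<^sup>2 \<le> \<rho>\<^sup>2"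
    proof -
      have "0 < \<delta> * K" using \<delta> Kb by (simp add: K_def)
      then show "t \<le> T" using \<open>\<delta> * (K * t) \<le> B\<close> by (simp add: T_def pos_le_divide_eq mult_ac)
      show "penalty x \<le> B / \<delta>" using \<open>\<delta> * penalty x \<le> B\<close> \<delta> by (simp add: pos_le_divide_eq mult_ac)
      show "(y - y0)\<^sup>2 \<le> \<rho>\<^sup>2" using \<open>L * (y - y0)\<^sup>2 \<le> B\<close> \<rho> B0 by (simp add: L_def field_simps)
    qed
    moreover have "\<bar>y - y0\<bar> \<le> \<rho>" using calculation(3) \<rho> by (simp add: abs_le_square_iff[symmetric])
    moreover have "\<bar>x\<bar> \<le> R" using abs_le_of_penalty_le[OF calculation(2)] by (simp add: R_def)
    ultimately show ?thesis using that by (auto simp: box_def abs_le_iff)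
  qed
  have "compact box" unfolding box_def by (intro compact_Times compact_Icc)
  have p1: "(t1, x1, y0) \<in> box" "\<eta> \<le> \<Psi> (t1, x1, y0)"
  proof -
    show "\<eta> \<le> \<Psi> (t1, x1, y0)" using \<delta>1 by (simp add: \<Psi>_def W_def \<eta>_def)
    then show "(t1, x1, y0) \<in> box" using in_box[OF t1, of x1 y0] \<eta> by simp
  qed
  have \<Psi>_cont: "continuous_on box \<Psi>"
  proof -
    have "continuous_on box (\<lambda>z. v (fst z, pt (fst (snd z)) (snd (snd z))))"
      by (rule continuous_on_compose2[OF v_cont]) (intro continuous_intros continuous_on_pt, auto simp: box_def)
    moreover have "continuous_on box (\<lambda>z. (\<lambda>(t, x). u t x) (fst z, fst (snd z)))"
      by (rule continuous_on_compose2[OF u_cont]) (auto intro!: continuous_intros simp: box_def)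
    moreover have "continuous_on box (\<lambda>z. penalty (fst (snd z)))"
      by (rule continuous_on_compose2[OF k_diff_cont[OF k_diff_penalty]]) (auto intro!: continuous_intros)
    ultimately show ?thesis
      unfolding \<Psi>_def W_def split_beta by (intro continuous_intros) simp_all
  qed
  obtain t x y where txy: "(t, x, y) \<in> box" "\<And>z. z \<in> box \<Longrightarrow> \<Psi> z \<le> \<Psi> (t, x, y)"
    using continuous_attains_sup[OF \<open>compact box\<close> _ \<Psi>_cont] p1(1) by (metis empty_iff prod_cases3)
  have max_ge: "\<eta> \<le> \<Psi> (t, x, y)" using txy(2)[OF p1(1)] p1(2) by simp
  \<comment> \<open>As \<Psi> is negative outside \<open>box\<close>, the maximum over the compact
    box is global, as the definition of a test function requires.\<close>
  have max: "\<Psi> (t', x', y') \<le> \<Psi> (t, x, y)" if "0 \<le> t'" for t' x' y'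
    using in_box[OF that, of x' y'] txy(2) max_ge \<eta> by fastforce
  have bnds: "0 \<le> t" "t \<le> T" "\<bar>x\<bar> \<le> R" "\<bar>y - y0\<bar> \<le> \<rho>1" "\<bar>y - y0\<bar> \<le> \<rho>2"
    using txy(1) by (auto simp: box_def \<rho>_def)
  have "t \<noteq> 0"
  proof
    assume "t = 0"
    then have "\<Psi> (t, x, y) = v (0, pt x y) - u 0 x - (\<delta> * penalty x + L * (y - y0)\<^sup>2)"
      by (simp add: \<Psi>_def W_def)
    also have "\<dots> \<le> v (0, pt x y) - u 0 x"
    proof -
      have "0 \<le> \<delta> * penalty x + L * (y - y0)\<^sup>2"
        using \<delta> penalty_nonneg[of x] L by (intro add_nonneg_nonneg mult_nonneg_nonneg) auto
      then show ?thesis by linarith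
    qed
    also have "\<dots> \<le> \<eta> / 2" using \<rho>2(2)[OF bnds(5), of x] by simp
    finally show False using max_ge \<eta> by simp
  qed
  then have t: "0 < t" using bnds by simp
  define z where "z = pt3 t x y"
  \<comment> \<open>The added constant is the maximum of \<Psi>; it lifts W until it touches v from
    above at the maximum point.\<close>
  define \<Phi> where "\<Phi> z = W (z 0) (z 1) (z 2) + \<Psi> (t, x, y)" for z :: "nat \<Rightarrow> real"
  have z: "z \<in> spacetime 2" using t by (simp add: z_def spacetime_iff)
  have "C_diff 3 (spacetime 2) 2 \<Phi>"
  proof -
    have co: "C_diff 3 (spacetime 2) 2 (\<lambda>z. g (z i))" if "k_diff False UNIV 2 g" "i < 3" for g i
      by (rule C_diff_coord[OF open_spacetime that(2) _ that(1)]) simp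
    have "C_diff 3 (spacetime 2) 2 (\<lambda>z. z 0)" "C_diff 3 (spacetime 2) 2 (\<lambda>z. penalty (z 1))"
      "C_diff 3 (spacetime 2) 2 (\<lambda>z. z 2)"
      using co[OF k_diff_ident, of 0] co[OF k_diff_penalty, of 1] co[OF k_diff_ident, of 2] by simp_all
    then have "C_diff 3 (spacetime 2) 2 (\<lambda>z. u (z 0) (z 1) + (\<delta> * (K * z 0 + penalty (z 1))
        + L * ((z 2 + - y0) * (z 2 + - y0))) + \<Psi> (t, x, y))"
      by (intro C_diff_add[OF open_spacetime] C_diff_mult[OF open_spacetime] C_diff_const[OF open_spacetime] u_C2)
    then show ?thesis
      by (simp add: \<Phi>_def[abs_def] W_def power2_eq_square)
  qed
  moreover have "\<forall>z\<in>spacetime 2. v (z 0, space_part z) \<le> \<Phi> z"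
  proof
    fix z assume "z \<in> spacetime 2"
    then have z: "0 < z 0" "z \<in> Rn 3" by (auto simp: spacetime_iff)
    have "space_part z = pt (z 1) (z 2)"
      using Rn2_eq[OF space_part_Rn[OF z(2)]] by (simp add: numeral_2_eq_2)
    then show "v (z 0, space_part z) \<le> \<Phi> z"
      using z max[of "z 0" "z 1" "z 2"] by (simp add: \<Phi>_def \<Psi>_def)
  qed
  moreover have "\<Phi> z = v (z 0, space_part z)" by (simp add: \<Phi>_def \<Psi>_def z_def)
  ultimately have "param_op b z (\<Phi> z) (gradient 3 \<Phi> z) (Hess 3 \<Phi> z) \<le> 0"
    using sub z unfolding viscosity_subsolution_def by blast
  moreover have "gradient 3 \<Phi> z 0 = u\<^sub>t t x + \<delta> * K"
  proof -
    have "gradient 3 \<Phi> z 0 = (\<lambda>z. u\<^sub>t (z 0) (z 1) + \<delta> * K) z"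
      by (rule gradient_Hess_eq(1)[OF open_spacetime z])
        (auto simp: \<Phi>_def W_def spacetime_iff intro!: derivative_eq_intros u_t)
    then show ?thesis by (simp add: z_def)
  qed
  moreover have D1: "((\<lambda>s. \<Phi> (z(1 := s))) has_real_derivative u\<^sub>x (z 0) (z 1) + \<delta> * penalty' (z 1)) (at (z 1))"
    if "z \<in> spacetime 2" for z
    using that by (auto simp: \<Phi>_def W_def spacetime_iff intro!: derivative_eq_intros u_x DERIV_penalty)
  moreover have "gradient 3 \<Phi> z 1 = u\<^sub>x t x + \<delta> * penalty' x"
    using gradient_Hess_eq(1)[OF open_spacetime z _ D1] by (simp add: z_def)
  moreover have "Hess 3 \<Phi> z 1 1 = u\<^sub>x\<^sub>x t x + \<delta> * penalty'' x"
    by (rule gradient_Hess_eq(2)[OF open_spacetime z _ D1])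
      (use t in \<open>auto simp: z_def intro!: derivative_eq_intros u_xx DERIV_penalty'\<close>)
  ultimately have le: "u\<^sub>t t x + \<delta> * K - (u\<^sub>x\<^sub>x t x + \<delta> * penalty'' x) - b y x * (u\<^sub>x t x + \<delta> * penalty' x) \<le> 0"
    by (simp add: param_op_eq z_def)
  have "(b y0 x - b y x) * u\<^sub>x t x + \<delta> * (K - penalty'' x - b y x * penalty' x) \<le> 0"
    using le unfolding pde[OF t] by (simp add: algebra_simps)
  moreover have "1 \<le> K - penalty'' x - b y x * penalty' x"
  proof -
    have "\<bar>b y x * penalty' x\<bar> \<le> Kb * 1"
      unfolding abs_mult by (rule mult_mono[OF b_bd abs_penalty'_le]) (use Kb in auto)
    then show ?thesis using penalty''_le[of x] by (simp add: K_def)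
  qed
  then have "\<delta> * 1 \<le> \<delta> * (K - penalty'' x - b y x * penalty' x)"
    using \<delta> by (intro mult_left_mono) auto
  moreover have "\<bar>(b y0 x - b y x) * u\<^sub>x t x\<bar> < \<delta>"
  proof -
    have "\<bar>(b y0 x - b y x) * u\<^sub>x t x\<bar> \<le> \<delta> / (\<bar>C\<bar> + 1) * \<bar>C\<bar>"
      unfolding abs_mult
      using \<rho>1(2)[OF bnds(3,4)] C[OF t bnds(2), of x] by (intro mult_mono) (auto simp: abs_minus_commute)
    also have "\<dots> < \<delta>" using \<delta> by (simp add: field_simps add_nonneg_pos)
    finally show ?thesis .
  qed
  ultimately show False by (simp add: abs_less_iff)
qed

section \<open>The solution\<close>

lemma deriv_iter_zero_left:
  fixes G :: "real \<Rightarrow> real"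
  assumes "\<And>x. x < 0 \<Longrightarrow> G x = 0"
  shows "x < 0 \<Longrightarrow> (deriv ^^ k) G x = 0"
proof (induction k arbitrary: x)
  case (Suc k)
  have "((deriv ^^ k) G has_real_derivative 0) (at x)"
    by (rule has_field_derivative_transform_within_open[of "\<lambda>_. 0" _ _ "{..<0}"]) (use Suc in auto)
  then show ?case by (simp add: DERIV_imp_deriv)
qed (use assms in auto)

lemma continuous_shifted:
  assumes "continuous_on UNIV G" "\<And>x. x < 0 \<Longrightarrow> G x = 0"
  shows "continuous_on UNIV (\<lambda>(y, x). shifted G y x)"
  using isCont_shifted[of "\<lambda>_. 1" G, OF continuous_on_const assms, unfolded mult_1]
  by (auto simp: continuous_on_eq_continuous_at shifted_def)

lemma DERIV_shifted:
  assumes "\<And>x. (G has_real_derivative G' x) (at x)"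
  shows "(shifted G y has_real_derivative shifted G' y x) (at x)"
proof (cases "0 < y")
  case True
  have "((\<lambda>x. G (x - log_shift y)) has_real_derivative G' (x - log_shift y)) (at x)"
    by (rule DERIV_cong[OF DERIV_chain2[OF assms]], (rule derivative_eq_intros refl | simp)+)
  then show ?thesis using True by (simp add: shifted_def[abs_def])
qed (simp add: shifted_def[abs_def])

lemma abs_le_SOME_bound:
  fixes f :: "real \<Rightarrow> real"
  assumes "bounded (range f)"
  shows "\<bar>f x\<bar> \<le> (SOME B. \<forall>x. \<bar>f x\<bar> \<le> B)"
proof -
  have "\<exists>B. \<forall>x. \<bar>f x\<bar> \<le> B" using assms by (auto simp: bounded_iff)
  from someI_ex[OF this] show ?thesis by blast
qed

section \<open>Cut-off functions for the initial value\<close>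

definition chi :: "real \<Rightarrow> real" where
  "chi x = flat_exp 0 (x + 2) * flat_exp 0 (- x)"

definition kappa :: "real \<Rightarrow> real" where
  "kappa y = flat_exp 0 (1 + y) * flat_exp 0 (1 - y)"

lemma chi_zero: "x \<notin> {-2<..<0} \<Longrightarrow> chi x = 0"
  and kappa_zero: "y \<notin> {-1<..<1} \<Longrightarrow> kappa y = 0"
  by (auto simp: chi_def kappa_def)

lemma chi_nonneg: "0 \<le> chi x" and kappa_nonneg: "0 \<le> kappa y"
  by (auto simp: chi_def kappa_def flat_nonneg)

lemma chi_le_1: "chi x \<le> 1" and kappa_le_1: "kappa y \<le> 1"
  using flat_le[of 0] flat_nonneg[of 0] by (auto simp: chi_def kappa_def intro!: mult_le_one)

lemma chi_pos: "-2 < x \<Longrightarrow> x < 0 \<Longrightarrow> 0 < chi x"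
  by (simp add: chi_def flat_exp_def)

lemma k_diff_chi: "k_diff True UNIV k chi"
proof -
  have "k_diff True UNIV k (\<lambda>x. flat_exp 0 (1 * x + 2) * flat_exp 0 (-1 * x + 0))"
    by (intro k_diff_mult k_diff_affine k_diff_flat)
  then show ?thesis by (simp add: chi_def[abs_def])
qed

lemma k_diff_kappa: "k_diff True UNIV k kappa"
proof -
  have "k_diff True UNIV k (\<lambda>x. flat_exp 0 (1 * x + 1) * flat_exp 0 (-1 * x + 1))"
    by (intro k_diff_mult k_diff_affine k_diff_flat)
  then show ?thesis by (simp add: kappa_def[abs_def] add.commute)
qed

text \<open>By 1/(1 + y) + 1/(1 - y) = 2/(1 - y y) \<ge> 2. With the maximum at y = 0,
  multiplication by \<open>kappa\<close> cannot make up for the loss of \<open>sol\<close> away from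
  y = 0.\<close>

lemma kappa_le_0: "kappa y \<le> kappa 0"
proof (cases "y \<in> {-1<..<1}")
  case True
  then have p: "0 < 1 + y" "0 < 1 - y" "0 < (1 + y) * (1 - y)" by auto
  have "2 \<le> inverse (1 + y) + inverse (1 - y)"
  proof -
    have "inverse (1 + y) + inverse (1 - y) = 2 / ((1 + y) * (1 - y))"
      using p by (simp add: field_simps)
    moreover have "(1 + y) * (1 - y) \<le> 1" by (simp add: algebra_simps)
    ultimately show ?thesis using p by (simp add: le_divide_eq)
  qed
  then have "exp (- inverse (1 + y) + - inverse (1 - y)) \<le> exp (-1 + -1)" by simp
  then show ?thesis
    unfolding exp_add using p by (simp add: kappa_def flat_exp_def)
qed (simp add: kappa_zero kappa_nonneg)

text \<open>The constant 6 is \<open>fact 3\<close>, the bound on \<open>flat_exp 3\<close>; it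
  becomes the M of the overview.\<close>

lemma potential_le: "potential x \<le> 6"
proof -
  have "potential x \<le> 6 * 1"
    unfolding potential_def using flat_le[of 3 x] flat_nonneg[of 3 x] profile_ge_1[of x]
    by (intro mult_mono) (auto simp: fact_numeral inverse_le_1_iff)
  then show ?thesis by simp
qed

lemma potential_neg: "x < 0 \<Longrightarrow> potential x = 0" and drift_neg: "x < 0 \<Longrightarrow> drift x = 0"
  by (auto simp: potential_def drift_def)

section \<open>The Dyson series for the translated potential\<close>

definition pot :: "nat \<Rightarrow> real \<Rightarrow> real \<Rightarrow> real" where
  "pot k y x = (if k = 0 then 6 else 0) - shifted ((deriv ^^ k) potential) y x"

text \<open>Order 0 keeps the exact value 6, so that the series grows at most like
  \<open>exp (6 * t)\<close> and the factor \<open>exp (- (6 * t))\<close> in \<open>sol\<close>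
  cancels this for all times. Higher orders only need some bound.\<close>

definition pot_bound :: "nat \<Rightarrow> real" where
  "pot_bound k = (if k = 0 then 6 else (SOME B. \<forall>x. \<bar>(deriv ^^ k) potential x\<bar> \<le> B))"

definition chi_bound :: "nat \<Rightarrow> real" where
  "chi_bound k = (SOME B. \<forall>x. \<bar>(deriv ^^ k) chi x\<bar> \<le> B)"

lemma pot_0: "pot 0 y x = 6 - shifted potential y x"
  by (simp add: pot_def)

lemma pot_0_bounds: "0 \<le> pot 0 y x" "pot 0 y x \<le> 6"
  using potential_nonneg potential_le by (auto simp: pot_0 shifted_def)

interpretation hp: heat_potential pot "\<lambda>k. (deriv ^^ k) chi" pot_bound chi_bound
proof
  fix k y x
  have "continuous_on UNIV (\<lambda>(y, x). shifted ((deriv ^^ k) potential) y x)"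
    by (rule continuous_shifted[OF k_diff_cont[OF k_diff_deriv_iter[OF k_diff_potential]]])
      (auto intro: deriv_iter_zero_left potential_neg)
  then show "continuous_on UNIV (\<lambda>(p, x). pot k p x)"
    unfolding pot_def split_beta by (intro continuous_intros)
  have "(shifted ((deriv ^^ k) potential) y has_real_derivative shifted ((deriv ^^ Suc k) potential) y x) (at x)"
    by (rule DERIV_shifted) (rule DERIV_deriv_iter[OF k_diff_potential], auto)
  then show "(pot k y has_real_derivative pot (Suc k) y x) (at x)"
    unfolding pot_def[abs_def] by (auto intro!: derivative_eq_intros)
  have "\<bar>shifted ((deriv ^^ k) potential) y x\<bar> \<le> pot_bound k" if "k \<noteq> 0"
  proof -
    note * = abs_le_SOME_bound[OF k_diff_bounded[OF k_diff_deriv_iter[OF k_diff_potential, of k]]]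
    show ?thesis
      using *[where x = "x - log_shift y"] that order_trans[OF abs_ge_zero *[where x = 0]]
      by (auto simp: shifted_def pot_bound_def)
  qed
  then show "\<bar>pot k y x\<bar> \<le> pot_bound k"
    using pot_0_bounds[of y x] by (cases "k = 0") (auto simp: pot_bound_def pot_def)
  show "((deriv ^^ k) chi has_real_derivative (deriv ^^ Suc k) chi x) (at x)"
    by (rule DERIV_deriv_iter[OF k_diff_chi]) auto
  show "\<bar>(deriv ^^ k) chi x\<bar> \<le> chi_bound k"
    unfolding chi_bound_def by (rule abs_le_SOME_bound[OF k_diff_bounded[OF k_diff_deriv_iter[OF k_diff_chi]]]) auto
qed

text \<open>The function h of the overview. It is written through \<open>profile x - 1\<close>,
  which vanishes on the left half-line, so that the lemmas about \<open>shifted\<close>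
  apply.\<close>

definition weight :: "real \<Rightarrow> real \<Rightarrow> real" where
  "weight y x = 1 + shifted (\<lambda>x. profile x - 1) y x"

abbreviation "weight' \<equiv> shifted (\<lambda>x. flat_exp 0 x + flat_exp 1 x)"
abbreviation "weight'' \<equiv> shifted (flat_exp 3)"

lemma weight_eq: "weight y x = (if 0 < y then profile (x - log_shift y) else 1)"
  by (simp add: weight_def shifted_def)

lemma weight_ge_1: "1 \<le> weight y x" and weight_pos: "0 < weight y x" and weight_nz: "weight y x \<noteq> 0"
  using profile_ge_1[of "x - log_shift y"] by (auto simp: weight_eq)

lemma weight_left: "x \<le> 0 \<Longrightarrow> weight y x = 1"
  using shift_nonneg[of y] by (simp add: weight_eq)

lemma DERIV_weight: "(weight y has_real_derivative weight' y x) (at x)"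
proof -
  have "(shifted (\<lambda>x. profile x - 1) y has_real_derivative weight' y x) (at x)"
    by (rule DERIV_shifted) (auto intro!: derivative_eq_intros DERIV_profile)
  then show ?thesis unfolding weight_def[abs_def] by (auto intro!: derivative_eq_intros)
qed

lemma DERIV_weight': "(weight' y has_real_derivative weight'' y x) (at x)"
  by (rule DERIV_shifted) (rule DERIV_profile')

lemma weight'_bound: "\<bar>weight' y x\<bar> \<le> 2"
  using flat_nonneg[of 0 "x - log_shift y"] flat_nonneg[of 1 "x - log_shift y"]
    flat_le[of 0 "x - log_shift y"] flat_le[of 1 "x - log_shift y"] by (auto simp: shifted_def)

lemma continuous_weight: "continuous_on UNIV (\<lambda>(y, x). weight y x)"
proof -
  have "continuous_on UNIV profile"
    by (rule DERIV_continuous_on, rule has_field_derivative_at_within, rule DERIV_profile)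
  then have "continuous_on UNIV (\<lambda>(y, x). shifted (\<lambda>x. profile x - 1) y x)"
    by (intro continuous_shifted continuous_intros) auto
  then show ?thesis unfolding weight_def split_beta by (intro continuous_intros)
qed

abbreviation "drift_xy \<equiv> shifted drift"

lemma coeff_weight: "drift_xy y x * weight y x = 2 * weight' y x"
proof -
  have "profile z \<noteq> 0" for z using profile_ge_1[of z] by linarith
  then show ?thesis by (simp add: shifted_def weight_eq drift_def field_simps)
qed

lemma potential_weight: "shifted potential y x * weight y x = weight'' y x"
proof -
  have "profile z \<noteq> 0" for z using profile_ge_1[of z] by linarith
  then show ?thesis by (simp add: shifted_def weight_eq potential_def field_simps)
qed

lemma continuous_drift_xy: "continuous_on UNIV (\<lambda>(y, x). drift_xy y x)"
  by (rule continuous_shifted[OF k_diff_cont[OF k_diff_drift] drift_neg])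

lemma coeff_bound: "\<bar>drift_xy y x\<bar> \<le> 4"
proof -
  \<comment> \<open>Since the weight is at least 1, it suffices to bound drift times weight, which
    is twice the bounded derivative of the weight.\<close>
  have "\<bar>drift_xy y x\<bar> \<le> \<bar>drift_xy y x * weight y x\<bar>"
    using weight_ge_1[of y x] mult_left_mono[of 1 "\<bar>weight y x\<bar>" "\<bar>drift_xy y x\<bar>"] by (simp add: abs_mult)
  also have "\<dots> \<le> 4" unfolding coeff_weight using weight'_bound[of y x] by simp
  finally show ?thesis .
qed

text \<open>The slices of the solution: the substitution \<open>u = v / h\<close> turns the drift \<open>2 h\<^sub>x / h\<close> into
  the potential \<open>h\<^sub>x\<^sub>x / h\<close>, and the factor \<open>exp (-6 t)\<close> replaces it by \<open>6 - h\<^sub>x\<^sub>x / h \<ge> 0\<close>.\<close>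

definition sol :: "real \<Rightarrow> real \<Rightarrow> real \<Rightarrow> real" where
  "sol y t x = exp (- (6 * t)) * (hp.w 0 y t x * inverse (weight y x))"

definition sol_t :: "real \<Rightarrow> real \<Rightarrow> real \<Rightarrow> real" where
  "sol_t y t x = exp (- (6 * t)) * ((hp.w 2 y t x - shifted potential y x * hp.w 0 y t x) * inverse (weight y x))"

definition sol_x :: "real \<Rightarrow> real \<Rightarrow> real \<Rightarrow> real" where
  "sol_x y t x = exp (- (6 * t)) * (hp.w 1 y t x * inverse (weight y x)
    - hp.w 0 y t x * (weight' y x * (inverse (weight y x) * inverse (weight y x))))"

definition sol_xx :: "real \<Rightarrow> real \<Rightarrow> real \<Rightarrow> real" where
  "sol_xx y t x = exp (- (6 * t)) * (hp.w 2 y t x * inverse (weight y x)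
    - 2 * (hp.w 1 y t x * (weight' y x * (inverse (weight y x) * inverse (weight y x))))
    - hp.w 0 y t x * (weight'' y x * (inverse (weight y x) * inverse (weight y x)))
    + 2 * (hp.w 0 y t x * ((weight' y x * weight' y x) * (inverse (weight y x) * (inverse (weight y x) * inverse (weight y x))))))"

lemma sol_t: "0 < t \<Longrightarrow> ((\<lambda>t. sol y t x) has_real_derivative sol_t y t x) (at t)"
proof -
  assume "0 < t"
  from hp.w_time[OF this, of 0 y x]
  have "((\<lambda>t. hp.w 0 y t x) has_real_derivative hp.w 2 y t x + pot 0 y x * hp.w 0 y t x) (at t)"
    by (simp add: numeral_2_eq_2)
  then show ?thesis
    unfolding sol_def sol_t_def
    by (auto intro!: derivative_eq_intros simp: pot_0 algebra_simps)
qed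

lemma sol_x: "(sol y t has_real_derivative sol_x y t x) (at x)"
  using hp.w_der[of 0 y t x] unfolding sol_def[abs_def] sol_x_def
  by (auto intro!: derivative_eq_intros DERIV_weight simp: weight_nz algebra_simps)

lemma sol_xx: "(sol_x y t has_real_derivative sol_xx y t x) (at x)"
proof -
  have I: "((\<lambda>x. inverse (weight y x)) has_real_derivative - (weight' y x * (inverse (weight y x) * inverse (weight y x)))) (at x)"
    by (auto intro!: derivative_eq_intros DERIV_weight simp: weight_nz)
  have W: "(hp.w 1 y t has_real_derivative hp.w 2 y t x) (at x)" "(hp.w 0 y t has_real_derivative hp.w 1 y t x) (at x)"
    using hp.w_der[of 1 y t x] hp.w_der[of 0 y t x] by (simp_all add: numeral_2_eq_2)
  show ?thesis
    unfolding sol_x_def[abs_def] sol_xx_def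
    by (rule DERIV_cong[OF DERIV_cmult[OF DERIV_diff[OF DERIV_mult[OF W(1) I]
          DERIV_mult[OF W(2) DERIV_mult[OF DERIV_weight' DERIV_mult[OF I I]]]]]])
      (simp add: algebra_simps del: One_nat_def)
qed

text \<open>Dividing by h creates the terms - 2 w' h'/h^2 + 2 w h'^2/h^3 in the second derivative;
  the drift 2 h'/h applied to the first derivative cancels exactly these and leaves - (h''/h)
  w/h.\<close>

lemma sol_pde: "sol_t y t x = sol_xx y t x + drift_xy y x * sol_x y t x"
proof -
  have b: "drift_xy y x = 2 * weight' y x * inverse (weight y x)"
    using coeff_weight[of y x] weight_nz[of y x] by (simp add: field_simps)
  have q: "shifted potential y x = weight'' y x * inverse (weight y x)"
    using potential_weight[of y x] weight_nz[of y x] by (simp add: field_simps)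
  show ?thesis
    unfolding sol_t_def sol_xx_def sol_x_def b q by (simp add: algebra_simps)
qed

lemma continuous_w: "continuous_on S (\<lambda>z. hp.w k (f z) (g z) (h z))"
  if "continuous_on S f" "continuous_on S g" "continuous_on S h"
  using continuous_on_compose2[OF hp.w_cont, of S "\<lambda>z. (f z, g z, h z)"] that
  by (simp add: continuous_on_Pair)

lemma sol_cont: "continuous_on UNIV (\<lambda>(y, t, x). sol y t x)"
proof -
  have "continuous_on UNIV (\<lambda>z::real \<times> real \<times> real. weight (fst z) (snd (snd z)))"
    using continuous_on_compose2[OF continuous_weight, of UNIV "\<lambda>z::real \<times> real \<times> real. (fst z, snd (snd z))"]
    by (simp add: continuous_intros)
  then show ?thesis
    unfolding sol_def split_beta by (intro continuous_intros continuous_w) (auto simp: weight_nz)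
qed

text \<open>\<open>chi\<close> is supported where the weight is 1 for every y. Hence division by the
  weight does not change it, and one y-independent initial value serves all slices.\<close>

lemma sol_initial: "sol y 0 x = chi x"
  using weight_left[of x y] chi_zero[of x] by (cases "x \<le> 0") (auto simp: sol_def hp.w_initial)

lemma sol_bound: "0 \<le> t \<Longrightarrow> \<bar>sol y t x\<bar> \<le> chi_bound 0"
proof -
  assume "0 \<le> t"
  then have w: "\<bar>hp.w 0 y t x\<bar> \<le> chi_bound 0 * exp (6 * t)"
    using hp.w_0_le_exp[of t y x] by (simp add: pot_bound_def)
  have "\<bar>sol y t x\<bar> = exp (- (6 * t)) * (\<bar>hp.w 0 y t x\<bar> * inverse (weight y x))"
    using weight_pos[of y x] by (simp add: sol_def abs_mult)
  also have "\<dots> \<le> exp (- (6 * t)) * ((chi_bound 0 * exp (6 * t)) * 1)"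
    using w weight_ge_1[of y x] weight_pos[of y x]
    by (intro mult_left_mono mult_mono) (auto simp: inverse_le_1_iff intro: order_trans[OF abs_ge_zero w])
  also have "\<dots> = chi_bound 0" by (simp add: exp_minus)
  finally show ?thesis .
qed

lemma sol_nonneg: "0 \<le> t \<Longrightarrow> 0 \<le> sol y t x"
  using hp.w_nonneg[of y t x] chi_nonneg pot_0_bounds weight_pos[of y x] by (simp add: sol_def)

text \<open>The majorants of the derivative series grow with time, so the bound is for finite T;
  \<open>comparison\<close> confines t to such an interval.\<close>

lemma sol_x_bound: "\<exists>C. \<forall>t x. 0 < t \<longrightarrow> t \<le> T \<longrightarrow> \<bar>sol_x y t x\<bar> \<le> C"
proof (intro exI allI impI)
  fix t x :: real assume t: "0 < t" "t \<le> T"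
  let ?w = "\<lambda>k. \<Sum>n. hp.bd k n T"
  have w: "\<bar>hp.w k y t x\<bar> \<le> ?w k" for k using t by (intro hp.w_bd) auto
  have i: "\<bar>inverse (weight y x)\<bar> \<le> 1" using weight_ge_1[of y x] by (simp add: inverse_le_1_iff)
  have "\<bar>hp.w 1 y t x * inverse (weight y x) - hp.w 0 y t x * (weight' y x * (inverse (weight y x) * inverse (weight y x)))\<bar>
     \<le> ?w 1 * 1 + ?w 0 * (2 * (1 * 1))"
    by (rule order_trans[OF abs_triangle_ineq4], unfold abs_mult, intro add_mono mult_mono w i weight'_bound)
      (use order_trans[OF abs_ge_zero w] in auto)
  moreover have "exp (- (6 * t)) \<le> 1" using t by simp
  ultimately have "exp (- (6 * t)) * \<bar>hp.w 1 y t x * inverse (weight y x) - hp.w 0 y t x * (weight' y x * (inverse (weight y x) * inverse (weight y x)))\<bar>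
     \<le> 1 * (?w 1 * 1 + ?w 0 * (2 * (1 * 1)))"
    by (intro mult_mono) auto
  then show "\<bar>sol_x y t x\<bar> \<le> ?w 1 + 2 * ?w 0"
    by (simp add: sol_x_def abs_mult)
qed

text \<open>Joint smoothness in t and x by bootstrapping: a time derivative is again a combination
  of products of the series \<open>hp.w j\<close> with derivatives of the potential, so induction on
  N for all k at once closes. The third coordinate does not occur, as y is frozen.\<close>

lemma C_diff_w: "C_diff 3 (spacetime 2) N (\<lambda>z. hp.w k y (z 0) (z 1))"
proof (induction N arbitrary: k)
  case 0
  show ?case by (auto intro!: continuous_w continuous_intros)
next
  case (Suc N)
  note U = open_spacetime
  define g where "g i z = (if i = (0::nat) then hp.w (k + 2) y (z 0) (z 1)
      + (\<Sum>j\<le>k. real (k choose j) * (pot (k - j) y (z 1) * hp.w j y (z 0) (z 1)))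
      else if i = 1 then hp.w (Suc k) y (z 0) (z 1) else 0)" for i and z :: "nat \<Rightarrow> real"
  have pot: "C_diff 3 (spacetime 2) N (\<lambda>z. pot j y (z 1))" for j
  proof (rule C_diff_coord[OF U])
    show "k_diff False UNIV N (pot j y)"
    proof (cases "0 < y")
      case True
      have "k_diff False UNIV N (\<lambda>x. (if j = 0 then 6 else 0) + - (deriv ^^ j) potential (1 * x + - log_shift y))"
        by (intro k_diff_add k_diff_const k_diff_uminus k_diff_affine k_diff_weaken[OF k_diff_deriv_iter] k_diff_potential open_UNIV)
      then show ?thesis using True by (simp add: pot_def[abs_def] shifted_def)
    next
      case False
      then show ?thesis by (simp add: pot_def[abs_def] shifted_def k_diff_const)
    qed
  qed auto
  show ?case
  proof (rule C_diff_SucI[OF U, where g = g])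
    show "continuous_on (spacetime 2) (\<lambda>z. hp.w k y (z 0) (z 1))"
      by (intro continuous_w continuous_intros)
    show "C_diff 3 (spacetime 2) N (g i)" if "i < 3" for i
    proof -
      have "i = 0 \<or> i = 1 \<or> i = 2" using that by presburger
      then consider "i = 0" | "i = 1" | "i = 2" by blast
      then show ?thesis
      proof cases
        case 1
        show ?thesis unfolding g_def[abs_def] if_P[OF 1]
          by (intro C_diff_add[OF U] C_diff_sum[OF U] C_diff_mult[OF U] C_diff_const[OF U] Suc pot)
      qed (auto simp: g_def[abs_def] Suc[simplified] C_diff_const[OF U])
    qed
    show "((\<lambda>s. hp.w k y ((z(i := s)) 0) ((z(i := s)) 1)) has_real_derivative g i z) (at (z i))"
      if "i < 3" "z \<in> spacetime 2" for i z
    proof -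
      have "i = 0 \<or> i = 1 \<or> i = 2" using that(1) by presburger
      then consider "i = 0" | "i = 1" | "i = 2" by blast
      then show ?thesis
      proof cases
        case 1
        then show ?thesis
          using hp.w_time[of "z 0" k y "z 1"] that(2) by (simp add: g_def leibniz_def spacetime_iff)
      next
        case 2
        then show ?thesis using hp.w_der[of k y "z 0" "z 1"] by (simp add: g_def)
      qed (simp add: g_def)
    qed
  qed
qed

lemma C_diff_sol: "C_diff 3 (spacetime 2) N (\<lambda>z. sol y (z 0) (z 1))"
proof -
  have e: "k_diff False UNIV N (\<lambda>t. c * exp (- (6 * t)))" for c :: real
  proof (induction N arbitrary: c)
    case (Suc N)
    show ?case
      by (rule k_diff_SucI[OF _ Suc[of "- 6 * c"]]) (auto intro!: derivative_eq_intros)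
  qed (auto intro!: continuous_intros)
  have h: "k_diff False UNIV N (\<lambda>x. inverse (weight y x))"
  proof (cases "0 < y")
    case True
    have "k_diff False UNIV N (\<lambda>x. (\<lambda>x. inverse (profile x)) (1 * x + - log_shift y))"
      by (rule k_diff_affine[OF k_diff_weaken[OF k_diff_inverse_profile]])
    then show ?thesis using True by (simp add: weight_eq[abs_def])
  qed (simp add: weight_eq[abs_def] k_diff_const)
  show ?thesis
    unfolding sol_def
    by (intro C_diff_mult[OF open_spacetime] C_diff_w
        C_diff_coord[OF open_spacetime _ _ e[of 1, simplified]] C_diff_coord[OF open_spacetime _ _ h]) auto
qed

section \<open>Loss of Hoelder continuity\<close>

definition initial_value :: "(nat \<Rightarrow> real) \<Rightarrow> real" where
  "initial_value x = chi (x 0) * kappa (x 1)"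

text \<open>A factor depending only on the parameter commutes with the equation, so multiplying the
  slices by \<open>kappa\<close> gives a compactly supported initial value at no cost.\<close>

definition solution :: "real \<times> (nat \<Rightarrow> real) \<Rightarrow> real" where
  "solution = (\<lambda>(t, x). kappa (x 1) * sol (x 1) t (x 0))"

lemma initial_value_smooth: "C_infinity 2 initial_value"
proof -
  have U: "openin (Euclidean_space 2) (Rn 2)" by simp
  show ?thesis
    unfolding C_infinity_def initial_value_def[abs_def]
    by (intro allI C_diff_mult[OF U] C_diff_coord[OF U _ _ k_diff_weaken[OF k_diff_chi]]
        C_diff_coord[OF U _ _ k_diff_weaken[OF k_diff_kappa]]) auto
qed

lemma drift_field_smooth: "i < 2 \<Longrightarrow> C_infinity 2 (\<lambda>x. drift_field drift_xy x i)"
proof -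
  have "C_diff 2 (Rn 2) k (\<lambda>z. if 0 < z 1 then 1 * drift (z 0 - log_shift (z 1)) else 0)" for k
    by (rule C_diff_shifted[OF k_diff_const k_diff_weaken[OF k_diff_drift] drift_neg])
  moreover have "C_diff 2 (Rn 2) k (\<lambda>z. 0)" for k
    by (rule C_diff_const) simp
  ultimately show ?thesis
    unfolding C_infinity_def drift_field_def shifted_def mult_1 by (cases "i = 0") simp_all
qed

lemma drift_field_bounded: "L2_set (drift_field drift_xy x) {..<2} \<le> 4"
proof -
  have "L2_set (drift_field drift_xy x) {..<2} = \<bar>drift_xy (x 1) (x 0)\<bar>"
    by (simp add: L2_set_def drift_field_def numeral_2_eq_2)
  then show ?thesis using coeff_bound by simp
qed

lemma compact_support_initial_value: "compact (closure {x \<in> Rn 2. initial_value x \<noteq> 0})"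
proof -
  let ?K = "(\<lambda>(x, y). pt x y) ` ({-2..0} \<times> {-1..1})"
  have K: "compact ?K"
    unfolding split_beta
    by (intro compact_continuous_image continuous_on_pt continuous_on_fst continuous_on_snd continuous_on_id
        compact_Times compact_Icc)
  have sub: "{x \<in> Rn 2. initial_value x \<noteq> 0} \<subseteq> ?K"
  proof
    fix x assume x: "x \<in> {x \<in> Rn 2. initial_value x \<noteq> 0}"
    then have "chi (x 0) \<noteq> 0" "kappa (x 1) \<noteq> 0" by (auto simp: initial_value_def)
    then have "x 0 \<in> {-2<..<0}" "x 1 \<in> {-1<..<1}"
      using chi_zero[of "x 0"] kappa_zero[of "x 1"] by argo+
    then have "(x 0, x 1) \<in> {-2..0} \<times> {-1..1}" by auto
    moreover have "x = (\<lambda>(x, y). pt x y) (x 0, x 1)" using Rn2_eq[of x] x by simp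
    ultimately show "x \<in> ?K" by (rule rev_image_eqI)
  qed
  show ?thesis
    using compact_Int_closed[OF K closed_closure[of "{x \<in> Rn 2. initial_value x \<noteq> 0}"]]
    unfolding Int_absorb1[OF closure_minimal[OF sub compact_imp_closed[OF K]]] .
qed

lemma kappa_cont: "continuous_on S kappa"
  using k_diff_cont[OF k_diff_kappa] continuous_on_subset by blast

lemma solution_bounded_continuous: "bounded_continuous_with_initial 2 initial_value solution"
  unfolding bounded_continuous_with_initial_def
proof (intro conjI ballI)
  have "\<bar>kappa y * sol y t x\<bar> \<le> 1 * chi_bound 0" if "0 \<le> t" for y t x
    unfolding abs_mult using kappa_le_1[of y] kappa_nonneg[of y] sol_bound[OF that, of y x]
    by (intro mult_mono) auto
  then show "bounded (solution ` ({0..} \<times> Rn 2))"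
    by (auto simp: bounded_iff solution_def)
  have c: "continuous_on ({0..} \<times> Rn 2) (\<lambda>z::real \<times> (nat \<Rightarrow> real). snd z i)" for i
    by (rule continuous_on_product_then_coordinatewise) (intro continuous_on_snd continuous_on_id)
  have "continuous_on ({0..} \<times> Rn 2) (\<lambda>z. (\<lambda>(y, t, x). sol y t x) (snd z 1, fst z, snd z 0))"
    by (rule continuous_on_compose2[OF sol_cont])
      (intro continuous_on_Pair continuous_on_fst continuous_on_id c subset_UNIV)+
  moreover have "continuous_on ({0..} \<times> Rn 2) (\<lambda>z::real \<times> (nat \<Rightarrow> real). kappa (snd z 1))"
    by (rule continuous_on_compose2[OF kappa_cont[of UNIV] c subset_UNIV])
  ultimately show "continuous_on ({0..} \<times> Rn 2) solution"
    unfolding solution_def split_beta by (intro continuous_on_mult) simp_all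
  show "solution (0, x) = initial_value x" for x
    by (simp add: solution_def initial_value_def sol_initial)
qed

lemma solution_slice_solution: "slice_solution drift_xy solution"
  unfolding slice_solution_def
proof (intro exI[of _ "\<lambda>t x. kappa (x 1) * sol_x (x 1) t (x 0)"] allI impI ballI)
  fix t :: real and x :: "nat \<Rightarrow> real" assume t: "0 < t"
  show "\<exists>D D2. ((\<lambda>s. solution (s, x)) has_real_derivative D) (at t) \<and>
     ((\<lambda>s. solution (t, x(0 := s))) has_real_derivative kappa (x 1) * sol_x (x 1) t (x 0)) (at (x 0)) \<and>
     ((\<lambda>s. kappa ((x(0 := s)) 1) * sol_x ((x(0 := s)) 1) t ((x(0 := s)) 0)) has_real_derivative D2) (at (x 0)) \<and>
     D = D2 + drift_xy (x 1) (x 0) * (kappa (x 1) * sol_x (x 1) t (x 0))"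
  proof (rule exI[of _ "kappa (x 1) * sol_t (x 1) t (x 0)"],
      rule exI[of _ "kappa (x 1) * sol_xx (x 1) t (x 0)"], intro conjI)
    show "((\<lambda>s. solution (s, x)) has_real_derivative kappa (x 1) * sol_t (x 1) t (x 0)) (at t)"
      using DERIV_cmult[OF sol_t[OF t]] by (simp add: solution_def)
    show "((\<lambda>s. solution (t, x(0 := s))) has_real_derivative kappa (x 1) * sol_x (x 1) t (x 0)) (at (x 0))"
      using DERIV_cmult[OF sol_x] by (simp add: solution_def)
    show "((\<lambda>s. kappa ((x(0 := s)) 1) * sol_x ((x(0 := s)) 1) t ((x(0 := s)) 0)) has_real_derivative
        kappa (x 1) * sol_xx (x 1) t (x 0)) (at (x 0))"
      using DERIV_cmult[OF sol_xx] by simp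
    show "kappa (x 1) * sol_t (x 1) t (x 0) = kappa (x 1) * sol_xx (x 1) t (x 0)
        + drift_xy (x 1) (x 0) * (kappa (x 1) * sol_x (x 1) t (x 0))"
      unfolding sol_pde by (simp add: algebra_simps)
  qed
qed

lemma solution_viscosity: "bounded_viscosity_solution 2 (drift_field drift_xy) diffusion initial_value solution"
  by (rule slice_solution_viscosity[OF solution_bounded_continuous solution_slice_solution])

section \<open>Uniqueness of the bounded viscosity solution\<close>

lemma coeff_uniform:
  assumes "0 < \<epsilon>"
  shows "\<exists>\<rho>>0. \<forall>x y. \<bar>x\<bar> \<le> R \<longrightarrow> \<bar>y - y0\<bar> \<le> \<rho> \<longrightarrow> \<bar>drift_xy y x - drift_xy y0 x\<bar> < \<epsilon>"
proof -
  \<comment> \<open>Uniformity is limited to bounded x: for y0 = 0 the difference at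
    \<open>x = log_shift y + 1\<close> is \<open>drift 1\<close> > 0, however small y > 0
    is.\<close>
  let ?S = "{y0 - 1..y0 + 1} \<times> {-R..R}"
  have "uniformly_continuous_on ?S (\<lambda>(y, x). drift_xy y x)"
    by (intro compact_uniformly_continuous compact_Times compact_Icc continuous_on_subset[OF continuous_drift_xy]) auto
  then obtain d where d: "0 < d" "\<And>z z'. z \<in> ?S \<Longrightarrow> z' \<in> ?S \<Longrightarrow> dist z' z < d \<Longrightarrow>
      dist ((\<lambda>(y, x). drift_xy y x) z') ((\<lambda>(y, x). drift_xy y x) z) < \<epsilon>"
    using assms unfolding uniformly_continuous_on_def by metis
  show ?thesis
  proof (intro exI[of _ "min 1 (d / 2)"] conjI allI impI)
    fix x y assume "\<bar>x\<bar> \<le> R" "\<bar>y - y0\<bar> \<le> min 1 (d / 2)"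
    then show "\<bar>drift_xy y x - drift_xy y0 x\<bar> < \<epsilon>"
      using d(2)[of "(y0, x)" "(y, x)"] d(1) by (auto simp: dist_real_def dist_Pair_Pair abs_le_iff)
  qed (use d in auto)
qed

lemma kappa_uniform:
  assumes "0 < \<epsilon>"
  shows "\<exists>\<rho>>0. \<forall>y. \<bar>y - y0\<bar> \<le> \<rho> \<longrightarrow> \<bar>kappa y - kappa y0\<bar> \<le> \<epsilon>"
proof -
  obtain d where "0 < d" "\<And>y. dist y y0 < d \<Longrightarrow> dist (kappa y) (kappa y0) < \<epsilon>"
    using kappa_cont[of UNIV] assms unfolding continuous_on_iff by blast
  then have "0 < d / 2" "\<And>y. \<bar>y - y0\<bar> \<le> d / 2 \<Longrightarrow> \<bar>kappa y - kappa y0\<bar> \<le> \<epsilon>"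
    by (auto simp: dist_real_def intro: less_imp_le)
  then show ?thesis by blast
qed

text \<open>The sign \<sigma> lets one proof serve v and - v, which together give both inequalities
  of uniqueness.\<close>

lemma viscosity_le:
  assumes sub: "viscosity_subsolution 3 (spacetime 2) (param_op drift_xy) (\<lambda>z. v (z 0, space_part z))"
    and v: "bounded (v ` ({0..} \<times> Rn 2))" "continuous_on ({0..} \<times> Rn 2) v"
    and v0: "\<And>x. x \<in> Rn 2 \<Longrightarrow> v (0, x) = \<sigma> * initial_value x" and \<sigma>: "\<bar>\<sigma>\<bar> = 1"
    and t: "0 \<le> t"
  shows "v (t, pt x y0) \<le> \<sigma> * solution (t, pt x y0)"
proof -
  obtain Bv where Bv: "\<And>z. z \<in> {0..} \<times> Rn 2 \<Longrightarrow> \<bar>v z\<bar> \<le> Bv"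
    using v(1) by (auto simp: bounded_iff)
  let ?c = "\<sigma> * kappa y0"
  have c: "\<bar>?c\<bar> \<le> 1" using \<sigma> kappa_nonneg[of y0] kappa_le_1[of y0] by (simp add: abs_mult)
  have "v (t, pt x y0) \<le> ?c * sol y0 t x"
  proof (rule comparison[where b = drift_xy and u = "\<lambda>t x. ?c * sol y0 t x" and Bv = Bv and Bu = "1 * chi_bound 0"
      and u\<^sub>t = "\<lambda>t x. ?c * sol_t y0 t x" and u\<^sub>x = "\<lambda>t x. ?c * sol_x y0 t x"
      and u\<^sub>x\<^sub>x = "\<lambda>t x. ?c * sol_xx y0 t x" and Kb = 4, OF sub v(2)])
    show "C_diff 3 (spacetime 2) 2 (\<lambda>z. ?c * sol y0 (z 0) (z 1))"
      by (intro C_diff_mult[OF open_spacetime] C_diff_const[OF open_spacetime] C_diff_sol)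
    have "continuous_on ({0..} \<times> UNIV) (\<lambda>z. (\<lambda>(y, t, x). sol y t x) (y0, fst z, snd z))"
      by (rule continuous_on_compose2[OF sol_cont]) (auto intro!: continuous_intros)
    then show "continuous_on ({0..} \<times> UNIV) (\<lambda>(t, x). ?c * sol y0 t x)"
      unfolding split_beta by (intro continuous_intros) simp
    show "\<bar>?c * sol y0 t x\<bar> \<le> 1 * chi_bound 0" if "0 \<le> t" for t x
      unfolding abs_mult[of ?c] by (intro mult_mono c sol_bound that) auto
    show "\<exists>C. \<forall>t x. 0 < t \<longrightarrow> t \<le> T \<longrightarrow> \<bar>?c * sol_x y0 t x\<bar> \<le> C" for T
    proof -
      obtain C where C: "\<And>t x. 0 < t \<Longrightarrow> t \<le> T \<Longrightarrow> \<bar>sol_x y0 t x\<bar> \<le> C" using sol_x_bound by blast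
      have "\<bar>?c * sol_x y0 t x\<bar> \<le> 1 * C" if "0 < t" "t \<le> T" for t x
        unfolding abs_mult[of ?c] by (intro mult_mono c C that) auto
      then show ?thesis by blast
    qed
    show "\<exists>\<rho>>0. \<forall>x y. \<bar>y - y0\<bar> \<le> \<rho> \<longrightarrow> v (0, pt x y) \<le> ?c * sol y0 0 x + \<epsilon>" if \<epsilon>: "0 < \<epsilon>" for \<epsilon>
    proof -
      obtain \<rho> where \<rho>: "\<rho> > 0" "\<And>y. \<bar>y - y0\<bar> \<le> \<rho> \<Longrightarrow> \<bar>kappa y - kappa y0\<bar> \<le> \<epsilon>"
        using kappa_uniform[OF \<epsilon>] by blast
      show ?thesis
      proof (intro exI[of _ \<rho>] conjI allI impI \<rho>(1))
        fix x y assume y: "\<bar>y - y0\<bar> \<le> \<rho>"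
        have "\<bar>\<sigma> * chi x * (kappa y - kappa y0)\<bar> \<le> 1 * \<epsilon>"
          unfolding abs_mult using \<sigma> chi_nonneg[of x] chi_le_1[of x] \<rho>(2)[OF y] by (intro mult_mono) auto
        then show "v (0, pt x y) \<le> ?c * sol y0 0 x + \<epsilon>"
          by (simp add: v0 initial_value_def sol_initial algebra_simps abs_le_iff)
      qed
    qed
    show "?c * sol_t y0 t x = ?c * sol_xx y0 t x + drift_xy y0 x * (?c * sol_x y0 t x)" for t x
      unfolding sol_pde by (simp add: algebra_simps)
    show "\<exists>\<rho>>0. \<forall>x y. \<bar>x\<bar> \<le> R \<longrightarrow> \<bar>y - y0\<bar> \<le> \<rho> \<longrightarrow> \<bar>drift_xy y x - drift_xy y0 x\<bar> < \<epsilon>" if "0 < \<epsilon>" for R \<epsilon>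
      using that by (rule coeff_uniform)
  qed (use Bv t in \<open>auto intro: DERIV_cmult sol_t sol_x sol_xx coeff_bound\<close>)
  then show ?thesis by (simp add: solution_def)
qed

lemma viscosity_unique:
  assumes v: "bounded_viscosity_solution 2 (drift_field drift_xy) diffusion initial_value v"
    and "0 \<le> t" "x \<in> Rn 2"
  shows "v (t, x) = solution (t, x)"
proof -
  have 3: "Suc 2 = 3" by simp
  have b: "bounded (v ` ({0..} \<times> Rn 2))" "continuous_on ({0..} \<times> Rn 2) v" "\<And>x. x \<in> Rn 2 \<Longrightarrow> v (0, x) = initial_value x"
    and sub: "viscosity_subsolution 3 (spacetime 2) (param_op drift_xy) (\<lambda>z. v (z 0, space_part z))"
    and sup: "viscosity_supersolution 3 (spacetime 2) (param_op drift_xy) (\<lambda>z. v (z 0, space_part z))"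
    using v unfolding bounded_viscosity_solution_def viscosity_solution_def
      bounded_continuous_with_initial_def 3 by auto
  have "bounded ((\<lambda>z. - v z) ` ({0..} \<times> Rn 2))" using b(1) by (auto simp: bounded_iff)
  moreover have "continuous_on ({0..} \<times> Rn 2) (\<lambda>z. - v z)" using b(2) by (rule continuous_on_minus)
  ultimately have "- v (t, pt (x 0) (x 1)) \<le> -1 * solution (t, pt (x 0) (x 1))"
    by (intro viscosity_le[where v = "\<lambda>z. - v z", OF viscosity_subsolution_uminus[OF sup]])
      (use b(3) assms(2) in auto)
  moreover have "v (t, pt (x 0) (x 1)) \<le> 1 * solution (t, pt (x 0) (x 1))"
    by (intro viscosity_le[OF sub b(1,2)]) (use b(3) assms(2) in auto)
  ultimately show ?thesis using Rn2_eq[OF assms(3)] by simp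
qed

section \<open>Lower bound for the gap between slices\<close>

lemma gauss_avg_ge:
  assumes f: "continuous_on UNIV f" "\<And>x. \<bar>f x\<bar> \<le> B" "\<And>x. 0 \<le> f x"
    and c: "0 \<le> c" "\<And>x. a \<le> x \<Longrightarrow> x \<le> a + 1 \<Longrightarrow> c \<le> f x"
    and s: "1/2 \<le> s" "s \<le> 2" and r: "\<bar>a\<bar> \<le> r" "\<bar>x\<bar> \<le> r"
  shows "c * (exp (- (2 * (2 * r + 1)\<^sup>2)) / (2 * sqrt (2 * pi))) \<le> gauss_avg f s x"
proof -
  \<comment> \<open>The value z = l sends x + s z to a. A window of length 1/2 stays within
    [a, a + 1] because s \<le> 2, and s \<ge> 1/2 gives the bound 2 (2 r + 1) on z there, hence the
    lower bound on the density.\<close>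
  define l where "l = (a - x) / s"
  define g where "g = c * ((1 / sqrt (2 * pi)) * exp (- (2 * (2 * r + 1)\<^sup>2)))"
  have g: "0 \<le> g" using c by (simp add: g_def)
  have meas: "(\<lambda>z. f (x + s * z)) \<in> borel_measurable borel"
    by (rule borel_measurable_affine[OF f(1)])
  have int: "integrable lborel (\<lambda>z. std_normal_density z * f (x + s * z))"
    using integrable_gauss_avg[OF f(1,2), of x s] meas unfolding gauss_def
    by (subst (asm) integrable_density) auto
  have "c * (exp (- (2 * (2 * r + 1)\<^sup>2)) / (2 * sqrt (2 * pi))) = (1/2) * g"
    by (simp add: g_def)
  also have "\<dots> = (\<integral>z. indicator {l..l + 1/2} z * g \<partial>lborel)"
    by simp
  also have "\<dots> \<le> (\<integral>z. std_normal_density z * f (x + s * z) \<partial>lborel)"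
  proof (rule integral_mono)
    show "integrable lborel (\<lambda>z. indicator {l..l + 1/2} z * g)"
      by (intro integrable_mult_left integrable_real_indicator) (simp, rule emeasure_compact_finite[OF compact_Icc])
    show "indicator {l..l + 1/2} z * g \<le> std_normal_density z * f (x + s * z)" for z
    proof (cases "z \<in> {l..l + 1/2}")
      case True
      have sl: "s * l = a - x" using s by (simp add: l_def)
      have "s * l \<le> s * z" "s * z \<le> s * (l + 1/2)"
        using True s by (auto intro: mult_left_mono)
      moreover have "s * (l + 1/2) \<le> a - x + 1" using s sl by (simp add: distrib_left)
      ultimately have sz: "a \<le> x + s * z" "x + s * z \<le> a + 1" using sl by linarith+
      have "1/2 * \<bar>z\<bar> \<le> s * \<bar>z\<bar>" using s by (intro mult_right_mono) auto
      also have "\<dots> = \<bar>s * z\<bar>" using s by (simp add: abs_mult)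
      also have "\<dots> \<le> 2 * r + 1" using sz r by (simp add: abs_le_iff)
      finally have "\<bar>z\<bar> \<le> 2 * (2 * r + 1)" by simp
      also have "\<dots> \<le> \<bar>2 * (2 * r + 1)\<bar>" by (rule abs_ge_self)
      finally have "\<bar>z\<bar> \<le> \<bar>2 * (2 * r + 1)\<bar>" .
      then have "z\<^sup>2 \<le> (2 * (2 * r + 1))\<^sup>2" by (simp only: abs_le_square_iff)
      then have "z\<^sup>2 \<le> 4 * (2 * r + 1)\<^sup>2" unfolding power_mult_distrib by simp
      then have "exp (- (2 * (2 * r + 1)\<^sup>2)) \<le> exp (- z\<^sup>2 / 2)" by simp
      then have "(1 / sqrt (2 * pi)) * exp (- (2 * (2 * r + 1)\<^sup>2)) \<le> std_normal_density z"
        unfolding std_normal_density_def by (intro mult_left_mono) auto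
      then have "((1 / sqrt (2 * pi)) * exp (- (2 * (2 * r + 1)\<^sup>2))) * c \<le> std_normal_density z * f (x + s * z)"
        using c(1) c(2)[OF sz] by (intro mult_mono) auto
      then show ?thesis using True by (simp add: g_def mult.commute)
    qed (use f(3) in simp)
  qed (rule int)
  also have "\<dots> = gauss_avg f s x"
    unfolding gauss_avg_def gauss_def using meas by (subst integral_density) auto
  finally show ?thesis .
qed

lemma positive_lower_bound:
  fixes f :: "real \<Rightarrow> real"
  assumes "continuous_on UNIV f" "\<And>x. a \<le> x \<Longrightarrow> x \<le> b \<Longrightarrow> 0 < f x" "a \<le> b"
  obtains c where "0 < c" "\<And>x. a \<le> x \<Longrightarrow> x \<le> b \<Longrightarrow> c \<le> f x"
proof -
  obtain z where z: "z \<in> {a..b}" "\<And>x. x \<in> {a..b} \<Longrightarrow> f z \<le> f x"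
    using continuous_attains_inf[of "{a..b}" f] assms continuous_on_subset by force
  show ?thesis by (rule that[of "f z"]) (use z assms in auto)
qed

lemma sqrt_window:
  assumes "1/4 \<le> r" "r \<le> 3/4"
  shows "1/2 \<le> sqrt (2 * r)" "sqrt (2 * r) \<le> 2"
proof -
  show "1/2 \<le> sqrt (2 * r)" by (rule real_le_rsqrt) (use assms in \<open>simp add: power2_eq_square\<close>)
  show "sqrt (2 * r) \<le> 2" by (rule real_le_lsqrt) (use assms in \<open>simp_all add: power2_eq_square\<close>)
qed

text \<open>In the first-order term, heat travels between -1 and the interval from
  \<open>log_shift y + 1\<close> to \<open>log_shift y + 2\<close>, where the translated potential
  is bounded below, and between there and the bulk of \<open>chi\<close>. Restricting r to
  [1/4, 3/4] keeps both travel times away from 0, so each journey costs one Gaussian factor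
  \<open>E y\<close>, and the product of the two is the stated exponential.\<close>

lemma sol_gap: "\<exists>c>0. \<forall>y>0. c * exp (- (4 * (2 * log_shift y + 5)\<^sup>2)) \<le> sol 0 1 (-1) - sol y 1 (-1)"
proof -
  have pc: "continuous_on UNIV potential" by (rule k_diff_cont[OF k_diff_potential])
  have cc: "continuous_on UNIV chi" by (rule k_diff_cont[OF k_diff_chi])
  have pp: "0 < potential x" if "1 \<le> x" for x
    using that profile_ge_1[of x] by (simp add: potential_def flat_exp_def)
  obtain c0 where c0: "0 < c0" "\<And>x. 1 \<le> x \<Longrightarrow> x \<le> 2 \<Longrightarrow> c0 \<le> potential x"
    using positive_lower_bound[OF pc, of 1 2] pp by auto
  obtain c1 where c1: "0 < c1" "\<And>x. -3/2 \<le> x \<Longrightarrow> x \<le> -1/2 \<Longrightarrow> c1 \<le> chi x"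
    using positive_lower_bound[OF cc, of "-3/2" "-1/2"] chi_pos by auto
  define k where "k = 1 / (2 * sqrt (2 * pi))"
  have k: "0 < k" by (simp add: k_def)
  \<comment> \<open>The radius \<open>log_shift y + 2\<close> covers start and target of both
    journeys, so one bound from \<open>gauss_avg_ge\<close> serves twice.\<close>
  define E where "E y = exp (- (2 * (2 * (log_shift y + 2) + 1)\<^sup>2))" for y
  have E: "0 < E y" for y by (simp add: E_def)
  have "exp (-6) * (1/2 * (c0 * (c1 * (E y * k)) * (E y * k))) \<le> sol 0 1 (-1) - sol y 1 (-1)" if y: "0 < y" for y
  proof -
    have L: "0 \<le> log_shift y" by (rule shift_nonneg)
    define F where "F t x = potential (x - log_shift y) * gauss_avg chi (sqrt (2 * t)) x" for t x
    have chi_avg: "\<bar>gauss_avg chi s x\<bar> \<le> 1" for s x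
      by (rule gauss_avg_abs_le[OF cc]) (use chi_nonneg chi_le_1 in auto)
    have F_bd: "\<bar>F t x\<bar> \<le> 6 * 1" for t x
      unfolding F_def abs_mult using potential_nonneg potential_le
      by (intro mult_mono chi_avg) auto
    have F_nn: "0 \<le> F t x" for t x
      unfolding F_def by (intro mult_nonneg_nonneg potential_nonneg gauss_avg_nonneg chi_nonneg)
    have F_cont: "continuous_on UNIV (\<lambda>(t, x). F t x)"
    proof -
      have "continuous_on UNIV (\<lambda>z. (\<lambda>(p, t, x). hp.V 0 0 p t x) (0, fst z, snd z))"
        by (rule continuous_on_compose2[OF hp.continuous_V0]) (auto intro!: continuous_intros)
      then have "continuous_on UNIV (\<lambda>z. gauss_avg chi (sqrt (2 * fst z)) (snd z))"
        by (simp add: split_beta)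
      moreover have "continuous_on UNIV (\<lambda>z::real \<times> real. potential (snd z - log_shift y))"
        by (rule continuous_on_compose2[OF pc]) (auto intro!: continuous_intros)
      ultimately show ?thesis unfolding F_def split_beta by (intro continuous_on_mult)
    qed
    have Fc: "continuous_on UNIV (F t)" for t
      using continuous_on_compose2[OF F_cont continuous_on_Pair[OF continuous_on_const continuous_on_id]]
      by (simp add: subset_UNIV)
    have F_ge: "c0 * (c1 * (E y * k)) \<le> F r x"
      if r: "1/4 \<le> r" "r \<le> 3/4" and x: "log_shift y + 1 \<le> x" "x \<le> log_shift y + 1 + 1" for r x
    proof -
      have "c1 * (exp (- (2 * (2 * (log_shift y + 2) + 1)\<^sup>2)) / (2 * sqrt (2 * pi))) \<le> gauss_avg chi (sqrt (2 * r)) x"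
        by (rule gauss_avg_ge[OF cc, where a = "-3/2" and B = 1])
          (use c1 chi_nonneg chi_le_1 sqrt_window[OF r] x L in auto)
      then have "c1 * (E y * k) \<le> gauss_avg chi (sqrt (2 * r)) x"
        by (simp add: E_def k_def)
      moreover have "c0 \<le> potential (x - log_shift y)" using x by (intro c0) auto
      ultimately show ?thesis
        unfolding F_def using c0(1) c1(1) E[of y] k potential_nonneg by (intro mult_mono) auto
    qed
    have avg_ge: "c0 * (c1 * (E y * k)) * (E y * k) \<le> gauss_avg (F r) (sqrt (2 * (1 - r))) (-1)"
      if r: "r \<in> {1/4..3/4}" for r
    proof -
      have "c0 * (c1 * (E y * k)) * (exp (- (2 * (2 * (log_shift y + 2) + 1)\<^sup>2)) / (2 * sqrt (2 * pi)))
          \<le> gauss_avg (F r) (sqrt (2 * (1 - r))) (-1)"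
        by (rule gauss_avg_ge[OF Fc F_bd F_nn, where a = "log_shift y + 1"])
          (use r F_ge L c0(1) c1(1) E[of y] k sqrt_window[of "1 - r"] in auto)
      then show ?thesis by (simp add: E_def k_def)
    qed
    have I: "(\<lambda>r. gauss_avg (F (1 * r)) (sqrt (2 * (1 - 1 * r))) (-1)) integrable_on {0..1}"
      by (rule duhamel_integrable[OF F_cont, of "\<lambda>_. 6 * 1"]) (use F_bd in auto)
    have "1/2 * (c0 * (c1 * (E y * k)) * (E y * k)) = integral {1/4..3/4} (\<lambda>r::real. c0 * (c1 * (E y * k)) * (E y * k))"
      by simp
    also have "\<dots> \<le> integral {1/4..3/4} (\<lambda>r. gauss_avg (F r) (sqrt (2 * (1 - r))) (-1))"
    proof (rule integral_le)
      show "(\<lambda>r. gauss_avg (F r) (sqrt (2 * (1 - r))) (-1)) integrable_on {1/4..3/4}"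
        using integrable_on_subinterval[OF I, of "1/4" "3/4"] by simp
    qed (use avg_ge in auto)
    also have "\<dots> \<le> integral {0..1} (\<lambda>r. gauss_avg (F r) (sqrt (2 * (1 - r))) (-1))"
    proof (rule integral_subset_le)
      show "(\<lambda>r. gauss_avg (F r) (sqrt (2 * (1 - r))) (-1)) integrable_on {1/4..3/4}"
        using integrable_on_subinterval[OF I, of "1/4" "3/4"] by simp
    qed (use I F_nn in \<open>auto intro: gauss_avg_nonneg\<close>)
    also have "\<dots> = duhamel F 1 (-1)" by (simp add: duhamel_def)
    also have "\<dots> = duhamel (\<lambda>t x. (pot 0 0 x - pot 0 y x) * gauss_avg chi (sqrt (2 * t)) x) 1 (-1)"
      using y by (simp add: F_def[abs_def] pot_0 shifted_def)
    also have "\<dots> \<le> hp.w 0 0 1 (-1) - hp.w 0 y 1 (-1)"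
      using hp.w_diff_ge[of y 0 1 "-1"] pot_0_bounds chi_nonneg potential_nonneg
      by (auto simp: pot_0 shifted_def)
    \<comment> \<open>At x = -1 the weight is 1 for both slices, so the gap of the series is the gap
      of \<open>sol\<close> up to the factor \<open>exp (-6)\<close>.\<close>
    finally show ?thesis
      by (simp add: sol_def weight_left right_diff_distrib[symmetric] mult_left_mono)
  qed
  moreover have "E y * E y = exp (- (4 * (2 * log_shift y + 5)\<^sup>2))" for y
    by (simp add: E_def exp_add[symmetric] algebra_simps)
  ultimately show ?thesis
    using c0(1) c1(1) k
    by (intro exI[of _ "exp (-6) * (1/2 * (c0 * (c1 * k) * k))"]) (force simp: mult_ac)
qed

lemma solution_gap: "\<exists>c>0. \<forall>n. c * exp (- (4 * (2 * ln (1 + (real n)\<^sup>2) + 5)\<^sup>2))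
    \<le> solution (1, pt (-1) 0) - solution (1, pt (-1) (exp (- real n)))"
proof -
  obtain c where c: "0 < c" "\<And>y. 0 < y \<Longrightarrow> c * exp (- (4 * (2 * log_shift y + 5)\<^sup>2)) \<le> sol 0 1 (-1) - sol y 1 (-1)"
    using sol_gap by blast
  have k0: "0 < kappa 0" by (simp add: kappa_def flat_exp_def)
  show ?thesis
  proof (intro exI[of _ "kappa 0 * c"] conjI allI)
    fix n
    let ?y = "exp (- real n)"
    have "kappa 0 * (c * exp (- (4 * (2 * log_shift ?y + 5)\<^sup>2))) \<le> kappa 0 * (sol 0 1 (-1) - sol ?y 1 (-1))"
      using k0 c(2)[of ?y] by (intro mult_left_mono) auto
    \<comment> \<open>Replacing \<open>kappa 0\<close> by the smaller \<open>kappa ?y\<close> in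
      front of the nonnegative second term only widens the gap.\<close>
    also have "\<dots> \<le> kappa 0 * sol 0 1 (-1) - kappa ?y * sol ?y 1 (-1)"
      using mult_right_mono[OF kappa_le_0[of ?y] sol_nonneg[of 1 ?y "-1"]] by (simp add: right_diff_distrib)
    finally show "kappa 0 * c * exp (- (4 * (2 * ln (1 + (real n)\<^sup>2) + 5)\<^sup>2))
        \<le> solution (1, pt (-1) 0) - solution (1, pt (-1) ?y)"
      by (simp add: solution_def log_shift_def mult.assoc)
  qed (use k0 c in simp)
qed

text \<open>The values at \<open>y = exp (-n)\<close> beat every power of \<open>y\<close>, because \<open>log_shift y\<close> grows only
  logarithmically in \<open>n\<close>.\<close>

lemma solution_not_power_bounded:
  assumes \<alpha>: "0 < \<alpha>"
    and bd: "\<forall>\<^sub>F n in sequentially. \<bar>solution (1, pt (-1) 0) - solution (1, pt (-1) (exp (- real n)))\<bar> \<le> C * exp (- real n) powr \<alpha>"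
  shows False
proof -
  obtain c where c: "0 < c" "\<And>n. c * exp (- (4 * (2 * ln (1 + (real n)\<^sup>2) + 5)\<^sup>2))
    \<le> solution (1, pt (-1) 0) - solution (1, pt (-1) (exp (- real n)))"
    using solution_gap by blast
  have "filterlim (\<lambda>n. \<alpha> * real n - 4 * (2 * ln (1 + (real n)\<^sup>2) + 5)\<^sup>2) at_top sequentially"
    using \<alpha> by real_asymp
  then have "filterlim (\<lambda>n. c * exp (\<alpha> * real n - 4 * (2 * ln (1 + (real n)\<^sup>2) + 5)\<^sup>2)) at_top sequentially"
    using c(1) by (intro filterlim_tendsto_pos_mult_at_top[OF tendsto_const] filterlim_compose[OF exp_at_top]) auto
  then have "\<forall>\<^sub>F n in sequentially. C < c * exp (\<alpha> * real n - 4 * (2 * ln (1 + (real n)\<^sup>2) + 5)\<^sup>2)"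
    by (simp add: filterlim_at_top_dense)
  with bd have "\<forall>\<^sub>F n in sequentially. False"
  proof eventually_elim
    case (elim n)
    let ?q = "4 * (2 * ln (1 + (real n)\<^sup>2) + 5)\<^sup>2"
    have "c * exp (- ?q) \<le> C * exp (- (\<alpha> * real n))"
      using c(2)[of n] elim(1) by (simp add: exp_powr_real mult.commute abs_le_iff)
    then have "c * exp (- ?q) * exp (\<alpha> * real n) \<le> C * exp (- (\<alpha> * real n)) * exp (\<alpha> * real n)"
      by (rule mult_right_mono) simp
    moreover have "exp (- (\<alpha> * real n)) * exp (\<alpha> * real n) = 1" by (simp flip: exp_add)
    moreover have "exp (- ?q) * exp (\<alpha> * real n) = exp (\<alpha> * real n - ?q)" by (simp flip: exp_add)
    ultimately have "c * exp (\<alpha> * real n - ?q) \<le> C" by (simp add: mult.assoc)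
    then show ?case using elim(2) by simp
  qed
  then show False by simp
qed

lemma exp_neg_nat_tendsto: "(\<lambda>n. exp (- real n)) \<longlonglongrightarrow> 0"
  by real_asymp

lemma solution_not_hoelder: "\<not> locally_hoelder 2 solution"
proof
  assume "locally_hoelder 2 solution"
  moreover have "(1::real, pt (-1) 0) \<in> {0..} \<times> Rn 2" by simp
  ultimately obtain V \<alpha> where V: "openin (top_of_set ({0..} \<times> Rn 2)) V" "(1, pt (-1) 0) \<in> V"
    and \<alpha>: "0 < \<alpha>" and h: "hoelder_on 2 \<alpha> V solution"
    unfolding locally_hoelder_def by blast
  obtain C where C: "\<And>p q. p \<in> V \<Longrightarrow> q \<in> V \<Longrightarrow> \<bar>solution p - solution q\<bar> \<le> C * euclid_dist 2 p q powr \<alpha>"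
    using h unfolding hoelder_on_def by blast
  obtain T where T: "open T" "V = ({0..} \<times> Rn 2) \<inter> T" using V(1) by (auto simp: openin_open)
  have "continuous_on UNIV (\<lambda>y. (1::real, pt (-1) y))"
    by (intro continuous_on_Pair continuous_on_pt continuous_on_const continuous_on_id)
  then have "(\<lambda>n. (1::real, pt (-1) (exp (- real n)))) \<longlonglongrightarrow> (1, pt (-1) 0)"
    using exp_neg_nat_tendsto by (rule continuous_on_tendsto_compose) auto
  then have "\<forall>\<^sub>F n in sequentially. (1::real, pt (-1) (exp (- real n))) \<in> T"
    by (rule topological_tendstoD) (use T V in auto)
  then have "\<forall>\<^sub>F n in sequentially. \<bar>solution (1, pt (-1) 0) - solution (1, pt (-1) (exp (- real n)))\<bar> \<le> C * exp (- real n) powr \<alpha>"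
  proof eventually_elim
    case (elim n)
    have "euclid_dist 2 (1, pt (-1) 0) (1, pt (-1) (exp (- real n))) = exp (- real n)"
      by (simp add: euclid_dist_def L2_set_def numeral_2_eq_2)
    then show ?case using C[OF V(2), of "(1, pt (-1) (exp (- real n)))"] elim T by simp
  qed
  then show False by (rule solution_not_power_bounded[OF \<alpha>])
qed

section \<open>Nonexistence of a classical solution\<close>

lemma no_classical: "\<not> bounded_classical_solution 2 (drift_field drift_xy) diffusion initial_value u"
proof
  assume u: "bounded_classical_solution 2 (drift_field drift_xy) diffusion initial_value u"
  then have bc: "bounded_continuous_with_initial 2 initial_value u" and C: "C_1_2 2 u"
    and pde: "\<And>t x. 0 < t \<Longrightarrow> x \<in> Rn 2 \<Longrightarrow> time_deriv u (t, x) =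
          (\<Sum>i<2. \<Sum>j<2. diffusion i j * space_partial i (space_partial j u) (t, x)) +
          (\<Sum>i<2. drift_field drift_xy x i * space_partial i u (t, x))"
    by (auto simp: bounded_classical_solution_def)
  have D: "((\<lambda>s. f (x(i := s))) has_real_derivative partial i f x) (at (x i))" if "has_partial i f x" for i f x
    using that by (auto simp: has_partial_def partial_def real_differentiable_def dest: DERIV_imp_deriv)
  have "slice_solution drift_xy u"
    unfolding slice_solution_def
  proof (intro exI[of _ "\<lambda>t x. space_partial 0 u (t, x)"] allI impI ballI)
    fix t :: real and x assume t: "0 < t" and x: "x \<in> Rn 2"
    have "((\<lambda>s. u (s, x)) has_real_derivative time_deriv u (t, x)) (at t)"
      using C t x by (auto simp: C_1_2_def time_deriv_def real_differentiable_def dest: DERIV_imp_deriv)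
    moreover have "((\<lambda>s. u (t, x(0 := s))) has_real_derivative space_partial 0 u (t, x)) (at (x 0))"
      using C t x D[of 0 "\<lambda>y. u (t, y)" x] by (simp add: C_1_2_def space_partial_def)
    moreover have "((\<lambda>s. space_partial 0 u (t, x(0 := s))) has_real_derivative
        space_partial 0 (space_partial 0 u) (t, x)) (at (x 0))"
      using C t x D[of 0 "\<lambda>y. space_partial 0 u (t, y)" x] by (simp add: C_1_2_def space_partial_def)
    moreover have "time_deriv u (t, x) = space_partial 0 (space_partial 0 u) (t, x) + drift_xy (x 1) (x 0) * space_partial 0 u (t, x)"
      using pde[OF t x] by (simp add: numeral_2_eq_2 diffusion_def drift_field_def)
    ultimately show "\<exists>D D2. ((\<lambda>s. u (s, x)) has_real_derivative D) (at t) \<and>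
       ((\<lambda>s. u (t, x(0 := s))) has_real_derivative space_partial 0 u (t, x)) (at (x 0)) \<and>
       ((\<lambda>s. space_partial 0 u (t, x(0 := s))) has_real_derivative D2) (at (x 0)) \<and>
       D = D2 + drift_xy (x 1) (x 0) * space_partial 0 u (t, x)" by blast
  qed
  from viscosity_unique[OF slice_solution_viscosity[OF bc this]]
  have eq: "u (1, pt (-1) y) = solution (1, pt (-1) y)" for y by simp
  \<comment> \<open>A derivative in y at the origin of the parameter bounds the increments by a
    multiple of y, which is the excluded power bound with exponent 1.\<close>
  have "has_partial 1 (\<lambda>y. u (1, y)) (pt (-1) 0)"
    using C by (simp add: C_1_2_def)
  from D[OF this] have "\<exists>d. ((\<lambda>s. u (1, (pt (-1) 0)(1 := s))) has_real_derivative d) (at 0)"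
    by (auto simp del: fun_upd_apply)
  moreover have "(pt (-1) 0)(1 := s) = pt (-1) s" for s by (auto simp: pt_def)
  ultimately obtain d where "((\<lambda>s. solution (1, pt (-1) s)) has_real_derivative d) (at 0)"
    using eq by auto
  then have lim: "((\<lambda>h. (solution (1, pt (-1) (0 + h)) - solution (1, pt (-1) 0)) / h) \<longlongrightarrow> d) (at 0)"
    by (simp add: DERIV_def)
  have "filterlim (\<lambda>n. exp (- real n)) (at 0) sequentially"
    using exp_neg_nat_tendsto by (auto simp: filterlim_at)
  from filterlim_compose[OF lim this]
  have "(\<lambda>n. \<bar>(solution (1, pt (-1) (0 + exp (- real n))) - solution (1, pt (-1) 0)) / exp (- real n)\<bar>) \<longlonglongrightarrow> \<bar>d\<bar>"
    by (rule tendsto_rabs)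
  then have "\<forall>\<^sub>F n in sequentially. \<bar>(solution (1, pt (-1) (0 + exp (- real n))) - solution (1, pt (-1) 0)) / exp (- real n)\<bar> < \<bar>d\<bar> + 1"
    by (rule order_tendstoD) simp
  then have "\<forall>\<^sub>F n in sequentially. \<bar>solution (1, pt (-1) 0) - solution (1, pt (-1) (exp (- real n)))\<bar> \<le> (\<bar>d\<bar> + 1) * exp (- real n) powr 1"
    by eventually_elim (simp add: abs_minus_commute pos_divide_less_eq abs_divide less_imp_le)
  then show False by (rule solution_not_power_bounded[OF zero_less_one])
qed

theorem theorem1p1:
  shows "\<exists>(d::nat) (\<mu> :: (nat \<Rightarrow> real) \<Rightarrow> nat \<Rightarrow> real) (A :: nat \<Rightarrow> nat \<Rightarrow> real)
           (\<phi> :: (nat \<Rightarrow> real) \<Rightarrow> real).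
     1 \<le> d \<and>
     \<mu> \<in> Rn d \<rightarrow> Rn d \<and>
     (\<exists>C. \<forall>x\<in>Rn d. L2_set (\<mu> x) {..<d} \<le> C) \<and>
     (\<forall>i<d. C_infinity d (\<lambda>x. \<mu> x i)) \<and>
     A \<in> sym_mats d \<and> mat_le d (\<lambda>i j. 0) A \<and>
     C_infinity d \<phi> \<and> compact (closure {x \<in> Rn d. \<phi> x \<noteq> 0}) \<and>
     \<not> (\<exists>u. bounded_classical_solution d \<mu> A \<phi> u) \<and>
     (\<exists>u. bounded_viscosity_solution d \<mu> A \<phi> u \<and>
        (\<forall>v. bounded_viscosity_solution d \<mu> A \<phi> v \<longrightarrow>
           (\<forall>t\<ge>0. \<forall>x\<in>Rn d. v (t, x) = u (t, x))) \<and>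
        \<not> locally_hoelder d u)"
proof (intro exI[of _ "2::nat"] exI[of _ "drift_field drift_xy"] exI[of _ diffusion] exI[of _ initial_value] conjI)
  show "drift_field drift_xy \<in> Rn 2 \<rightarrow> Rn 2"
    by (auto simp: Rn_iff drift_field_def)
  show "\<exists>C. \<forall>x\<in>Rn 2. L2_set (drift_field drift_xy x) {..<2} \<le> C"
    using drift_field_bounded by blast
  show "\<exists>u. bounded_viscosity_solution 2 (drift_field drift_xy) diffusion initial_value u \<and>
      (\<forall>v. bounded_viscosity_solution 2 (drift_field drift_xy) diffusion initial_value v \<longrightarrow>
        (\<forall>t\<ge>0. \<forall>x\<in>Rn 2. v (t, x) = u (t, x))) \<and> \<not> locally_hoelder 2 u"
    using solution_viscosity viscosity_unique solution_not_hoelder by blast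
qed (use drift_field_smooth diffusion_sym diffusion_nonneg initial_value_smooth compact_support_initial_value no_classical in auto)

end
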